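(* Let $C$ be a compact tropical curve of genus $g$ with canonical divisor $K$. For every divisor $D$ on $C$ of degree $d$, $$\dim|D|-\dim|K-D|=d-g+1.$$
   Context: A compact tropical curve $C$ is a connected finite (1-dimensional) graph, loops and multiple edges allowed, with a metric structure: each inner edge (one not adjacent to a 1-valent vertex) has a finite positive length, and each leaf (edge adjacent to a 1-valent vertex) has infinite length, the 1-valent vertices (the endpoints) lying at infinity. 2-valent vertices may be inserted or removed freely, so an interior point of an edge has valence 2. $C^\circ$ is the complement of the endpoints. The genus is $g=b_1(C)$. A rational function on $C$ is a continuous function $f:C^\circ\to\mathbb{R}$ that is piecewise linear with finitely many linear pieces and integer slopes with respect to arc length. For $p\in C$, $\operatorname{ord}_p(f)$ is the sum of the slopes of $f$ at $p$ along all edge directions emanating from $p$ (at an endpoint $p$: the slope of $f$ on the leaf near $p$ in the direction pointing away from $p$). $(f)=\sum_p\operatorname{ord}_p(f)\,p$. A divisor is a finite formal sum $D=\sum a_ip_i$, $a_i\in\mathbb{Z}$, $p_i\in C$; its degree is $\sum a_i$; it is effective if all $a_i\ge0$. $D_1\sim D_2$ if $D_1-D_2=(f)$ for some rational function $f$. $|D|$ is the set of effective divisors linearly equivalent to $D$. If $|D|=\emptyset$, set $\dim|D|=-1$. Otherwise $\dim|D|$ is the maximal integer $r\ge0$ such that $|D-R|\ne\emptyset$ for every effective divisor $R$ of degree $r$. The canonical divisor is $K=\sum_{p\in C}(\operatorname{val}(p)-2)\,p$, where $\operatorname{val}(p)$ is the valence of $p$. *)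

theory Defs
  imports
    "HOL-Analysis.Analysis"
    "HOL-Library.Poly_Mapping"
    "Graph_Theory.Graph_Theory"
begin

section \<open>Compact tropical curves\<close>

text \<open>
  The underlying graph is an arbitrary multigraph, given by a digraph: the direction of an arc
  has no geometric meaning and only fixes a reference orientation along which the edge is
  parametrized. A tropical curve has many such models (other orientations, other choices of
  2-valent vertices); all notions below are defined for a model.
\<close>

record ('v, 'e) metric_graph =
  graph :: "('v, 'e) pre_digraph"
  len :: "'e \<Rightarrow> ereal"

definition vertex_val :: "('v, 'e) metric_graph \<Rightarrow> 'v \<Rightarrow> nat" where
  "vertex_val C v = in_degree (graph C) v + out_degree (graph C) v"  \<comment> \<open>a loop counts twice\<close>

definition endpoint :: "('v, 'e) metric_graph \<Rightarrow> 'v \<Rightarrow> bool" where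
  "endpoint C v \<longleftrightarrow> v \<in> verts (graph C) \<and> vertex_val C v = 1"

definition leaf :: "('v, 'e) metric_graph \<Rightarrow> 'e \<Rightarrow> bool" where
  "leaf C e \<longleftrightarrow> e \<in> arcs (graph C) \<and>
     (endpoint C (tail (graph C) e) \<or> endpoint C (head (graph C) e))"

definition tropical_curve :: "('v, 'e) metric_graph \<Rightarrow> bool" where
  "tropical_curve C \<longleftrightarrow>
     fin_digraph (graph C) \<and> Digraph_Component.connected (graph C) \<and>
     (\<forall>e\<in>arcs (graph C). if leaf C e then len C e = \<infinity> else 0 < len C e \<and> len C e < \<infinity>)"

text \<open>
  Arc length identifies the open edge \<open>e\<close> with the open interval from \<open>lo C e\<close> to \<open>hi C e\<close>, the
  coordinate increasing from tail to head: \<open>(0, len)\<close> for an inner edge, \<open>(0, \<infinity>)\<close> or \<open>(-\<infinity>, 0)\<close> for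
  a leaf with one endpoint, and \<open>(-\<infinity>, \<infinity>)\<close> if both ends of \<open>e\<close> are endpoints. An end of an edge
  is an endpoint of the curve iff its coordinate is infinite.
\<close>

definition lo :: "('v, 'e) metric_graph \<Rightarrow> 'e \<Rightarrow> ereal" where
  "lo C e = (if endpoint C (tail (graph C) e) then - \<infinity> else 0)"

definition hi :: "('v, 'e) metric_graph \<Rightarrow> 'e \<Rightarrow> ereal" where
  "hi C e = (if endpoint C (tail (graph C) e) \<and> \<not> endpoint C (head (graph C) e)
             then 0 else len C e)"

datatype ('v, 'e) point = Vertex 'v | Inner 'e real

definition points :: "('v, 'e) metric_graph \<Rightarrow> ('v, 'e) point set" where
  "points C = Vertex ` verts (graph C) \<union>
     {Inner e t | e t. e \<in> arcs (graph C) \<and> lo C e < ereal t \<and> ereal t < hi C e}"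

definition finite_part :: "('v, 'e) metric_graph \<Rightarrow> ('v, 'e) point set" where
  "finite_part C = points C - Vertex ` {v. endpoint C v}"  \<comment> \<open>this is \<open>C\<degree>\<close>\<close>

text \<open>
  \<open>chart C e\<close> maps \<open>edge_dom C e\<close> onto the part of the closed edge \<open>e\<close> that lies in
  \<open>finite_part C\<close>; infinite values of \<open>lo\<close> and \<open>hi\<close> are never attained.
\<close>

definition edge_dom :: "('v, 'e) metric_graph \<Rightarrow> 'e \<Rightarrow> real set" where
  "edge_dom C e = {t. lo C e \<le> ereal t \<and> ereal t \<le> hi C e}"

definition chart :: "('v, 'e) metric_graph \<Rightarrow> 'e \<Rightarrow> real \<Rightarrow> ('v, 'e) point" where
  "chart C e t = (if ereal t = lo C e then Vertex (tail (graph C) e)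
                  else if ereal t = hi C e then Vertex (head (graph C) e)
                  else Inner e t)"

lemma chart_in_finite_part:
  assumes "tropical_curve C" "e \<in> arcs (graph C)" "t \<in> edge_dom C e"
  shows "chart C e t \<in> finite_part C"
proof -
  interpret fin_digraph "graph C" using assms(1) by (simp add: tropical_curve_def)
  show ?thesis
    using assms(2,3)
    by (auto simp: chart_def finite_part_def points_def edge_dom_def lo_def hi_def
        order.strict_iff_order leaf_def split: if_splits)
      (use assms(1,2) in \<open>auto simp: tropical_curve_def leaf_def dest!: bspec[of _ _ e]\<close>)
qed


section \<open>Genus\<close>

text \<open>
  The genus is the first Betti number \<open>b\<^sub>1(C)\<close>, the dimension of \<open>H\<^sub>1\<close> (with real
  coefficients) of the graph as a 1-dimensional cell complex. As there are no 2-cells,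
  \<open>H\<^sub>1\<close> is the space of 1-cycles.
\<close>

definition boundary :: "('v, 'e) metric_graph \<Rightarrow> ('e \<Rightarrow>\<^sub>0 real) \<Rightarrow> ('v \<Rightarrow>\<^sub>0 real)" where
  "boundary C c = (\<Sum>e\<in>Poly_Mapping.keys c.
     Poly_Mapping.single (head (graph C) e) (Poly_Mapping.lookup c e) -
     Poly_Mapping.single (tail (graph C) e) (Poly_Mapping.lookup c e))"

definition cycles :: "('v, 'e) metric_graph \<Rightarrow> ('e \<Rightarrow>\<^sub>0 real) set" where
  "cycles C = {c. Poly_Mapping.keys c \<subseteq> arcs (graph C) \<and> boundary C c = 0}"

definition chain_scale :: "real \<Rightarrow> ('e \<Rightarrow>\<^sub>0 real) \<Rightarrow> ('e \<Rightarrow>\<^sub>0 real)" where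
  "chain_scale r c = Poly_Mapping.map ((*) r) c"

lemma lookup_chain_scale [simp]:
  "Poly_Mapping.lookup (chain_scale r c) e = r * Poly_Mapping.lookup c e"
  by (simp add: chain_scale_def Poly_Mapping.map.rep_eq when_def)

lemma vector_space_chain_scale: "vector_space chain_scale"
  by unfold_locales (auto intro!: poly_mapping_eqI simp: lookup_add algebra_simps)

definition genus :: "('v, 'e) metric_graph \<Rightarrow> nat" where
  "genus C = vector_space.dim chain_scale (cycles C)"


section \<open>Rational functions\<close>

definition pw_linear_on :: "real set \<Rightarrow> (real \<Rightarrow> real) \<Rightarrow> bool" where
  "pw_linear_on I h \<longleftrightarrow>
     (\<exists>B. finite B \<and>
       (\<forall>J. is_interval J \<and> J \<subseteq> I - B \<longrightarrow>
         (\<exists>(m::int) c. \<forall>t\<in>J. h t = of_int m * t + c)))"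

text \<open>
  Continuity of \<open>f\<close> on \<open>finite_part C\<close> is continuity on every closed edge, since the curve is
  glued from its closed edges. The values of \<open>f\<close> outside \<open>finite_part C\<close> are irrelevant.
\<close>

definition rational_fun ::
    "('v, 'e) metric_graph \<Rightarrow> (('v, 'e) point \<Rightarrow> real) \<Rightarrow> bool" where
  "rational_fun C f \<longleftrightarrow>
     (\<forall>e\<in>arcs (graph C). continuous_on (edge_dom C e) (f \<circ> chart C e) \<and>
        pw_linear_on (edge_dom C e) (f \<circ> chart C e))"

text \<open>
  \<open>slope F h\<close> is the slope of a function that is affine with integer slope along the filter \<open>F\<close>
  (a one-sided neighbourhood of a point or of infinity), with respect to the coordinate.
\<close>

definition slope :: "real filter \<Rightarrow> (real \<Rightarrow> real) \<Rightarrow> int" where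
  "slope F h = (THE m::int. \<exists>c. \<forall>\<^sub>F t in F. h t = of_int m * t + c)"

definition at_tail :: "('v, 'e) metric_graph \<Rightarrow> 'e \<Rightarrow> real filter" where
  "at_tail C e = (if lo C e = - \<infinity> then at_bot else at_right (real_of_ereal (lo C e)))"

definition at_head :: "('v, 'e) metric_graph \<Rightarrow> 'e \<Rightarrow> real filter" where
  "at_head C e = (if hi C e = \<infinity> then at_top else at_left (real_of_ereal (hi C e)))"

text \<open>
  In \<open>ord_at\<close> a slope taken in the direction of decreasing coordinate is the negative of the
  slope with respect to the coordinate. At an endpoint the same formula gives the slope on the
  leaf near infinity, in the direction pointing away from the endpoint.
\<close>

fun ord_at ::
    "('v, 'e) metric_graph \<Rightarrow> (('v, 'e) point \<Rightarrow> real) \<Rightarrow> ('v, 'e) point \<Rightarrow> int" where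
  "ord_at C f (Vertex v) =
     (\<Sum>e\<in>out_arcs (graph C) v. slope (at_tail C e) (f \<circ> chart C e)) +
     (\<Sum>e\<in>in_arcs (graph C) v. - slope (at_head C e) (f \<circ> chart C e))"
| "ord_at C f (Inner e t) =
     slope (at_right t) (f \<circ> chart C e) + (- slope (at_left t) (f \<circ> chart C e))"


section \<open>Divisors\<close>

type_synonym ('v, 'e) divisor = "('v, 'e) point \<Rightarrow>\<^sub>0 int"

definition divisors :: "('v, 'e) metric_graph \<Rightarrow> ('v, 'e) divisor set" where
  "divisors C = {D. Poly_Mapping.keys D \<subseteq> points C}"

definition deg :: "('v, 'e) divisor \<Rightarrow> int" where
  "deg D = (\<Sum>p\<in>Poly_Mapping.keys D. Poly_Mapping.lookup D p)"

definition effective :: "('v, 'e) divisor \<Rightarrow> bool" where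
  "effective D \<longleftrightarrow> (\<forall>p. 0 \<le> Poly_Mapping.lookup D p)"

definition lin_equiv ::
    "('v, 'e) metric_graph \<Rightarrow> ('v, 'e) divisor \<Rightarrow> ('v, 'e) divisor \<Rightarrow> bool" where
  "lin_equiv C D1 D2 \<longleftrightarrow>
     (\<exists>f. rational_fun C f \<and>
       (\<forall>p\<in>points C. Poly_Mapping.lookup (D1 - D2) p = ord_at C f p))"

definition linsys :: "('v, 'e) metric_graph \<Rightarrow> ('v, 'e) divisor \<Rightarrow> ('v, 'e) divisor set" where
  "linsys C D = {D' \<in> divisors C. effective D' \<and> lin_equiv C D' D}"

definition dim_linsys :: "('v, 'e) metric_graph \<Rightarrow> ('v, 'e) divisor \<Rightarrow> int" where
  "dim_linsys C D =
     (if linsys C D = {} then -1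
      else int (GREATEST r::nat.
        \<forall>R\<in>divisors C. effective R \<and> deg R = int r \<longrightarrow> linsys C (D - R) \<noteq> {}))"

text \<open>All points that are not vertices of the model have valence 2.\<close>

definition canonical :: "('v, 'e) metric_graph \<Rightarrow> ('v, 'e) divisor" where
  "canonical C = (\<Sum>v\<in>verts (graph C).
     Poly_Mapping.single (Vertex v) (int (vertex_val C v) - 2))"

end

theory Submission
  imports Defs
begin

text \<open>
  Everything follows from one statement: if \<open>|D|\<close> is empty, then there is a divisor \<open>N\<close> of degree
  \<open>g - 1\<close> such that \<open>|N - D|\<close> is nonempty and \<open>|K - N|\<close> is empty. Indeed, choose an effective \<open>R\<close> of
  degree \<open>dim |D| + 1\<close> with \<open>|D - R|\<close> empty, apply the statement to \<open>D - R\<close>, and take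
  \<open>F \<in> |N - D + R|\<close>. Then \<open>|K - D - F|\<close> is empty because \<open>K - D - F + R \<sim> K - N\<close>, so
  \<open>dim |K - D| < deg F\<close>. This is one inequality, and the other one is the same for \<open>K - D\<close>.

  To find \<open>N\<close>, move all chips off the leaves and choose a representative of \<open>D\<close> with as few negative
  chips as possible. Replace it by its translate by the supremum of all functions that vanish on the
  set \<open>Q\<close> of negative points, are nonnegative, and create no new negative points. The supremum is
  again rational, because away from the chips these functions are convex with integer slopes of
  bounded size. Now nothing can be fired without touching \<open>Q\<close>, so a fire started at \<open>Q\<close> burns the
  whole curve (Dhar). Let \<open>N\<close> be the number of burning directions minus 1 at every point. It dominates the
  representative, and \<open>|K - N|\<close> is empty: if \<open>K - N + (f)\<close> were effective, consider the
  last point to burn among those where \<open>f\<close> is maximal.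
\<close>

section \<open>Germs of piecewise linear functions\<close>

text \<open>Edge lengths are arbitrary reals, so there is no finite graph on which chips move and no
  termination argument for firing. Finiteness comes instead from slopes being integers: a bounded
  set of slopes is finite, so a supremum of convex functions stays piecewise linear, and a function
  that misses the supremum by less than x but gains a whole unit of slope overtakes it at distance
  x. The bound on the slopes in turn comes from principal divisors having degree 0. Minimizing the
  negative chips before taking the supremum keeps the set \<open>Q\<close> fixed under that
  translation, so that maximality can be used again for the translated divisor. The number g - 1
  appears as edges minus vertices, which neither subdividing edges nor removing leaves changes.
  Leaves are kept out of the firing because compactness fails on them; they return only in the
  canonical divisor, where the extra valence at the base of a leaf is cancelled by the slope that
  its endpoint enforces. If every vertex is an endpoint there is no core, and the curve is a line
  that needs its own argument.\<close>

definition germ :: "(real \<Rightarrow> real) \<Rightarrow> real \<Rightarrow> real \<Rightarrow> int \<Rightarrow> bool" where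
  "germ h t s m \<longleftrightarrow> (\<forall>\<^sub>F x in at_right 0. h (t + s * x) = h t + of_int m * x)"

text \<open>Slopes are taken outward in the direction \<open>s\<close>, not along the coordinate, so
  that an order becomes a plain sum over directions. As the value at \<open>t\<close> enters, a germ
  also records one-sided continuity.\<close>

definition gslope :: "(real \<Rightarrow> real) \<Rightarrow> real \<Rightarrow> real \<Rightarrow> int" where
  "gslope h t s = (THE m. germ h t s m)"

lemma germE:
  assumes "germ h t s m"
  obtains d where "d > 0" "\<And>x. 0 \<le> x \<Longrightarrow> x < d \<Longrightarrow> h (t + s * x) = h t + of_int m * x"
proof -
  obtain d where d: "d > 0" "\<And>x. 0 < x \<Longrightarrow> x < d \<Longrightarrow> h (t + s * x) = h t + of_int m * x"
    using assms unfolding germ_def eventually_at_right_field by auto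
  have "h (t + s * x) = h t + of_int m * x" if "0 \<le> x" "x < d" for x
    using d(2)[of x] that by (cases "x = 0") auto
  with d(1) show ?thesis using that by blast
qed

lemma germI:
  assumes "d > 0" "\<And>x. 0 < x \<Longrightarrow> x < d \<Longrightarrow> h (t + s * x) = h t + of_int m * x"
  shows "germ h t s m"
  using assms unfolding germ_def eventually_at_right_field by auto

lemma germ_unique:
  assumes "germ h t s m" "germ h t s n" shows "m = n"
proof -
  obtain d where d: "d > 0" "\<And>x. 0 \<le> x \<Longrightarrow> x < d \<Longrightarrow> h (t + s * x) = h t + of_int m * x"
    using germE[OF assms(1)] by blast
  obtain d' where d': "d' > 0" "\<And>x. 0 \<le> x \<Longrightarrow> x < d' \<Longrightarrow> h (t + s * x) = h t + of_int n * x"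
    using germE[OF assms(2)] by blast
  define x where "x = min d d' / 2"
  have x: "x > 0" "x < d" "x < d'" using d(1) d'(1) by (auto simp: x_def min_def)
  have "real_of_int m * x = of_int n * x" using d(2)[of x] d'(2)[of x] x by auto
  with x show ?thesis by simp
qed

lemma gslope_eq: "germ h t s m \<Longrightarrow> gslope h t s = m"
  unfolding gslope_def by (blast intro: the_equality germ_unique)

lemma germ_gslope: "\<exists>m. germ h t s m \<Longrightarrow> germ h t s (gslope h t s)"
  using gslope_eq by metis

lemma germ_cong:
  assumes "d > 0" "\<And>x. 0 \<le> x \<Longrightarrow> x < d \<Longrightarrow> h (t + s * x) = k (t + s * x)"
  shows "germ h t s m \<longleftrightarrow> germ k t s m"
proof -
  have "h t = k t" using assms(2)[of 0] assms(1) by auto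
  moreover have "\<forall>\<^sub>F x in at_right 0. h (t + s * x) = k (t + s * x)"
    unfolding eventually_at_right_field using assms by (intro exI[of _ d]) auto
  ultimately show ?thesis unfolding germ_def
    by (intro eventually_subst) (auto elim: eventually_mono)
qed

lemma germ_add: "germ h t s m \<Longrightarrow> germ k t s n \<Longrightarrow> germ (\<lambda>x. h x + k x) t s (m + n)"
  unfolding germ_def by (erule (1) eventually_elim2) (auto simp: algebra_simps)

lemma germ_uminus: "germ h t s m \<Longrightarrow> germ (\<lambda>x. - h x) t s (- m)"
  unfolding germ_def by (elim eventually_mono) (auto simp: algebra_simps)

lemma germ_const: "germ (\<lambda>x. c) t s 0"
  unfolding germ_def by auto

lemma germ_less:
  assumes "germ h t s m" "germ k t s n" "h t < k t"
  shows "\<forall>\<^sub>F x in at_right 0. h (t + s * x) < k (t + s * x)"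
proof -
  have "((\<lambda>x. (k t - h t) + of_int (n - m) * x) \<longlongrightarrow> (k t - h t) + of_int (n - m) * 0) (at_right 0)"
    by (intro tendsto_intros)
  then have "\<forall>\<^sub>F x in at_right 0. 0 < (k t - h t) + of_int (n - m) * x"
    using assms(3) by (auto dest!: order_tendstoD(1)[where a = 0])
  with assms(1,2) show ?thesis unfolding germ_def
    by eventually_elim (auto simp: algebra_simps)
qed

lemma germ_max_less:
  assumes "germ h t s m" "germ k t s n" "h t < k t"
  shows "germ (\<lambda>x. max (h x) (k x)) t s n"
proof -
  from germ_less[OF assms] assms(2)[unfolded germ_def] show ?thesis unfolding germ_def
    by eventually_elim (use assms(3) in auto)
qed

lemma germ_max_eq:
  assumes "germ h t s m" "germ k t s n" "h t = k t"
  shows "germ (\<lambda>x. max (h x) (k x)) t s (max m n)"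
proof -
  have "\<forall>\<^sub>F x in at_right (0::real). x > 0" by (simp add: eventually_at_right_less)
  with assms(1,2) show ?thesis unfolding germ_def
  proof eventually_elim
    case (elim x)
    have "max (of_int m * x) (of_int n * x) = of_int (max m n) * x"
      using elim(3) by (auto simp: max_def mult_le_cancel_right)
    then show ?case using elim assms(3) by (auto simp: max_def)
  qed
qed

lemma germ_max: "\<exists>m. germ h t s m \<Longrightarrow> \<exists>m. germ k t s m \<Longrightarrow> \<exists>m. germ (\<lambda>x. max (h x) (k x)) t s m"
  by (cases "h t" "k t" rule: linorder_cases)
    (use germ_max_less germ_max_eq germ_max_less[where h = k and k = h] in \<open>fastforce simp: max.commute\<close>)+

lemma germ_Max:
  assumes "finite A" "A \<noteq> {}" "\<And>a. a \<in> A \<Longrightarrow> \<exists>m. germ (f a) t s m"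
  shows "\<exists>m. germ (\<lambda>x. Max ((\<lambda>a. f a x) ` A)) t s m"
  using assms
proof (induction A rule: finite_ne_induct)
  case (insert a A)
  have "(\<lambda>x. Max ((\<lambda>a. f a x) ` insert a A)) = (\<lambda>x. max (f a x) (Max ((\<lambda>a. f a x) ` A)))"
    using insert.hyps by (simp add: Max_insert)
  then show ?case using germ_max[of "f a" t s] insert by auto
qed auto

lemma germ_affine: "germ (\<lambda>x. of_int m * x + c) t 1 m" "germ (\<lambda>x. of_int m * x + c) t (-1) (- m)"
  unfolding germ_def by (auto simp: algebra_simps)

lemma germ_flip: "germ h t (-1) m \<longleftrightarrow> germ (\<lambda>x. h (- x)) (- t) 1 m"
  unfolding germ_def by (simp add: algebra_simps)

text \<open>Just past \<open>t\<close> the function is affine, so the same slope is seen looking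
  forward and its negative looking back. This turns an upper bound for all outward slopes into a
  two-sided one.\<close>

lemma germ_nearby:
  assumes "germ h t s m" "s = 1 \<or> s = - 1"
  shows "\<forall>\<^sub>F x in at_right 0. germ h (t + s * x) s m \<and> germ h (t + s * x) (- s) (- m)"
proof -
  obtain d where d: "d > 0" "\<And>x. 0 \<le> x \<Longrightarrow> x < d \<Longrightarrow> h (t + s * x) = h t + of_int m * x"
    using germE[OF assms(1)] by blast
  have "germ h (t + s * x) s m \<and> germ h (t + s * x) (- s) (- m)" if "0 < x" "x < d" for x
  proof
    have 1: "h (t + s * x) = h t + of_int m * x" using d that by auto
    show "germ h (t + s * x) s m"
      by (rule germI[of "d - x"]) (use d(2)[of "x + _"] 1 that in \<open>auto simp: algebra_simps\<close>)
    show "germ h (t + s * x) (- s) (- m)"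
      by (rule germI[of x]) (use d(2)[of "x - _"] 1 that in \<open>auto simp: algebra_simps\<close>)
  qed
  with d(1) show ?thesis unfolding eventually_at_right_field by auto
qed

lemma germ_pos:
  assumes "germ h t s m" "\<forall>\<^sub>F x in at_right 0. h t \<le> h (t + s * x)"
  shows "m \<ge> 0"
proof -
  have "\<forall>\<^sub>F x in at_right (0::real). x > 0" by (simp add: eventually_at_right_less)
  with assms have "\<forall>\<^sub>F x in at_right (0::real). m \<ge> 0" unfolding germ_def
    by eventually_elim (auto simp: zero_le_mult_iff)
  then show ?thesis by (simp add: eventually_const_iff)
qed

lemma germ_nonpos:
  assumes "germ h t s m" "\<forall>\<^sub>F x in at_right 0. h (t + s * x) \<le> h t"
  shows "m \<le> 0"
  using germ_pos[OF germ_uminus[OF assms(1)]] assms(2) by simp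

text \<open>Affine functions with different slopes agree in at most one point, so this is what a
  filter has to satisfy for \<open>slope\<close> to be unique. It covers finite ends of edges and
  ends at infinity alike.\<close>

definition punctured :: "real filter \<Rightarrow> bool" where
  "punctured F \<longleftrightarrow> F \<noteq> bot \<and> (\<forall>a. \<forall>\<^sub>F x in F. x \<noteq> a)"

lemma punctured [simp]: "punctured at_bot" "punctured at_top" "punctured (at_right t)" "punctured (at_left t)"
proof -
  show "punctured at_bot" "punctured at_top"
    unfolding punctured_def by (auto elim: eventually_mono[OF eventually_gt_at_bot] eventually_mono[OF eventually_gt_at_top])
  have "\<forall>\<^sub>F x in at_right t. x \<noteq> a" "\<forall>\<^sub>F x in at_left t. x \<noteq> a" for a
    by (cases "a = t"; auto simp: eventually_at_filter eventually_nhds intro!: exI[of _ "- {a}"])+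
  then show "punctured (at_right t)" "punctured (at_left t)"
    unfolding punctured_def by auto
qed

lemma slope_eqI:
  assumes "punctured F" and "\<forall>\<^sub>F x in F. h x = of_int m * x + c"
  shows "slope F h = m"
  unfolding slope_def
proof (rule the_equality)
  show "\<exists>c. \<forall>\<^sub>F x in F. h x = of_int m * x + c" using assms(2) by blast
next
  fix n assume "\<exists>c'. \<forall>\<^sub>F x in F. h x = real_of_int n * x + c'"
  then obtain c' where c': "\<forall>\<^sub>F x in F. h x = real_of_int n * x + c'" by blast
  show "n = m"
  proof (rule ccontr)
    assume "n \<noteq> m"
    \<comment> \<open>The point where the two lines cross.\<close>
    define a where "a = (c - c') / (n - m)"
    have "\<forall>\<^sub>F x in F. x \<noteq> a" using assms(1) by (simp add: punctured_def)
    with assms(2) c' have "\<forall>\<^sub>F x in F. False"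
      by eventually_elim (use \<open>n \<noteq> m\<close> in \<open>auto simp: a_def field_simps\<close>)
    then show False using assms(1) by (simp add: punctured_def eventually_False)
  qed
qed

lemma germ_right_iff: "germ h t 1 m \<longleftrightarrow> (\<forall>\<^sub>F x in at_right t. h x = of_int m * x + (h t - of_int m * t))"
  unfolding germ_def by (subst (2) at_right_to_0) (simp add: eventually_filtermap algebra_simps)

lemma germ_left_iff: "germ h t (-1) m \<longleftrightarrow> (\<forall>\<^sub>F x in at_left t. h x = of_int (- m) * x + (h t + of_int m * t))"
  unfolding germ_flip germ_right_iff by (subst at_left_minus) (simp add: eventually_filtermap algebra_simps)

lemma slope_at_right: "germ h t 1 m \<Longrightarrow> slope (at_right t) h = m"
  unfolding germ_right_iff by (rule slope_eqI) auto

lemma slope_at_left: "germ h t (-1) m \<Longrightarrow> slope (at_left t) h = - m"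
  unfolding germ_left_iff by (rule slope_eqI) auto

section \<open>Piecewise linear and convex functions on an interval\<close>

lemma germ_comp: "germ (\<lambda>x. h (t + s * x)) 0 1 m \<longleftrightarrow> germ h t s m"
  unfolding germ_def by simp

lemma pw_linear_on_subset: "pw_linear_on I h \<Longrightarrow> J \<subseteq> I \<Longrightarrow> pw_linear_on J h"
  unfolding pw_linear_on_def by (meson Diff_mono order_refl subset_trans)

lemma pw_linear_on_affine:
  "(\<And>t. t \<in> I \<Longrightarrow> h t = of_int m * t + c) \<Longrightarrow> pw_linear_on I h"
  unfolding pw_linear_on_def by (intro exI[of _ "{}"]) blast

lemma pw_linear_on_combine:
  assumes "pw_linear_on {a..b} h" "pw_linear_on {b..c} h"
  shows "pw_linear_on {a..c} h"
proof -
  obtain B where B: "finite B" "\<forall>J. is_interval J \<and> J \<subseteq> {a..b} - B \<longrightarrow> (\<exists>(m::int) c. \<forall>t\<in>J. h t = of_int m * t + c)"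
    using assms(1) unfolding pw_linear_on_def by (elim exE conjE)
  obtain B' where B': "finite B'" "\<forall>J. is_interval J \<and> J \<subseteq> {b..c} - B' \<longrightarrow> (\<exists>(m::int) c. \<forall>t\<in>J. h t = of_int m * t + c)"
    using assms(2) unfolding pw_linear_on_def by (elim exE conjE)
  have "\<exists>(m::int) c. \<forall>t\<in>J. h t = of_int m * t + c"
    if J: "is_interval J" "J \<subseteq> {a..c} - insert b (B \<union> B')" for J
  proof -
    have "J \<subseteq> {..b} \<or> J \<subseteq> {b..}"
    proof (rule ccontr)
      assume "\<not> ?thesis"
      then obtain x y where "x \<in> J" "y \<in> J" "x < b" "b < y" unfolding subset_eq atMost_iff atLeast_iff by (metis not_le)
      then have "b \<in> J" using J(1) by (meson is_interval_1 less_imp_le)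
      with J(2) show False by auto
    qed
    then have "J \<subseteq> {a..b} - B \<or> J \<subseteq> {b..c} - B'" using J(2) by (fastforce simp: subset_eq)
    then show ?thesis
    proof
      assume "J \<subseteq> {a..b} - B"
      from B(2)[rule_format, OF conjI[OF J(1) this]] show ?thesis .
    next
      assume "J \<subseteq> {b..c} - B'"
      from B'(2)[rule_format, OF conjI[OF J(1) this]] show ?thesis .
    qed
  qed
  then show ?thesis unfolding pw_linear_on_def
    using B(1) B'(1) by (intro exI[of _ "insert b (B \<union> B')"]) auto
qed

text \<open>The finitely many breakpoints avoid a short punctured interval beside \<open>t\<close>,
  and the affine piece found there extends to \<open>t\<close> by continuity. The point
  \<open>t + s * y\<close> certifies that \<open>I\<close> reaches beyond \<open>t\<close> in the
  direction \<open>s\<close>.\<close>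

lemma pw_linear_germ:
  assumes pw: "pw_linear_on I h" and cont: "continuous_on I h" and I: "is_interval I"
    and t: "t \<in> I" and s: "s = 1 \<or> s = -1" and y: "t + s * y \<in> I" "y > 0"
  shows "\<exists>m. germ h t s m"
proof -
  obtain B where B: "finite B" "\<forall>J. is_interval J \<and> J \<subseteq> I - B \<longrightarrow> (\<exists>(m::int) c. \<forall>t\<in>J. h t = of_int m * t + c)"
    using pw unfolding pw_linear_on_def by (elim exE conjE)
  have "\<forall>\<^sub>F x in at t. x \<notin> B"
    using islimpt_finite[OF B(1), of t] unfolding islimpt_iff_eventually by simp
  then have "\<forall>\<^sub>F x in at_right t. x \<notin> B" "\<forall>\<^sub>F x in at_left t. x \<notin> B"
    unfolding eventually_at_split by blast+
  then have "\<forall>\<^sub>F x in at_right 0. t + s * x \<notin> B"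
    using s by (auto simp: at_right_to_0[of t] at_left_minus[of t] at_right_to_0[of "-t"] eventually_filtermap algebra_simps)
  then obtain d0 where d0: "d0 > 0" "\<And>x. 0 < x \<Longrightarrow> x < d0 \<Longrightarrow> t + s * x \<notin> B"
    unfolding eventually_at_right_field by auto
  define d where "d = min d0 y"
  have d: "d > 0" "d \<le> y" "d \<le> d0" using d0(1) y(2) by (auto simp: d_def)
  define J where "J = (\<lambda>x. t + s * x) ` {0<..<d}"
  have inI: "t + s * x \<in> I" if "0 \<le> x" "x \<le> y" for x
  proof (cases "s = 1")
    case True
    then show ?thesis using I t y that mem_is_interval_1_I[of I t "t + y" "t + x"] by auto
  next
    case False
    then show ?thesis using I t y s that mem_is_interval_1_I[of I "t - y" t "t - x"] by auto
  qed
  have "is_interval J"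
  proof -
    have "continuous_on {0<..<d} (\<lambda>x. t + s * x)" by (intro continuous_intros)
    then have "Topological_Spaces.connected ((\<lambda>x. t + s * x) ` {0<..<d})" by (rule connected_continuous_image) simp
    then show ?thesis unfolding J_def is_interval_connected_1 .
  qed
  moreover have "J \<subseteq> I - B" using inI d0(2) d by (auto simp: J_def)
  ultimately obtain m :: int and c where mc: "\<And>u. u \<in> J \<Longrightarrow> h u = of_int m * u + c" using B(2)[rule_format, of J] by blast
  have "continuous_on {0..y} (\<lambda>x. h (t + s * x))"
    by (rule continuous_on_compose2[OF cont]) (auto intro!: continuous_intros inI)
  then have "((\<lambda>x. h (t + s * x)) \<longlongrightarrow> h (t + s * 0)) (at_right 0)"
    using y(2) by (intro continuous_on_Icc_at_rightD[of 0 y]) auto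
  moreover have "\<forall>\<^sub>F x in at_right 0. h (t + s * x) = of_int m * (t + s * x) + c"
    unfolding eventually_at_right_field
  proof (intro exI[of _ d] conjI allI impI)
    fix x assume "0 < x" "x < d"
    then have "t + s * x \<in> J" unfolding J_def by (intro imageI) auto
    then show "h (t + s * x) = of_int m * (t + s * x) + c" by (rule mc)
  qed (rule d(1))
  ultimately have "((\<lambda>x. of_int m * (t + s * x) + c) \<longlongrightarrow> h (t + s * 0)) (at_right 0)"
    using tendsto_cong by fast
  moreover have "((\<lambda>x. of_int m * (t + s * x) + c) \<longlongrightarrow> of_int m * (t + s * 0) + c) (at_right 0)"
    by (intro tendsto_intros)
  ultimately have ht: "h t = of_int m * t + c"
    using tendsto_unique[of "at_right (0::real)"] by fastforce
  have "germ h t s (if s = 1 then m else - m)"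
  proof (rule germI[OF d(1)])
    fix x assume "0 < x" "x < d"
    then have "t + s * x \<in> J" unfolding J_def by (intro imageI) auto
    then show "h (t + s * x) = h t + of_int (if s = 1 then m else - m) * x"
      using mc[of "t + s * x"] ht s by (auto simp: algebra_simps)
  qed
  then show ?thesis by blast
qed

text \<open>A pointwise substitute for being continuous and piecewise linear: it can be verified for
  sums, maxima and suprema one direction at a time, and the finiteness of the set of breakpoints is
  recovered from compactness of the interval.\<close>

definition germs_on :: "real \<Rightarrow> (real \<Rightarrow> real) \<Rightarrow> bool" where
  "germs_on L h \<longleftrightarrow> (\<forall>t. 0 \<le> t \<and> t < L \<longrightarrow> (\<exists>m. germ h t 1 m)) \<and> (\<forall>t. 0 < t \<and> t \<le> L \<longrightarrow> (\<exists>m. germ h t (-1) m))"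

lemma germs_on_imp:
  assumes "germs_on L h" "0 \<le> L"
  shows "continuous_on {0..L} h \<and> pw_linear_on {0..L} h"
proof -
  \<comment> \<open>The guard makes \<open>P\<close> vacuous for intervals that stick out of
    \<open>{0..L}\<close>, which the local step of the bisection also has to handle.\<close>
  define P where "P = (\<lambda>a b. 0 \<le> a \<and> a \<le> b \<and> b \<le> L \<longrightarrow> continuous_on {a..b} h \<and> pw_linear_on {a..b} h)"
  have comb: "continuous_on {a..c} h \<and> pw_linear_on {a..c} h"
    if "continuous_on {a..b} h" "pw_linear_on {a..b} h" "continuous_on {b..c} h" "pw_linear_on {b..c} h" "a \<le> b" "b \<le> c" for a b c
    using that pw_linear_on_combine[of a b h c] continuous_on_closed_Un[of "{a..b}" "{b..c}" h]
      ivl_disj_un_two_touch(4)[of a b c] by auto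
  have aff: "continuous_on {a..b} h \<and> pw_linear_on {a..b} h"
    if "\<And>x. a \<le> x \<Longrightarrow> x \<le> b \<Longrightarrow> h x = of_int m * x + c" for a b c and m :: int
  proof
    show "continuous_on {a..b} h"
      by (subst continuous_on_cong[OF refl that]) (auto intro!: continuous_intros)
  qed (use that in \<open>auto intro: pw_linear_on_affine\<close>)
  have "P 0 L" using assms(2)
  proof (induction rule: Bolzano)
    case (trans a b c)
    then show ?case unfolding P_def using comb[of a b c] by auto
  next
    case (local x)
    have "\<exists>d>0. \<forall>b. x \<le> b \<and> b \<le> L \<and> b < x + d \<longrightarrow> continuous_on {x..b} h \<and> pw_linear_on {x..b} h"
    proof (cases "x < L")
      case True
      then obtain m where "germ h x 1 m" using assms(1) local unfolding germs_on_def by blast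
      then obtain d where d: "d > 0" "\<And>y. 0 \<le> y \<Longrightarrow> y < d \<Longrightarrow> h (x + y) = h x + of_int m * y"
        using germE by (metis mult_1)
      have "continuous_on {x..b} h \<and> pw_linear_on {x..b} h" if "b < x + d" for b
      proof (rule aff[of _ _ m "h x - of_int m * x"])
        fix y assume "x \<le> y" "y \<le> b"
        then show "h y = of_int m * y + (h x - of_int m * x)"
          using d(2)[of "y - x"] that by (simp add: algebra_simps)
      qed
      then show ?thesis using d(1) by (intro exI[of _ d]) simp
    next
      case False
      then have "x = L" using local by simp
      then have "continuous_on {x..b} h \<and> pw_linear_on {x..b} h" if "b \<le> L" for b
        by (intro aff[of _ _ 0 "h x"]) (use that in \<open>auto dest: antisym\<close>)
      then show ?thesis by (auto intro: exI[of _ 1])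
    qed
    then obtain d1 where d1: "d1 > 0" "\<And>b. x \<le> b \<Longrightarrow> b \<le> L \<Longrightarrow> b < x + d1 \<Longrightarrow> continuous_on {x..b} h \<and> pw_linear_on {x..b} h" by blast
    have "\<exists>d>0. \<forall>a. 0 \<le> a \<and> a \<le> x \<and> x - d < a \<longrightarrow> continuous_on {a..x} h \<and> pw_linear_on {a..x} h"
    proof (cases "0 < x")
      case True
      then obtain m where "germ h x (-1) m" using assms(1) local unfolding germs_on_def by blast
      then obtain d where d: "d > 0" "\<And>y. 0 \<le> y \<Longrightarrow> y < d \<Longrightarrow> h (x - y) = h x + of_int m * y"
        using germE by (metis mult_minus1 add_uminus_conv_diff)
      have "continuous_on {a..x} h \<and> pw_linear_on {a..x} h" if "x - d < a" for a
      proof (rule aff[of _ _ "-m" "h x + of_int m * x"])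
        fix y assume "a \<le> y" "y \<le> x"
        then show "h y = of_int (- m) * y + (h x + of_int m * x)"
          using d(2)[of "x - y"] that by (simp add: algebra_simps)
      qed
      then show ?thesis using d(1) by (intro exI[of _ d]) simp
    next
      case False
      then have "x = 0" using local by simp
      then have "continuous_on {a..x} h \<and> pw_linear_on {a..x} h" if "0 \<le> a" for a
        by (intro aff[of _ _ 0 "h x"]) (use that in \<open>simp, metis order.antisym order.trans\<close>)
      then show ?thesis by (auto intro: exI[of _ 1])
    qed
    then obtain d2 where d2: "d2 > 0" "\<And>a. 0 \<le> a \<Longrightarrow> a \<le> x \<Longrightarrow> x - d2 < a \<Longrightarrow> continuous_on {a..x} h \<and> pw_linear_on {a..x} h" by blast
    have "P a b" if "a \<le> x" "x \<le> b" "b - a < min d1 d2" for a b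
      unfolding P_def using d1(2)[of b] d2(2)[of a] comb[of a x b] that by auto
    with d1(1) d2(1) show ?case by (intro exI[of _ "min d1 d2"]) auto
  qed
  then show ?thesis using assms(2) unfolding P_def by auto
qed

text \<open>Convexity expressed through germs, because this is the form in which it is met: at an
  inner point without chips, effectivity says that the two outward slopes have nonnegative
  sum.\<close>

definition cvx :: "(real \<Rightarrow> real) \<Rightarrow> real \<Rightarrow> real \<Rightarrow> bool" where
  "cvx h a b \<longleftrightarrow> continuous_on {a..b} h \<and> (\<forall>t. a < t \<and> t < b \<longrightarrow>
     (\<exists>m n. germ h t 1 m \<and> germ h t (-1) n \<and> m + n \<ge> 0))"

lemma cvx_mono: "cvx h a b \<Longrightarrow> a \<le> a' \<Longrightarrow> b' \<le> b \<Longrightarrow> cvx h a' b'"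
  unfolding cvx_def by (auto intro: continuous_on_subset)

text \<open>Subtracting the tangent leaves a function \<open>k\<close> that starts at 0 with slope
  0. If it were negative at \<open>x\<close>, then at its last maximum the right slope would be
  negative and the left slope at most 0, against convexity; and if that maximum is \<open>a\<close>
  itself, against slope 0.\<close>

lemma cvx_tangent_right:
  assumes "cvx h a b" "germ h a 1 m" "a \<le> x" "x \<le> b"
  shows "h a + of_int m * (x - a) \<le> h x"
proof (rule ccontr)
  define k where "k = (\<lambda>y. h y + (of_int (- m) * y + (of_int m * a - h a)))"
  assume "\<not> ?thesis"
  then have kx: "k x < 0" by (simp add: k_def algebra_simps)
  have ka: "k a = 0" by (simp add: k_def)
  have cont: "continuous_on {a..x} k" unfolding k_def
    using assms by (auto simp: cvx_def intro!: continuous_intros intro: continuous_on_subset)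
  obtain y0 where y0: "y0 \<in> {a..x}" "\<And>z. z \<in> {a..x} \<Longrightarrow> k z \<le> k y0"
    using continuous_attains_sup[OF _ _ cont] assms(3) by auto
  \<comment> \<open>The maximizers of \<open>k\<close>. The last of them is needed because only
    there is \<open>k\<close> strictly smaller everywhere to the right.\<close>
  define Y where "Y = {a..x} \<inter> k -` {k y0..}"
  have "closed Y" unfolding Y_def by (intro continuous_closed_preimage cont) auto
  then have "compact Y" unfolding Y_def by (metis Int_lower1 bounded_closed_interval bounded_subset compact_eq_bounded_closed)
  moreover have "y0 \<in> Y" using y0 by (auto simp: Y_def)
  ultimately obtain y where y: "y \<in> Y" "\<And>z. z \<in> Y \<Longrightarrow> z \<le> y"
    using compact_attains_sup[of Y] by auto
  have y_max: "k z \<le> k y" if "z \<in> {a..x}" for z using y(1) y0(2)[OF that] by (auto simp: Y_def)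
  have ya: "a \<le> y" "y \<le> x" using y(1) by (auto simp: Y_def)
  have "y \<noteq> x" using kx ka y_max[of a] assms(3) by auto
  then have yx: "y < x" using ya by auto
  have strict: "k z < k y" if "y < z" "z \<le> x" for z
    using y(2)[of z] y_max[of z] that ya y(1) by (force simp: Y_def)
  have gk: "germ k t 1 (i - m)" if "germ h t 1 i" for t i
    using germ_add[OF that germ_affine(1)[of "-m" "of_int m * a - h a" t]] by (simp add: k_def)
  have gk': "germ k t (-1) (i + m)" if "germ h t (-1) i" for t i
    using germ_add[OF that germ_affine(2)[of "-m" "of_int m * a - h a" t]] by (simp add: k_def)
  have neg: "i < 0" if gi: "germ k y 1 i" for i
  proof -
    obtain d where d: "d > 0" "\<And>z. 0 \<le> z \<Longrightarrow> z < d \<Longrightarrow> k (y + z) = k y + of_int i * z"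
      using germE[OF gi] by (metis mult_1)
    define z where "z = min d (x - y) / 2"
    have z: "z > 0" "z < d" "y + z \<le> x" using d(1) yx by (auto simp: z_def min_def field_simps)
    then have "of_int i * z < 0" using strict[of "y + z"] d(2)[of z] by auto
    with z(1) show ?thesis by (simp add: mult_less_0_iff)
  qed
  show False
  proof (cases "y = a")
    case True
    then show ?thesis using neg gk[OF assms(2)] by auto
  next
    case False
    then have "a < y" "y < b" using ya yx assms(4) by auto
    then obtain i j where ij: "germ h y 1 i" "germ h y (-1) j" "i + j \<ge> 0" using assms(1) unfolding cvx_def by blast
    have "j + m \<le> 0"
    proof (rule germ_nonpos[OF gk'[OF ij(2)]])
      show "\<forall>\<^sub>F z in at_right 0. k (y + - 1 * z) \<le> k y"
        unfolding eventually_at_right_field using \<open>a < y\<close> yx by (intro exI[of _ "y - a"]) (auto intro!: y_max)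
    qed
    with neg[OF gk[OF ij(1)]] ij(3) show False by auto
  qed
qed

lemma cvx_flip:
  assumes "cvx h a b" shows "cvx (\<lambda>x. h (- x)) (- b) (- a)"
  unfolding cvx_def
proof (intro conjI allI impI)
  have "continuous_on {a..b} h" using assms unfolding cvx_def by blast
  then show "continuous_on {- b..- a} (\<lambda>x. h (- x))"
    by (rule continuous_on_compose2) (auto intro!: continuous_intros)
next
  fix t assume "- b < t \<and> t < - a"
  then have "a < - t \<and> - t < b" by auto
  then obtain m n where "germ h (- t) 1 m" "germ h (- t) (-1) n" "m + n \<ge> 0"
    using assms unfolding cvx_def by blast
  then show "\<exists>m n. germ (\<lambda>x. h (- x)) t 1 m \<and> germ (\<lambda>x. h (- x)) t (-1) n \<and> m + n \<ge> 0"
    using germ_flip[of h "- t" n] germ_flip[of "\<lambda>x. h (- x)" t m]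
    by (intro exI[of _ n] exI[of _ m]) (auto simp: add.commute)
qed

lemma cvx_tangent_left:
  assumes "cvx h a b" "germ h b (-1) m" "a \<le> x" "x \<le> b"
  shows "h b + of_int m * (b - x) \<le> h x"
  using cvx_tangent_right[OF cvx_flip[OF assms(1)], of m "- x"] assms(2-4) by (simp add: germ_flip)

text \<open>To the left of \<open>x\<close> the line of slope \<open>m\<close> is still a support
  line: by convexity the outward slope on that side is at least \<open>- m\<close>.\<close>

lemma cvx_tangent:
  assumes "cvx h a b" "germ h x 1 m" "a \<le> x" "x < b" "a \<le> y" "y \<le> b"
  shows "h x + of_int m * (y - x) \<le> h y"
proof (cases "x \<le> y")
  case True
  then show ?thesis using cvx_tangent_right[OF cvx_mono[OF assms(1)] assms(2)] assms by auto
next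
  case False
  then have "a < x" using assms by auto
  then obtain i j where ij: "germ h x 1 i" "germ h x (-1) j" "i + j \<ge> 0"
    using assms unfolding cvx_def by blast
  then have "i = m" using assms(2) germ_unique by auto
  have "h x + of_int j * (x - y) \<le> h y"
    using cvx_tangent_left[OF cvx_mono[OF assms(1)] ij(2)] assms False by auto
  moreover have "of_int (- m) * (x - y) \<le> of_int j * (x - y)"
    using ij(3) \<open>i = m\<close> False by (intro mult_right_mono) auto
  ultimately show ?thesis by (simp add: algebra_simps)
qed

text \<open>The supremum is the maximum, over the finitely many admissible slopes \<open>m\<close>, of the highest line
  of slope \<open>m\<close> below some member of the family.\<close>

lemma cvx_sup_germ:
  fixes \<Phi> :: "'a set" and f :: "'a \<Rightarrow> real \<Rightarrow> real"
  assumes ne: "\<Phi> \<noteq> {}" and b: "b > 0"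
    and cvx: "\<And>g. g \<in> \<Phi> \<Longrightarrow> cvx (f g) 0 b"
    and ex: "\<And>g. g \<in> \<Phi> \<Longrightarrow> \<exists>m. germ (f g) 0 1 m"
    and slopes: "\<And>g x m. g \<in> \<Phi> \<Longrightarrow> 0 \<le> x \<Longrightarrow> x < b \<Longrightarrow> germ (f g) x 1 m \<Longrightarrow> \<bar>m\<bar> \<le> M"
    and bdd: "\<And>x. 0 \<le> x \<Longrightarrow> x < b \<Longrightarrow> bdd_above ((\<lambda>g. f g x) ` \<Phi>)"
  shows "\<exists>m. germ (\<lambda>x. SUP g\<in>\<Phi>. f g x) 0 1 m"
proof -
  define T where "T = (\<lambda>m::int. {c. \<exists>g\<in>\<Phi>. \<forall>x. 0 \<le> x \<and> x \<le> b \<longrightarrow> of_int m * x + c \<le> f g x})"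
  define A where "A = {m. \<bar>m\<bar> \<le> M \<and> T m \<noteq> {}}"
  have up: "f g x \<le> (SUP g\<in>\<Phi>. f g x)" if "g \<in> \<Phi>" "0 \<le> x" "x < b" for g x
    using cSUP_upper[OF that(1) bdd[OF that(2,3)]] .
  have le: "of_int m * x + c \<le> (SUP g\<in>\<Phi>. f g x)" if c: "c \<in> T m" and x: "0 \<le> x" "x < b" for m c x
  proof -
    obtain g where "g \<in> \<Phi>" "of_int m * x + c \<le> f g x" using c x(1) less_imp_le[OF x(2)] unfolding T_def by blast
    then show ?thesis using up[of g x] x by auto
  qed
  have bddT: "bdd_above (T m)" for m
    using le[of _ m 0] b by (intro bdd_aboveI[of _ "SUP g\<in>\<Phi>. f g 0"]) auto
  \<comment> \<open>The tangent of a member at \<open>x\<close> has an admissible slope and stays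
    below that member on the whole interval. So no value is lost when the members are replaced by
    the lines below them.\<close>
  have tang: "\<exists>m\<in>A. \<exists>c\<in>T m. f g x = of_int m * x + c" if "g \<in> \<Phi>" "0 \<le> x" "x < b" for g x
  proof -
    have "\<exists>m. germ (f g) x 1 m"
    proof (cases "x = 0")
      case False
      then have "0 < x \<and> x < b" using that by simp
      then show ?thesis using cvx[OF that(1)] unfolding cvx_def by blast
    qed (use ex[OF that(1)] in simp)
    then obtain m where m: "germ (f g) x 1 m" by blast
    have "of_int m * y + (f g x - of_int m * x) \<le> f g y" if "0 \<le> y" "y \<le> b" for y
      using cvx_tangent[OF cvx m, of y] that \<open>g \<in> \<Phi>\<close> \<open>0 \<le> x\<close> \<open>x < b\<close> by (simp add: algebra_simps)
    then have "f g x - of_int m * x \<in> T m" using that(1) unfolding T_def by blast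
    moreover have "m \<in> A" using slopes[OF that m] calculation by (auto simp: A_def)
    ultimately show ?thesis by (intro bexI[of _ m] bexI[of _ "f g x - of_int m * x"]) auto
  qed
  have "A \<subseteq> {-M..M}" by (auto simp: A_def)
  then have fin: "finite A" using finite_subset by blast
  have "A \<noteq> {}" using ne tang[of _ 0] b by blast
  have eq: "(SUP g\<in>\<Phi>. f g x) = Max ((\<lambda>m. of_int m * x + Sup (T m)) ` A)" if x: "0 \<le> x" "x < b" for x
  proof (rule antisym)
    show "(SUP g\<in>\<Phi>. f g x) \<le> Max ((\<lambda>m. of_int m * x + Sup (T m)) ` A)"
    proof (rule cSUP_least[OF ne])
      fix g assume "g \<in> \<Phi>"
      then obtain m c where mc: "m \<in> A" "c \<in> T m" "f g x = of_int m * x + c" using tang x by blast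
      have "c \<le> Sup (T m)" using mc(2) bddT by (rule cSup_upper)
      then have "f g x \<le> of_int m * x + Sup (T m)" using mc(3) by auto
      also have "\<dots> \<le> Max ((\<lambda>m. of_int m * x + Sup (T m)) ` A)" using mc(1) fin by (intro Max_ge) auto
      finally show "f g x \<le> Max ((\<lambda>m. of_int m * x + Sup (T m)) ` A)" .
    qed
    have "of_int m * x + Sup (T m) \<le> (SUP g\<in>\<Phi>. f g x)" if "m \<in> A" for m
    proof -
      have "Sup (T m) \<le> (SUP g\<in>\<Phi>. f g x) - of_int m * x"
        using that le[OF _ x, of _ m] by (intro cSup_least) (force simp: A_def)+
      then show ?thesis by simp
    qed
    then show "Max ((\<lambda>m. of_int m * x + Sup (T m)) ` A) \<le> (SUP g\<in>\<Phi>. f g x)"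
      using fin \<open>A \<noteq> {}\<close> by (intro Max.boundedI) auto
  qed
  have "\<exists>m. germ (\<lambda>x. Max ((\<lambda>m. of_int m * x + Sup (T m)) ` A)) 0 1 m"
    by (rule germ_Max) (use fin \<open>A \<noteq> {}\<close> germ_affine in blast)+
  then show ?thesis
    using germ_cong[of b "\<lambda>x. SUP g\<in>\<Phi>. f g x" 0 1 "\<lambda>x. Max ((\<lambda>m. of_int m * x + Sup (T m)) ` A)"] eq b by auto
qed

lemma gslope_affine:
  assumes "a < b" "\<And>x. a < x \<Longrightarrow> x < b \<Longrightarrow> h x = of_int m * x + c"
  shows "\<exists>i. germ h a 1 i \<Longrightarrow> gslope h a 1 = m" "\<exists>i. germ h b (-1) i \<Longrightarrow> gslope h b (-1) = - m"
proof -
  have ev: "\<forall>\<^sub>F x in at_right a. h x = of_int m * x + c" "\<forall>\<^sub>F x in at_left b. h x = of_int m * x + c"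
    unfolding eventually_at_right_field eventually_at_left_field using assms by blast+
  have "slope (at_right a) h = m"
    by (rule slope_eqI[OF _ ev(1)]) simp
  moreover have "slope (at_left b) h = m"
    by (rule slope_eqI[OF _ ev(2)]) simp
  ultimately show "\<exists>i. germ h a 1 i \<Longrightarrow> gslope h a 1 = m" "\<exists>i. germ h b (-1) i \<Longrightarrow> gslope h b (-1) = - m"
    using slope_at_right slope_at_left gslope_eq by fastforce+
qed

text \<open>The sum of the two outward slopes at a point is the jump of the slope along the
  coordinate, so the jumps telescope; the induction splits off the last breakpoint. The sign of
  \<open>gslope h b (-1)\<close> is reversed because it looks back into the interval.\<close>

lemma telescope:
  assumes "finite B" "a < b"
    and "\<And>J. is_interval J \<Longrightarrow> J \<subseteq> {a<..<b} - B \<Longrightarrow> \<exists>(m::int) c. \<forall>t\<in>J. h t = of_int m * t + c"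
    and "\<And>t. a \<le> t \<Longrightarrow> t < b \<Longrightarrow> \<exists>m. germ h t 1 m" "\<And>t. a < t \<Longrightarrow> t \<le> b \<Longrightarrow> \<exists>m. germ h t (-1) m"
  shows "(\<Sum>t\<in>B \<inter> {a<..<b}. gslope h t 1 + gslope h t (-1)) = - gslope h b (-1) - gslope h a 1"
  using assms
proof (induction "card (B \<inter> {a<..<b})" arbitrary: b)
  case 0
  then have "{a<..<b} \<subseteq> {a<..<b} - B" by auto
  with 0(4)[of "{a<..<b}"] obtain m :: int and c where "\<And>t. a < t \<Longrightarrow> t < b \<Longrightarrow> h t = of_int m * t + c"
    by auto
  from gslope_affine[OF 0(3) this] 0(5)[of a] 0(6)[of b] 0(3)
  have "gslope h a 1 = m" "gslope h b (-1) = - m" by auto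
  moreover have "B \<inter> {a<..<b} = {}" using 0(1,2) by auto
  ultimately show ?case by simp
next
  case (Suc n)
  define b' where "b' = Max (B \<inter> {a<..<b})"
  have fin: "finite (B \<inter> {a<..<b})" "B \<inter> {a<..<b} \<noteq> {}" using Suc(2,3) by auto
  then have b': "b' \<in> B" "a < b'" "b' < b" using Max_in[OF fin] by (auto simp: b'_def)
  have max: "t \<le> b'" if "t \<in> B" "a < t" "t < b" for t using that fin by (auto simp: b'_def intro!: Max_ge)
  have eq: "B \<inter> {a<..<b} = insert b' (B \<inter> {a<..<b'})" using b' max by force
  have "card (B \<inter> {a<..<b'}) = n" using Suc(2,3) unfolding eq by simp
  then have IH: "(\<Sum>t\<in>B \<inter> {a<..<b'}. gslope h t 1 + gslope h t (-1)) = - gslope h b' (-1) - gslope h a 1"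
    using b' Suc.prems by (intro Suc.hyps(1)) (auto intro!: Suc.prems(3))
  have "{b'<..<b} \<subseteq> {a<..<b} - B" using max b' by force
  with Suc.prems(3)[of "{b'<..<b}"] obtain m :: int and c where "\<And>t. b' < t \<Longrightarrow> t < b \<Longrightarrow> h t = of_int m * t + c"
    by auto
  from gslope_affine[OF b'(3) this] Suc.prems(4)[of b'] Suc.prems(5)[of b] b'
  have "gslope h b' 1 = m" "gslope h b (-1) = - m" by auto
  then show ?case unfolding eq using Suc(3) IH by simp
qed

section \<open>Edges of a tropical curve\<close>

lemma slope_add:
  assumes "punctured F"
    and "\<exists>m c. \<forall>\<^sub>F x in F. h x = of_int m * x + c" "\<exists>m c. \<forall>\<^sub>F x in F. k x = of_int m * x + c"
  shows "slope F (\<lambda>x. h x + k x) = slope F h + slope F k" "slope F (\<lambda>x. - h x) = - slope F h"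
proof -
  obtain m c where 1: "\<forall>\<^sub>F x in F. h x = of_int m * x + c" using assms(2) by blast
  obtain n d where 2: "\<forall>\<^sub>F x in F. k x = of_int n * x + d" using assms(3) by blast
  have 3: "\<forall>\<^sub>F x in F. h x + k x = of_int (m + n) * x + (c + d)"
    using 1 2 by eventually_elim (auto simp: algebra_simps)
  have 4: "\<forall>\<^sub>F x in F. - h x = of_int (- m) * x + (- c)"
    using 1 by eventually_elim (auto simp: algebra_simps)
  show "slope F (\<lambda>x. h x + k x) = slope F h + slope F k" "slope F (\<lambda>x. - h x) = - slope F h"
    using slope_eqI[OF assms(1) 1] slope_eqI[OF assms(1) 2] slope_eqI[OF assms(1) 3]
      slope_eqI[OF assms(1) 4] by simp_all
qed

lemma pw_linear_on_add:
  assumes "pw_linear_on I h" "pw_linear_on I k"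
  shows "pw_linear_on I (\<lambda>x. h x + k x)" "pw_linear_on I (\<lambda>x. - h x)"
proof -
  obtain B where B: "finite B" "\<forall>J. is_interval J \<and> J \<subseteq> I - B \<longrightarrow> (\<exists>(m::int) c. \<forall>t\<in>J. h t = of_int m * t + c)"
    using assms(1) unfolding pw_linear_on_def by (elim exE conjE)
  obtain B' where B': "finite B'" "\<forall>J. is_interval J \<and> J \<subseteq> I - B' \<longrightarrow> (\<exists>(m::int) c. \<forall>t\<in>J. k t = of_int m * t + c)"
    using assms(2) unfolding pw_linear_on_def by (elim exE conjE)
  have "\<exists>(m::int) c. \<forall>t\<in>J. h t + k t = of_int m * t + c" if J: "is_interval J" "J \<subseteq> I - (B \<union> B')" for J
  proof -
    have JB: "J \<subseteq> I - B" "J \<subseteq> I - B'" using J(2) by auto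
    obtain m :: int and c where "\<forall>t\<in>J. h t = of_int m * t + c" using B(2)[rule_format, OF conjI[OF J(1) JB(1)]] by (elim exE)
    moreover obtain n :: int and d where "\<forall>t\<in>J. k t = of_int n * t + d" using B'(2)[rule_format, OF conjI[OF J(1) JB(2)]] by (elim exE)
    ultimately have "\<forall>t\<in>J. h t + k t = of_int (m + n) * t + (c + d)" by (auto simp: algebra_simps)
    then show ?thesis by (intro exI)
  qed
  then show "pw_linear_on I (\<lambda>x. h x + k x)"
    unfolding pw_linear_on_def using B(1) B'(1) by (intro exI[of _ "B \<union> B'"]) simp
  have "\<exists>(m::int) c. \<forall>t\<in>J. - h t = of_int m * t + c" if J: "is_interval J" "J \<subseteq> I - B" for J
  proof -
    obtain m :: int and c where "\<forall>t\<in>J. h t = of_int m * t + c" using B(2)[rule_format, OF conjI[OF J]] by (elim exE)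
    then have "\<forall>t\<in>J. - h t = of_int (- m) * t + (- c)" by (auto simp: algebra_simps)
    then show ?thesis by (intro exI)
  qed
  then show "pw_linear_on I (\<lambda>x. - h x)"
    unfolding pw_linear_on_def using B(1) by (intro exI[of _ "B"]) simp
qed

locale tropical =
  fixes C :: "('v, 'e) metric_graph"
  assumes tropical_curve: "tropical_curve C"
begin

abbreviation "V \<equiv> verts (graph C)"
abbreviation "E \<equiv> arcs (graph C)"
abbreviation "src \<equiv> tail (graph C)"
abbreviation "tgt \<equiv> head (graph C)"

sublocale G: fin_digraph "graph C" using tropical_curve by (simp add: tropical_curve_def)

text \<open>\<open>E0\<close> and \<open>V0\<close> form the graph left after removing leaves and
  endpoints. Each of its edges is a compact interval \<open>{0..L e}\<close>, where arguments by
  maxima apply.\<close>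

definition "E0 = {e \<in> E. \<not> leaf C e}"
definition "V0 = {v \<in> V. \<not> endpoint C v}"
definition L :: "'e \<Rightarrow> real" where "L e = real_of_ereal (len C e)"

lemma finite_E0 [simp]: "finite E0" and finite_V0 [simp]: "finite V0"
  unfolding E0_def V0_def by auto

lemma E0_E: "e \<in> E0 \<Longrightarrow> e \<in> E" and V0_V: "v \<in> V0 \<Longrightarrow> v \<in> V"
  by (auto simp: E0_def V0_def)

lemma E0_len:
  assumes "e \<in> E0"
  shows "len C e = ereal (L e)" "0 < L e"
proof -
  have "0 < len C e \<and> len C e < \<infinity>"
    using assms tropical_curve unfolding E0_def tropical_curve_def by auto
  then show "len C e = ereal (L e)" "0 < L e" unfolding L_def by (cases "len C e"; auto)+
qed

lemma E0_ends: "e \<in> E0 \<Longrightarrow> src e \<in> V0" "e \<in> E0 \<Longrightarrow> tgt e \<in> V0"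
  unfolding E0_def V0_def leaf_def by auto

lemma E0_lo_hi: "e \<in> E0 \<Longrightarrow> lo C e = 0" "e \<in> E0 \<Longrightarrow> hi C e = ereal (L e)"
  using E0_len by (auto simp: lo_def hi_def E0_def leaf_def)

lemma leaf_len: "e \<in> E \<Longrightarrow> e \<notin> E0 \<Longrightarrow> len C e = \<infinity>"
  using tropical_curve unfolding E0_def tropical_curve_def by auto

lemma leaf_endpoint: "e \<in> E \<Longrightarrow> e \<notin> E0 \<Longrightarrow> endpoint C (src e) \<or> endpoint C (tgt e)"
  unfolding E0_def leaf_def by auto

lemma endpoint_leaf: "e \<in> E \<Longrightarrow> endpoint C (src e) \<or> endpoint C (tgt e) \<Longrightarrow> e \<notin> E0"
  unfolding E0_def leaf_def by auto

lemma E0_chart: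
  assumes "e \<in> E0"
  shows "chart C e 0 = Vertex (src e)" "chart C e (L e) = Vertex (tgt e)"
    "0 < t \<Longrightarrow> t < L e \<Longrightarrow> chart C e t = Inner e t"
  using E0_lo_hi[OF assms] E0_len[OF assms] by (auto simp: chart_def zero_ereal_def)

lemma E0_edge_dom: "e \<in> E0 \<Longrightarrow> edge_dom C e = {0..L e}"
  using E0_lo_hi by (auto simp: edge_dom_def)

lemma E0_filters: "e \<in> E0 \<Longrightarrow> at_tail C e = at_right 0" "e \<in> E0 \<Longrightarrow> at_head C e = at_left (L e)"
  using E0_lo_hi by (auto simp: at_tail_def at_head_def)

lemma lo_less_hi: "e \<in> E \<Longrightarrow> lo C e < hi C e"
proof (cases "e \<in> E0")
  case False
  assume "e \<in> E"
  then show ?thesis using leaf_len[OF _ False] leaf_endpoint[OF _ False] by (auto simp: lo_def hi_def)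
qed (auto simp: E0_lo_hi E0_len)

lemma eventually_at_tail:
  assumes "e \<in> E" "lo C e < ereal y"
  shows "\<forall>\<^sub>F t in at_tail C e. lo C e < ereal t \<and> t < y"
proof (cases "lo C e")
  case (real r)
  then show ?thesis using assms unfolding at_tail_def
    by (auto simp: eventually_at_right_field intro: exI[of _ y])
next
  case MInf
  then show ?thesis using eventually_gt_at_bot[of y] by (auto simp: at_tail_def)
qed (auto simp: lo_def split: if_splits)

lemma eventually_at_head:
  assumes "e \<in> E" "ereal y < hi C e"
  shows "\<forall>\<^sub>F t in at_head C e. ereal t < hi C e \<and> y < t"
proof (cases "hi C e")
  case (real r)
  then show ?thesis using assms unfolding at_head_def
    by (auto simp: eventually_at_left_field intro: exI[of _ y])
next
  case PInf
  then show ?thesis using eventually_gt_at_top[of y] by (auto simp: at_head_def)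
next
  case MInf
  then show ?thesis using assms by auto
qed

lemma punctured_ends [simp]: "punctured (at_tail C e)" "punctured (at_head C e)"
  unfolding at_tail_def at_head_def by auto

definition "open_edge e = {t. lo C e < ereal t \<and> ereal t < hi C e}"

lemma open_edge_interval: "is_interval (open_edge e)"
  unfolding is_interval_1
proof (intro ballI allI impI)
  fix a b x assume "a \<in> open_edge e" "b \<in> open_edge e" "a \<le> x \<and> x \<le> b"
  then have "lo C e < ereal a" "ereal a \<le> ereal x" "ereal x \<le> ereal b" "ereal b < hi C e"
    unfolding open_edge_def by auto
  then show "x \<in> open_edge e"
    unfolding open_edge_def using less_le_trans le_less_trans by blast
qed

lemma edge_dom_interval: "is_interval (edge_dom C e)"
  unfolding is_interval_1
proof (intro ballI allI impI)
  fix a b x assume "a \<in> edge_dom C e" "b \<in> edge_dom C e" "a \<le> x \<and> x \<le> b"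
  then have "lo C e \<le> ereal a" "ereal a \<le> ereal x" "ereal x \<le> ereal b" "ereal b \<le> hi C e"
    unfolding edge_dom_def by auto
  then show "x \<in> edge_dom C e"
    unfolding edge_dom_def using order_trans by blast
qed

lemma open_edge_dom: "t \<in> open_edge e \<Longrightarrow> t \<in> edge_dom C e"
  unfolding open_edge_def edge_dom_def by auto

lemma open_edge_beyond:
  assumes "t \<in> open_edge e"
  shows "\<exists>u. t < u \<and> u \<in> open_edge e" "\<exists>u. u < t \<and> u \<in> open_edge e"
proof -
  have t: "lo C e < ereal t" "ereal t < hi C e" using assms unfolding open_edge_def by auto
  obtain u where "ereal t < ereal u" "ereal u < hi C e" using ereal_dense2[OF t(2)] by blast
  then show "\<exists>u. t < u \<and> u \<in> open_edge e" unfolding open_edge_def using t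
    by (intro exI[of _ u]) (auto intro: less_trans)
  obtain u where "lo C e < ereal u" "ereal u < ereal t" using ereal_dense2[OF t(1)] by blast
  moreover from this(2) t(2) have "ereal u < hi C e" by (rule less_trans)
  ultimately show "\<exists>u. u < t \<and> u \<in> open_edge e" unfolding open_edge_def
    by (intro exI[of _ u]) auto
qed

lemma points_iff: "Vertex v \<in> points C \<longleftrightarrow> v \<in> V" "Inner e t \<in> points C \<longleftrightarrow> e \<in> E \<and> t \<in> open_edge e"
  unfolding points_def open_edge_def by auto

lemma rational_germ:
  assumes "rational_fun C f" "e \<in> E" "t \<in> open_edge e" "s = 1 \<or> s = -1"
  shows "\<exists>m. germ (f \<circ> chart C e) t s m"
proof -
  obtain u v where uv: "t < u" "u \<in> open_edge e" "v < t" "v \<in> open_edge e" using open_edge_beyond[OF assms(3)] by blast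
  have "\<exists>y>0. t + s * y \<in> edge_dom C e"
    using assms(4) uv open_edge_dom by (auto intro: exI[of _ "u - t"] exI[of _ "t - v"])
  then obtain y where y: "y > 0" "t + s * y \<in> edge_dom C e" by blast
  show ?thesis
    using assms(1,2) by (intro pw_linear_germ[OF _ _ edge_dom_interval open_edge_dom[OF assms(3)] assms(4) y(2,1)])
      (auto simp: rational_fun_def)
qed

lemma ord_inner:
  assumes "rational_fun C f" "e \<in> E" "t \<in> open_edge e"
  shows "ord_at C f (Inner e t) = gslope (f \<circ> chart C e) t 1 + gslope (f \<circ> chart C e) t (-1)"
proof -
  obtain m n where mn: "germ (f \<circ> chart C e) t 1 m" "germ (f \<circ> chart C e) t (-1) n"
    using rational_germ[OF assms] by blast
  show ?thesis using slope_at_right[OF mn(1)] slope_at_left[OF mn(2)] gslope_eq[OF mn(1)] gslope_eq[OF mn(2)]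
    by simp
qed

text \<open>Outside a compact part of the edge that contains all breakpoints the function is affine
  up to either end, finite or infinite. Telescoping between two points \<open>a\<close> and
  \<open>b\<close> beyond the breakpoints therefore yields the slopes at the ends.\<close>

lemma edge_structure:
  assumes f: "rational_fun C f" and e: "e \<in> E"
  obtains B where "finite B" "B \<subseteq> open_edge e"
    "\<And>t. t \<in> open_edge e \<Longrightarrow> t \<notin> B \<Longrightarrow> ord_at C f (Inner e t) = 0"
    "(\<Sum>t\<in>B. ord_at C f (Inner e t)) = slope (at_head C e) (f \<circ> chart C e) - slope (at_tail C e) (f \<circ> chart C e)"
    "\<exists>m c. \<forall>\<^sub>F t in at_tail C e. (f \<circ> chart C e) t = of_int m * t + c"
    "\<exists>m c. \<forall>\<^sub>F t in at_head C e. (f \<circ> chart C e) t = of_int m * t + c"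
proof -
  define h where "h = f \<circ> chart C e"
  have "pw_linear_on (edge_dom C e) h" using f e unfolding rational_fun_def h_def by blast
  then have "pw_linear_on (open_edge e) h" by (rule pw_linear_on_subset) (use open_edge_dom in blast)
  then obtain B0 where B0: "finite B0" "\<forall>J. is_interval J \<and> J \<subseteq> open_edge e - B0 \<longrightarrow> (\<exists>(m::int) c. \<forall>t\<in>J. h t = of_int m * t + c)"
    unfolding pw_linear_on_def by (elim exE conjE)
  define B where "B = B0 \<inter> open_edge e"
  have B: "finite B" "B \<subseteq> open_edge e" using B0(1) by (auto simp: B_def)
  have aff: "\<exists>(m::int) c. \<forall>t\<in>J. h t = of_int m * t + c" if "is_interval J" "J \<subseteq> open_edge e - B" for J
  proof -
    have "J \<subseteq> open_edge e - B0" using that(2) by (auto simp: B_def)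
    then show ?thesis using B0(2)[rule_format, OF conjI[OF that(1)]] by blast
  qed
  have gex: "\<exists>m. germ h t 1 m" "\<exists>m. germ h t (-1) m" if "t \<in> open_edge e" for t
    using rational_germ[OF f e that] unfolding h_def by auto
  obtain x0 where x0: "x0 \<in> open_edge e"
    using ereal_dense2[OF lo_less_hi[OF e]] unfolding open_edge_def by blast
  \<comment> \<open>The extra point \<open>x0\<close> keeps the minimum and maximum meaningful when
    there are no breakpoints.\<close>
  define mn mx where "mn = Min (insert x0 B)" and "mx = Max (insert x0 B)"
  have "mn \<in> insert x0 B" "mx \<in> insert x0 B" unfolding mn_def mx_def by (intro Min_in Max_in; use B(1) in simp)+
  then have m: "mn \<in> open_edge e" "mx \<in> open_edge e" using x0 B(2) by auto
  have le: "mn \<le> mx" using B(1) unfolding mn_def mx_def by (meson Max_ge Min_le finite_insert insertI1 order_trans)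
  have bnd: "mn \<le> t \<and> t \<le> mx" if "t \<in> B" for t using that B(1) unfolding mn_def mx_def by auto
  obtain a where a: "a < mn" "a \<in> open_edge e" using open_edge_beyond(2)[OF m(1)] by blast
  obtain b where b: "mx < b" "b \<in> open_edge e" using open_edge_beyond(1)[OF m(2)] by blast
  have mid: "t \<in> open_edge e" if "a \<le> t" "t \<le> b" for t
    using mem_is_interval_1_I[OF open_edge_interval a(2) b(2) that] .
  have "is_interval (open_edge e \<inter> {..<mn})" "open_edge e \<inter> {..<mn} \<subseteq> open_edge e - B"
    using bnd open_edge_interval by (auto intro!: is_interval_Int simp: not_less[symmetric])
  from aff[OF this] obtain p :: int and c where p: "\<And>t. t \<in> open_edge e \<Longrightarrow> t < mn \<Longrightarrow> h t = of_int p * t + c" by auto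
  have "is_interval (open_edge e \<inter> {mx<..})" "open_edge e \<inter> {mx<..} \<subseteq> open_edge e - B"
    using bnd open_edge_interval by (auto intro!: is_interval_Int simp: not_less[symmetric])
  from aff[OF this] obtain q :: int and d where q: "\<And>t. t \<in> open_edge e \<Longrightarrow> mx < t \<Longrightarrow> h t = of_int q * t + d" by auto
  have evt: "\<forall>\<^sub>F t in at_tail C e. h t = of_int p * t + c"
  proof -
    have "lo C e < ereal mn" "ereal mn < hi C e" using m(1) unfolding open_edge_def by auto
    note mn = this
    from eventually_at_tail[OF e mn(1)] show ?thesis
    proof eventually_elim
      case (elim t)
      then have "ereal t < ereal mn" by simp
      from less_trans[OF this mn(2)] elim show ?case by (intro p) (auto simp: open_edge_def)
    qed
  qed
  have evh: "\<forall>\<^sub>F t in at_head C e. h t = of_int q * t + d"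
  proof -
    have "lo C e < ereal mx" "ereal mx < hi C e" using m(2) unfolding open_edge_def by auto
    note mx = this
    from eventually_at_head[OF e mx(2)] show ?thesis
    proof eventually_elim
      case (elim t)
      then have "ereal mx < ereal t" by simp
      from less_trans[OF mx(1) this] elim show ?case by (intro q) (auto simp: open_edge_def)
    qed
  qed
  have st: "slope (at_tail C e) h = p" using slope_eqI[OF _ evt] by simp
  have sh: "slope (at_head C e) h = q" using slope_eqI[OF _ evh] by simp
  have ga: "gslope h a 1 = p"
    by (rule gslope_affine(1)[OF a(1), of _ _ c]) (use p a m mid le b in \<open>auto intro!: gex\<close>)
  have gb: "gslope h b (-1) = - q"
    by (rule gslope_affine(2)[OF b(1), of _ _ d]) (use q a m mid le b in \<open>auto intro!: gex\<close>)
  have "(\<Sum>t\<in>B \<inter> {a<..<b}. gslope h t 1 + gslope h t (-1)) = - gslope h b (-1) - gslope h a 1"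
  proof (rule telescope[OF B(1)])
    show "\<exists>(m::int) c. \<forall>t\<in>J. h t = of_int m * t + c" if "is_interval J" "J \<subseteq> {a<..<b} - B" for J
      using that mid by (intro aff) force+
  qed (use a b le mid in \<open>auto intro!: gex\<close>)
  moreover have "B \<inter> {a<..<b} = B" using bnd a b by fastforce
  ultimately have sum: "(\<Sum>t\<in>B. ord_at C f (Inner e t)) = q - p"
    using ga gb B(2) by (subst sum.cong[OF refl ord_inner[OF f e]]) (auto simp flip: h_def)
  have zero: "ord_at C f (Inner e t) = 0" if t: "t \<in> open_edge e" "t \<notin> B" for t
  proof -
    obtain u v where uv: "t < u" "u \<in> open_edge e" "v < t" "v \<in> open_edge e" using open_edge_beyond[OF t(1)] by blast
    have "\<forall>\<^sub>F x in nhds t. x \<in> {v<..<u} - B"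
      using uv t(2) finite_imp_closed[OF B(1)] by (intro eventually_nhds_in_open) auto
    then obtain r where r: "r > 0" "\<And>x. \<bar>x - t\<bar> < r \<Longrightarrow> x \<in> {v<..<u} - B"
      unfolding eventually_nhds_metric dist_real_def by blast
    have "x \<in> open_edge e - B" if "x \<in> {t-r<..<t+r}" for x
      using mem_is_interval_1_I[OF open_edge_interval uv(4,2), of x] r(2)[of x] that by (auto simp: abs_less_iff)
    then have "{t-r<..<t+r} \<subseteq> open_edge e - B" by blast
    from aff[OF _ this] obtain m :: int and c where mc: "\<And>x. x \<in> {t-r<..<t+r} \<Longrightarrow> h x = of_int m * x + c" by auto
    have "gslope h t 1 = m"
      by (rule gslope_affine(1)[of t "t + r" h m c]) (use r mc in \<open>auto intro!: gex t\<close>)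
    moreover have "gslope h t (-1) = - m"
      by (rule gslope_affine(2)[of "t - r" t h m c]) (use r mc in \<open>auto intro!: gex t\<close>)
    ultimately show ?thesis using ord_inner[OF f e t(1)] by (simp add: h_def)
  qed
  show ?thesis
    using that[OF B zero] sum st sh evt evh unfolding h_def by blast
qed

end

section \<open>Divisors and linear systems\<close>

lemma deg_eq_sum:
  assumes "finite X" "Poly_Mapping.keys D \<subseteq> X"
  shows "deg D = (\<Sum>p\<in>X. Poly_Mapping.lookup D p)"
  unfolding deg_def by (rule sum.mono_neutral_left) (use assms in \<open>auto simp: in_keys_iff\<close>)

lemma deg_add: "deg (D1 + D2) = deg D1 + deg D2" and deg_diff: "deg (D1 - D2) = deg D1 - deg D2"
proof -
  define X where "X = Poly_Mapping.keys D1 \<union> Poly_Mapping.keys D2"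
  have X: "finite X" "Poly_Mapping.keys D1 \<subseteq> X" "Poly_Mapping.keys D2 \<subseteq> X"
    "Poly_Mapping.keys (D1 + D2) \<subseteq> X" "Poly_Mapping.keys (D1 - D2) \<subseteq> X"
    unfolding X_def by (auto simp: in_keys_iff lookup_add lookup_minus)
  show "deg (D1 + D2) = deg D1 + deg D2" "deg (D1 - D2) = deg D1 - deg D2"
    using X by (simp_all add: deg_eq_sum[OF X(1)] lookup_add lookup_minus sum.distrib sum_subtractf)
qed

lemma deg_single [simp]: "deg (Poly_Mapping.single p n) = n"
  by (cases "n = 0") (auto simp: deg_def)

lemma deg_zero [simp]: "deg 0 = 0"
  by (simp add: deg_def)

lemma deg_nonneg: "effective D \<Longrightarrow> 0 \<le> deg D"
  unfolding deg_def effective_def by (auto intro: sum_nonneg)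

lemma effective_deg_0:
  assumes "effective D" "deg D = 0" shows "D = 0"
proof -
  have "\<forall>p\<in>Poly_Mapping.keys D. Poly_Mapping.lookup D p = 0"
    using assms sum_nonneg_eq_0_iff[of "Poly_Mapping.keys D" "Poly_Mapping.lookup D"]
    unfolding effective_def deg_def by auto
  then show ?thesis by (intro poly_mapping_eqI) (metis in_keys_iff lookup_zero)
qed

lemma effective_add: "effective D1 \<Longrightarrow> effective D2 \<Longrightarrow> effective (D1 + D2)"
  unfolding effective_def by (simp add: lookup_add)

lemma divisors_iff: "D \<in> divisors C \<longleftrightarrow> (\<forall>p. p \<notin> points C \<longrightarrow> Poly_Mapping.lookup D p = 0)"
  unfolding divisors_def by (auto simp: in_keys_iff subset_iff)

lemma divisors_add: "D1 \<in> divisors C \<Longrightarrow> D2 \<in> divisors C \<Longrightarrow> D1 + D2 \<in> divisors C"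
  and divisors_diff: "D1 \<in> divisors C \<Longrightarrow> D2 \<in> divisors C \<Longrightarrow> D1 - D2 \<in> divisors C"
  and divisors_single: "p \<in> points C \<Longrightarrow> Poly_Mapping.single p n \<in> divisors C"
  and divisors_zero: "0 \<in> divisors C"
  unfolding divisors_iff by (auto simp: lookup_add lookup_minus lookup_single when_def)

lemma rational_fun_add: "rational_fun C f \<Longrightarrow> rational_fun C h \<Longrightarrow> rational_fun C (\<lambda>p. f p + h p)"
  and rational_fun_uminus: "rational_fun C f \<Longrightarrow> rational_fun C (\<lambda>p. - f p)"
  unfolding rational_fun_def
  by (auto simp: comp_def intro!: pw_linear_on_add continuous_intros)

lemma rational_fun_const: "rational_fun C (\<lambda>p. c)"
  unfolding rational_fun_def by (auto simp: comp_def intro!: pw_linear_on_affine[of _ _ 0 c])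

context tropical
begin

lemma rational_slope:
  assumes "rational_fun C f" "e \<in> E"
  shows "\<exists>m c. \<forall>\<^sub>F t in at_tail C e. (f \<circ> chart C e) t = of_int m * t + c"
    "\<exists>m c. \<forall>\<^sub>F t in at_head C e. (f \<circ> chart C e) t = of_int m * t + c"
  using edge_structure[OF assms] by blast+

lemma slope_tail_add:
  assumes "rational_fun C f" "rational_fun C h" "e \<in> E"
  shows "slope (at_tail C e) ((\<lambda>p. f p + h p) \<circ> chart C e) = slope (at_tail C e) (f \<circ> chart C e) + slope (at_tail C e) (h \<circ> chart C e)"
    "slope (at_tail C e) ((\<lambda>p. - f p) \<circ> chart C e) = - slope (at_tail C e) (f \<circ> chart C e)"
    "slope (at_head C e) ((\<lambda>p. f p + h p) \<circ> chart C e) = slope (at_head C e) (f \<circ> chart C e) + slope (at_head C e) (h \<circ> chart C e)"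
    "slope (at_head C e) ((\<lambda>p. - f p) \<circ> chart C e) = - slope (at_head C e) (f \<circ> chart C e)"
proof -
  have *: "(\<lambda>p. f p + h p) \<circ> chart C e = (\<lambda>x. (f \<circ> chart C e) x + (h \<circ> chart C e) x)"
    "(\<lambda>p. - f p) \<circ> chart C e = (\<lambda>x. - (f \<circ> chart C e) x)" by auto
  note f = rational_slope[OF assms(1,3)] and h = rational_slope[OF assms(2,3)]
  show "slope (at_tail C e) ((\<lambda>p. f p + h p) \<circ> chart C e) = slope (at_tail C e) (f \<circ> chart C e) + slope (at_tail C e) (h \<circ> chart C e)"
    "slope (at_tail C e) ((\<lambda>p. - f p) \<circ> chart C e) = - slope (at_tail C e) (f \<circ> chart C e)"
    "slope (at_head C e) ((\<lambda>p. f p + h p) \<circ> chart C e) = slope (at_head C e) (f \<circ> chart C e) + slope (at_head C e) (h \<circ> chart C e)"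
    "slope (at_head C e) ((\<lambda>p. - f p) \<circ> chart C e) = - slope (at_head C e) (f \<circ> chart C e)"
    unfolding * by (rule slope_add[OF punctured_ends(1) f(1) h(1)] slope_add[OF punctured_ends(2) f(2) h(2)])+
qed

lemma ord_at_add:
  assumes "rational_fun C f" "rational_fun C h" "p \<in> points C"
  shows "ord_at C (\<lambda>p. f p + h p) p = ord_at C f p + ord_at C h p" "ord_at C (\<lambda>p. - f p) p = - ord_at C f p"
proof -
  have "ord_at C (\<lambda>p. f p + h p) p = ord_at C f p + ord_at C h p \<and> ord_at C (\<lambda>p. - f p) p = - ord_at C f p"
  proof (cases p)
    case (Vertex v)
    then show ?thesis
      by (simp add: sum.distrib sum_negf sum_subtractf slope_tail_add[OF assms(1,2)] cong: sum.cong_simp)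
  next
    case (Inner e t)
    then have e: "e \<in> E" "t \<in> open_edge e" using assms(3) by (auto simp: points_iff)
    obtain m n where f: "germ (f \<circ> chart C e) t 1 m" "germ (f \<circ> chart C e) t (-1) n"
      using rational_germ[OF assms(1) e] by blast
    obtain m' n' where h: "germ (h \<circ> chart C e) t 1 m'" "germ (h \<circ> chart C e) t (-1) n'"
      using rational_germ[OF assms(2) e] by blast
    have *: "(\<lambda>p. f p + h p) \<circ> chart C e = (\<lambda>x. (f \<circ> chart C e) x + (h \<circ> chart C e) x)"
      "(\<lambda>p. - f p) \<circ> chart C e = (\<lambda>x. - (f \<circ> chart C e) x)" by auto
    show ?thesis
      unfolding Inner ord_inner[OF assms(1) e] ord_inner[OF assms(2) e]
        ord_inner[OF rational_fun_add[OF assms(1,2)] e] ord_inner[OF rational_fun_uminus[OF assms(1)] e] *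
      using gslope_eq[OF f(1)] gslope_eq[OF f(2)] gslope_eq[OF h(1)] gslope_eq[OF h(2)]
        gslope_eq[OF germ_add[OF f(1) h(1)]] gslope_eq[OF germ_add[OF f(2) h(2)]]
        gslope_eq[OF germ_uminus[OF f(1)]] gslope_eq[OF germ_uminus[OF f(2)]] by simp
  qed
  then show "ord_at C (\<lambda>p. f p + h p) p = ord_at C f p + ord_at C h p" "ord_at C (\<lambda>p. - f p) p = - ord_at C f p"
    by auto
qed

text \<open>Along each edge the inner orders add up to head slope minus tail slope, while the
  vertices collect the same slopes with opposite signs. Regrouping the vertex sums by edges cancels
  everything.\<close>

lemma principal_degree:
  assumes f: "rational_fun C f"
  shows "\<exists>X. finite X \<and> X \<subseteq> points C \<and> (\<forall>p\<in>points C - X. ord_at C f p = 0) \<and> (\<Sum>p\<in>X. ord_at C f p) = 0"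
proof -
  let ?st = "\<lambda>e. slope (at_tail C e) (f \<circ> chart C e)"
  let ?sh = "\<lambda>e. slope (at_head C e) (f \<circ> chart C e)"
  have "\<exists>B. finite B \<and> B \<subseteq> open_edge e \<and> (\<forall>t. t \<in> open_edge e \<longrightarrow> t \<notin> B \<longrightarrow> ord_at C f (Inner e t) = 0) \<and>
      (\<Sum>t\<in>B. ord_at C f (Inner e t)) = ?sh e - ?st e" if "e \<in> E" for e
    using edge_structure[OF f that] by metis
  then obtain B where B: "\<And>e. e \<in> E \<Longrightarrow> finite (B e)" "\<And>e. e \<in> E \<Longrightarrow> B e \<subseteq> open_edge e"
    "\<And>e t. e \<in> E \<Longrightarrow> t \<in> open_edge e \<Longrightarrow> t \<notin> B e \<Longrightarrow> ord_at C f (Inner e t) = 0"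
    "\<And>e. e \<in> E \<Longrightarrow> (\<Sum>t\<in>B e. ord_at C f (Inner e t)) = ?sh e - ?st e"
    by metis
  define X where "X = Vertex ` V \<union> (\<Union>e\<in>E. Inner e ` B e)"
  have "finite X" unfolding X_def using B(1) by auto
  moreover have "X \<subseteq> points C" unfolding X_def using B(2) by (fastforce simp: points_iff)
  moreover have "ord_at C f p = 0" if "p \<in> points C" "p \<notin> X" for p
  proof (cases p)
    case (Inner e t)
    then have "e \<in> E" "t \<in> open_edge e" "t \<notin> B e" using that unfolding X_def by (auto simp: points_iff)
    then show ?thesis unfolding Inner by (rule B(3))
  qed (use that in \<open>auto simp: X_def points_iff\<close>)
  moreover have "(\<Sum>p\<in>X. ord_at C f p) = 0"
  proof -
    have "(\<Sum>p\<in>X. ord_at C f p) = (\<Sum>p\<in>Vertex ` V. ord_at C f p) + (\<Sum>p\<in>(\<Union>e\<in>E. Inner e ` B e). ord_at C f p)"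
      unfolding X_def by (rule sum.union_disjoint) (use B(1) in auto)
    also have "(\<Sum>p\<in>(\<Union>e\<in>E. Inner e ` B e). ord_at C f p) = (\<Sum>e\<in>E. \<Sum>p\<in>Inner e ` B e. ord_at C f p)"
      by (rule sum.UNION_disjoint) (use B(1) in auto)
    also have "\<dots> = (\<Sum>e\<in>E. ?sh e - ?st e)"
      by (rule sum.cong[OF refl]) (use B(4) in \<open>simp add: sum.reindex inj_on_def\<close>)
    also have "(\<Sum>p\<in>Vertex ` V. ord_at C f p) = (\<Sum>v\<in>V. (\<Sum>e\<in>{e\<in>E. src e = v}. ?st e) - (\<Sum>e\<in>{e\<in>E. tgt e = v}. ?sh e))"
      by (simp add: sum.reindex inj_on_def sum_negf in_arcs_def out_arcs_def)
    also have "\<dots> = (\<Sum>e\<in>E. ?st e) - (\<Sum>e\<in>E. ?sh e)"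
    proof -
      have "(\<Sum>v\<in>V. \<Sum>e\<in>{e\<in>E. src e = v}. ?st e) = (\<Sum>e\<in>E. ?st e)" by (rule sum.group) auto
      moreover have "(\<Sum>v\<in>V. \<Sum>e\<in>{e\<in>E. tgt e = v}. ?sh e) = (\<Sum>e\<in>E. ?sh e)" by (rule sum.group) auto
      ultimately show ?thesis by (simp add: sum_subtractf)
    qed
    finally show ?thesis unfolding sum_subtractf by simp
  qed
  ultimately show ?thesis by blast
qed

text \<open>The principal divisor of \<open>f\<close>. It is meaningful for rational
  \<open>f\<close>, whose order vanishes outside a finite set.\<close>

definition pdiv :: "(('v, 'e) point \<Rightarrow> real) \<Rightarrow> ('v, 'e) divisor" where
  "pdiv f = Abs_poly_mapping (\<lambda>p. if p \<in> points C then ord_at C f p else 0)"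

lemma lookup_pdiv:
  assumes "rational_fun C f"
  shows "Poly_Mapping.lookup (pdiv f) p = (if p \<in> points C then ord_at C f p else 0)"
proof -
  obtain X where X: "finite X" "\<forall>p\<in>points C - X. ord_at C f p = 0"
    using principal_degree[OF assms] by blast
  have "finite {p. (if p \<in> points C then ord_at C f p else 0) \<noteq> 0}"
    by (rule finite_subset[OF _ X(1)]) (use X(2) in \<open>auto split: if_splits\<close>)
  then show ?thesis unfolding pdiv_def by (simp add: Abs_poly_mapping_inverse)
qed

lemma pdiv_divisor: "rational_fun C f \<Longrightarrow> pdiv f \<in> divisors C"
  unfolding divisors_def by (auto simp: in_keys_iff lookup_pdiv split: if_splits)

lemma deg_pdiv:
  assumes "rational_fun C f" shows "deg (pdiv f) = 0"
proof -
  obtain X where X: "finite X" "X \<subseteq> points C" "\<forall>p\<in>points C - X. ord_at C f p = 0" "(\<Sum>p\<in>X. ord_at C f p) = 0"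
    using principal_degree[OF assms] by blast
  have "deg (pdiv f) = (\<Sum>p\<in>X. Poly_Mapping.lookup (pdiv f) p)"
    by (rule deg_eq_sum[OF X(1)]) (use X(3) in \<open>auto simp: in_keys_iff lookup_pdiv[OF assms] split: if_splits\<close>)
  also have "\<dots> = (\<Sum>p\<in>X. ord_at C f p)" using X(2) by (intro sum.cong) (auto simp: lookup_pdiv[OF assms])
  finally show ?thesis using X(4) by simp
qed

lemma pdiv_add: "rational_fun C f \<Longrightarrow> rational_fun C h \<Longrightarrow> pdiv (\<lambda>p. f p + h p) = pdiv f + pdiv h"
  by (rule poly_mapping_eqI) (auto simp: lookup_add lookup_pdiv rational_fun_add ord_at_add)

lemma pdiv_uminus: "rational_fun C f \<Longrightarrow> pdiv (\<lambda>p. - f p) = - pdiv f"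
  by (rule poly_mapping_eqI) (auto simp: lookup_pdiv rational_fun_uminus ord_at_add(2)[of f f])

lemma pdiv_zero: "pdiv (\<lambda>p. 0) = 0"
  using pdiv_add[OF rational_fun_const[of C 0] rational_fun_const[of C 0]] by simp

lemma linsys_iff:
  assumes "D \<in> divisors C"
  shows "linsys C D \<noteq> {} \<longleftrightarrow> (\<exists>f. rational_fun C f \<and> effective (D + pdiv f))"
proof
  assume "linsys C D \<noteq> {}"
  then obtain D' f where D': "D' \<in> divisors C" "effective D'" and f: "rational_fun C f"
    "\<And>p. p \<in> points C \<Longrightarrow> Poly_Mapping.lookup (D' - D) p = ord_at C f p"
    unfolding linsys_def lin_equiv_def by blast
  have "Poly_Mapping.lookup (D' - D) p = 0" if "p \<notin> points C" for p
    using divisors_diff[OF D'(1) assms] that unfolding divisors_def by (auto simp: in_keys_iff)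
  then have "D' - D = pdiv f" by (intro poly_mapping_eqI) (auto simp: lookup_pdiv[OF f(1)] f(2))
  then have "D' = D + pdiv f" by (simp add: algebra_simps)
  then show "\<exists>f. rational_fun C f \<and> effective (D + pdiv f)" using D' f(1) by blast
next
  assume "\<exists>f. rational_fun C f \<and> effective (D + pdiv f)"
  then obtain f where f: "rational_fun C f" "effective (D + pdiv f)" by blast
  then have "D + pdiv f \<in> linsys C D"
    unfolding linsys_def lin_equiv_def using divisors_add[OF assms pdiv_divisor[OF f(1)]]
    by (auto intro!: exI[of _ f] simp: lookup_pdiv)
  then show "linsys C D \<noteq> {}" by blast
qed

lemma linsys_add_effective:
  assumes "D \<in> divisors C" "R \<in> divisors C" "effective R" "linsys C D \<noteq> {}"
  shows "linsys C (D + R) \<noteq> {}"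
proof -
  obtain f where f: "rational_fun C f" "effective (D + pdiv f)" using assms linsys_iff by blast
  then have "effective (D + R + pdiv f)" using effective_add[OF f(2) assms(3)] by (simp add: algebra_simps)
  then show ?thesis using f(1) linsys_iff[OF divisors_add[OF assms(1,2)]] by blast
qed

lemma linsys_pdiv:
  assumes "D \<in> divisors C" "rational_fun C f"
  shows "linsys C (D + pdiv f) \<noteq> {} \<longleftrightarrow> linsys C D \<noteq> {}"
proof
  assume "linsys C (D + pdiv f) \<noteq> {}"
  then obtain h where "rational_fun C h" "effective (D + pdiv f + pdiv h)"
    using linsys_iff[OF divisors_add[OF assms(1) pdiv_divisor[OF assms(2)]]] by blast
  then show "linsys C D \<noteq> {}" unfolding linsys_iff[OF assms(1)]
    by (intro exI[of _ "\<lambda>p. f p + h p"]) (auto simp: assms rational_fun_add pdiv_add algebra_simps)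
next
  assume "linsys C D \<noteq> {}"
  then obtain h where h: "rational_fun C h" "effective (D + pdiv h)"
    using linsys_iff[OF assms(1)] by blast
  note mf = rational_fun_uminus[OF assms(2)]
  then show "linsys C (D + pdiv f) \<noteq> {}" unfolding linsys_iff[OF divisors_add[OF assms(1) pdiv_divisor[OF assms(2)]]]
  proof (intro exI conjI)
    show "rational_fun C (\<lambda>p. h p + - f p)" by (rule rational_fun_add[OF h(1) mf])
    show "effective (D + pdiv f + pdiv (\<lambda>p. h p + - f p))"
      unfolding pdiv_add[OF h(1) mf] pdiv_uminus[OF assms(2)] using h(2) by simp
  qed
qed

lemma linsys_deg: "D \<in> divisors C \<Longrightarrow> linsys C D \<noteq> {} \<Longrightarrow> 0 \<le> deg D"
  using linsys_iff deg_nonneg deg_add deg_pdiv by (metis add.right_neutral)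

section \<open>Dimension of a linear system and the reduction of Riemann-Roch to one existence
  statement\<close>

lemma V_nonempty: "\<exists>v. v \<in> V"
  using tropical_curve unfolding tropical_curve_def Digraph_Component.connected_def strongly_connected_def by auto

text \<open>\<open>GREATEST\<close> is well defined because removing more than \<open>deg D\<close>
  chips leaves a divisor of negative degree. The two conclusions are all that is used later about
  dimensions.\<close>

lemma dim_linsys_attained:
  assumes D: "D \<in> divisors C"
  shows "\<exists>R\<in>divisors C. effective R \<and> deg R = dim_linsys C D + 1 \<and> linsys C (D - R) = {}"
    and dim_linsys_less: "\<And>R. R \<in> divisors C \<Longrightarrow> effective R \<Longrightarrow> linsys C (D - R) = {} \<Longrightarrow> dim_linsys C D < deg R"
proof -
  define P where "P = (\<lambda>r::nat. \<forall>R\<in>divisors C. effective R \<and> deg R = int r \<longrightarrow> linsys C (D - R) \<noteq> {})"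
  define r where "r = Greatest P"
  obtain v where v: "v \<in> V" using V_nonempty by blast
  have pv: "Vertex v \<in> points C" using v by (simp add: points_iff)
  have "(\<exists>R\<in>divisors C. effective R \<and> deg R = dim_linsys C D + 1 \<and> linsys C (D - R) = {}) \<and>
    (\<forall>R\<in>divisors C. effective R \<longrightarrow> linsys C (D - R) = {} \<longrightarrow> dim_linsys C D < deg R)"
  proof (cases "linsys C D = {}")
    case True
    then have "dim_linsys C D = -1" by (simp add: dim_linsys_def)
    then show ?thesis using True deg_nonneg by (auto intro!: bexI[of _ 0] divisors_zero simp: effective_def) force
  next
    case False
    have dim: "dim_linsys C D = int r" using False by (simp add: dim_linsys_def r_def P_def)
    have P0: "P 0" unfolding P_def using False effective_deg_0 by force
    have bound: "\<forall>y. P y \<longrightarrow> y \<le> nat (deg D)"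
    proof (intro allI impI)
      fix y assume "P y"
      have S: "Poly_Mapping.single (Vertex v) (int y) \<in> divisors C" using divisors_single[OF pv] .
      have "linsys C (D - Poly_Mapping.single (Vertex v) (int y)) \<noteq> {}"
        using \<open>P y\<close> S unfolding P_def effective_def by (auto simp: lookup_single when_def)
      from linsys_deg[OF divisors_diff[OF D S] this] show "y \<le> nat (deg D)" by (simp add: deg_diff)
    qed
    have Pr: "P r" unfolding r_def using GreatestI_nat[of P 0, OF P0] bound by blast
    have "\<not> P (Suc r)" using Greatest_le_nat[of P "Suc r" "nat (deg D)"] bound unfolding r_def by force
    then obtain R where R: "R \<in> divisors C" "effective R" "deg R = int (Suc r)" "linsys C (D - R) = {}"
      unfolding P_def by blast
    moreover have "dim_linsys C D < deg R" if R: "R \<in> divisors C" "effective R" "linsys C (D - R) = {}" for R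
    proof (rule ccontr)
      assume "\<not> ?thesis"
      then have le: "deg R \<le> int r" using dim by simp
      \<comment> \<open>If \<open>R\<close> has too few chips, it is padded at an arbitrary vertex
        up to degree \<open>r\<close>; removing fewer chips can only make the system larger.\<close>
      define S :: "('v, 'e) divisor" where "S = Poly_Mapping.single (Vertex v) (int r - deg R)"
      have S: "S \<in> divisors C" "effective S" "deg S = int r - deg R"
        unfolding S_def using divisors_single[OF pv] le by (auto simp: effective_def lookup_single when_def)
      then have "linsys C (D - (R + S)) \<noteq> {}"
        using Pr divisors_add[OF R(1) S(1)] effective_add[OF R(2) S(2)] unfolding P_def by (auto simp: deg_add)
      from linsys_add_effective[OF divisors_diff[OF D divisors_add[OF R(1) S(1)]] S(1,2) this]
      show False using R(3) by (simp add: algebra_simps)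
    qed
    ultimately show ?thesis using dim by (auto intro!: bexI[of _ R])
  qed
  then show "\<exists>R\<in>divisors C. effective R \<and> deg R = dim_linsys C D + 1 \<and> linsys C (D - R) = {}"
    "\<And>R. R \<in> divisors C \<Longrightarrow> effective R \<Longrightarrow> linsys C (D - R) = {} \<Longrightarrow> dim_linsys C D < deg R" by auto
qed

lemma canonical_divisor: "canonical C \<in> divisors C"
proof -
  have "(\<Sum>v\<in>A. Poly_Mapping.single (Vertex v) (int (vertex_val C v) - 2)) \<in> divisors C"
    if "finite A" "A \<subseteq> V" for A
    using that by (induction A rule: finite_induct) (auto intro!: divisors_zero divisors_add divisors_single simp: points_iff)
  then show ?thesis unfolding canonical_def by simp
qed

text \<open>Here \<open>\<gamma>\<close> is just the common degree of the divisors \<open>N\<close>.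
  It becomes edges minus vertices, and is identified with g - 1 only at the very end.\<close>

lemma riemann_roch_half:
  assumes key: "\<And>D. D \<in> divisors C \<Longrightarrow> linsys C D = {} \<Longrightarrow>
      \<exists>N\<in>divisors C. deg N = \<gamma> \<and> linsys C (N - D) \<noteq> {} \<and> linsys C (canonical C - N) = {}"
    and D: "D \<in> divisors C"
  shows "dim_linsys C D - dim_linsys C (canonical C - D) \<ge> deg D - \<gamma>"
proof -
  let ?K = "canonical C"
  obtain R where R: "R \<in> divisors C" "effective R" "deg R = dim_linsys C D + 1" "linsys C (D - R) = {}"
    using dim_linsys_attained[OF D] by blast
  obtain N where N: "N \<in> divisors C" "deg N = \<gamma>" "linsys C (N - (D - R)) \<noteq> {}" "linsys C (?K - N) = {}"
    using key[OF divisors_diff[OF D R(1)] R(4)] by blast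
  have NDR: "N - (D - R) \<in> divisors C" using D R N by (intro divisors_diff)
  obtain f where f: "rational_fun C f" "effective (N - (D - R) + pdiv f)" using linsys_iff[OF NDR] N(3) by blast
  define F where "F = N - (D - R) + pdiv f"
  have F: "F \<in> divisors C" "effective F" using f divisors_add[OF NDR pdiv_divisor] unfolding F_def by auto
  have "deg F = \<gamma> - deg D + dim_linsys C D + 1" unfolding F_def by (simp add: deg_add deg_diff deg_pdiv f(1) N(2) R(3))
  moreover have "linsys C (?K - D - F) = {}"
  proof (rule ccontr)
    assume *: "linsys C (?K - D - F) \<noteq> {}"
    have KDF: "?K - D - F \<in> divisors C" using D F canonical_divisor by (intro divisors_diff)
    have "linsys C (?K - D - F + pdiv f) \<noteq> {}" using * linsys_pdiv[OF KDF f(1)] by blast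
    from linsys_add_effective[OF _ R(1,2) this] have "linsys C (?K - D - F + pdiv f + R) \<noteq> {}"
      using divisors_add[OF KDF pdiv_divisor[OF f(1)]] by blast
    moreover have "?K - D - F + pdiv f + R = ?K - N" unfolding F_def by (simp add: algebra_simps)
    ultimately show False using N(4) by simp
  qed
  then have "dim_linsys C (?K - D) < deg F"
    using dim_linsys_less[OF divisors_diff[OF canonical_divisor D] F] by blast
  ultimately show ?thesis by linarith
qed

text \<open>Since the canonical degree is \<open>2 * \<gamma>\<close>, the lower bounds obtained for
  \<open>D\<close> and for the complementary divisor are \<open>deg D - \<gamma>\<close> and its
  negative, so both are equalities.\<close>

lemma riemann_roch:
  assumes key: "\<And>D. D \<in> divisors C \<Longrightarrow> linsys C D = {} \<Longrightarrow>
      \<exists>N\<in>divisors C. deg N = \<gamma> \<and> linsys C (N - D) \<noteq> {} \<and> linsys C (canonical C - N) = {}"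
    and degK: "deg (canonical C) = 2 * \<gamma>" and D: "D \<in> divisors C"
  shows "dim_linsys C D - dim_linsys C (canonical C - D) = deg D - \<gamma>"
  using riemann_roch_half[OF key D] riemann_roch_half[OF key divisors_diff[OF canonical_divisor D]]
  by (simp add: deg_diff degK)

end

section \<open>Genus and canonical degree\<close>

lemma (in vector_space) span_Int_independent:
  assumes "independent (A \<union> A')" "A \<inter> A' = {}" "x \<in> span A" "x \<in> span A'"
  shows "x = 0"
proof -
  have "representation A x = representation A' x"
    using representation_extend[OF assms(1) assms(3)] representation_extend[OF assms(1) assms(4)] by simp
  then have "representation A x b = 0" for b
    using representation_ne_zero[of A x b] representation_ne_zero[of A' x b] assms(2) by auto
  then show ?thesis
    using sum_nonzero_representation_eq[OF independent_mono[OF assms(1)] assms(3)] by simp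
qed

text \<open>A basis of the kernel in \<open>U\<close> is extended to a basis of \<open>U\<close>,
  and the added vectors map to a basis of the image. Finiteness is asked of \<open>U\<close> and not
  of the ambient space, because the chains over a whole type of arcs may be
  infinite-dimensional.\<close>

lemma (in Vector_Spaces.linear) rank_nullity:
  assumes U: "vs1.subspace U" and W: "finite W" "U \<subseteq> vs1.span W"
  shows "vs1.dim U = vs1.dim {x \<in> U. f x = 0} + vs2.dim (f ` U)"
proof -
  obtain A where A: "A \<subseteq> {x \<in> U. f x = 0}" "vs1.independent A" "{x \<in> U. f x = 0} \<subseteq> vs1.span A"
    using vs1.maximal_independent_subset .
  then have "A \<subseteq> U" by auto
  then obtain B where B: "A \<subseteq> B" "B \<subseteq> U" "vs1.independent B" "U \<subseteq> vs1.span B"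
    using vs1.maximal_independent_subset_extend[OF _ A(2)] by blast
  have fin: "finite B" using vs1.independent_span_bound[OF W(1) B(3)] B(2) W(2) by auto
  have spU: "vs1.span X \<subseteq> U" if "X \<subseteq> U" for X using vs1.span_minimal[OF that U] .
  have inj: "inj_on f (vs1.span (B - A))"
  proof (rule inj_onI)
    fix x y assume xy: "x \<in> vs1.span (B - A)" "y \<in> vs1.span (B - A)" "f x = f y"
    then have d: "x - y \<in> vs1.span (B - A)" using vs1.span_diff by blast
    moreover have "f (x - y) = 0" using xy(3) by (simp add: diff)
    ultimately have "x - y \<in> vs1.span A" using spU[of "B - A"] B(2) A(3) by blast
    moreover have "vs1.independent (A \<union> (B - A))" using B(1,3) by (simp add: Un_absorb1)
    ultimately have "x - y = 0" using vs1.span_Int_independent[of A "B - A" "x - y"] d by blast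
    then show "x = y" by (simp only: right_minus_eq)
  qed
  have ind: "vs2.independent (f ` (B - A))"
    using inj vs1.independent_mono[OF B(3)] by (intro independent_injective_image) auto
  have "f ` U \<subseteq> vs2.span (f ` (B - A))"
  proof -
    have "f ` U \<subseteq> f ` vs1.span B" using B(4) by blast
    also have "\<dots> = vs2.span (f ` B)" by (simp add: span_image)
    also have "\<dots> \<subseteq> vs2.span (f ` (B - A))"
    proof (rule vs2.span_minimal[OF _ vs2.subspace_span])
      show "f ` B \<subseteq> vs2.span (f ` (B - A))"
      proof
        fix y assume "y \<in> f ` B"
        then obtain b where "b \<in> B" "y = f b" by blast
        then show "y \<in> vs2.span (f ` (B - A))"
        proof (cases "b \<in> A")
          case True
          then have "f b = 0" using A(1) by blast
          then show ?thesis using \<open>y = f b\<close> vs2.span_zero by simp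
        qed (use \<open>y = f b\<close> \<open>b \<in> B\<close> in \<open>auto intro: vs2.span_base\<close>)
      qed
    qed
    finally show ?thesis .
  qed
  then have "card (f ` (B - A)) = vs2.dim (f ` U)"
    using ind B(2) by (intro vs2.basis_card_eq_dim) auto
  moreover have "card (f ` (B - A)) = card (B - A)"
    using inj by (intro card_image inj_on_subset[OF inj]) (auto intro: vs1.span_base)
  moreover have "card A = vs1.dim {x \<in> U. f x = 0}" using A by (intro vs1.basis_card_eq_dim)
  moreover have "card B = vs1.dim U" using B by (intro vs1.basis_card_eq_dim)
  moreover have "card B = card A + card (B - A)" using fin B(1) by (metis card_Diff_subset card_mono finite_subset le_add_diff_inverse)
  ultimately show ?thesis by simp
qed

context tropical
begin

lemma connected_induct:
  assumes "v0 \<in> V" "P v0" and "\<And>e. e \<in> E \<Longrightarrow> P (src e) \<longleftrightarrow> P (tgt e)" and "v \<in> V"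
  shows "P v"
proof -
  have "(v0, v) \<in> rtrancl_on V ((arcs_ends (graph C))\<^sup>s)"
    using tropical_curve assms(1,4) unfolding tropical_curve_def connected_conv by auto
  then show ?thesis
  proof (induction rule: rtrancl_on_induct)
    case (step u w)
    then obtain e where "e \<in> E" "(u = src e \<and> w = tgt e) \<or> (w = src e \<and> u = tgt e)"
      unfolding symcl_def arcs_ends_def arc_to_ends_def by auto
    then show ?case using step assms(3) by metis
  qed (use assms(2) in auto)
qed

text \<open>Every arc is counted once at its tail and once at its head, a loop twice at the same
  vertex.\<close>

lemma deg_canonical: "deg (canonical C) = 2 * (int (card E) - int (card V))"
proof -
  have "deg (\<Sum>v\<in>A. Poly_Mapping.single (Vertex v :: ('v, 'e) point) (int (vertex_val C v) - 2)) = (\<Sum>v\<in>A. int (vertex_val C v) - 2)"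
    if "finite A" for A
    using that by (induction A rule: finite_induct) (auto simp: deg_add)
  then have "deg (canonical C) = (\<Sum>v\<in>V. int (vertex_val C v) - 2)"
    unfolding canonical_def by auto
  also have "\<dots> = int (\<Sum>v\<in>V. in_degree (graph C) v) + int (\<Sum>v\<in>V. out_degree (graph C) v) - 2 * int (card V)"
    by (simp add: vertex_val_def sum_subtractf sum.distrib)
  also have "(\<Sum>v\<in>V. in_degree (graph C) v) = card E"
    using sum.group[of E V tgt "\<lambda>_. 1::nat"] by (simp add: in_degree_def in_arcs_def image_subset_iff)
  also have "(\<Sum>v\<in>V. out_degree (graph C) v) = card E"
    using sum.group[of E V src "\<lambda>_. 1::nat"] by (simp add: out_degree_def out_arcs_def image_subset_iff)
  finally show ?thesis by simp
qed

lemma boundary_eq_sum: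
  assumes "finite S" "Poly_Mapping.keys c \<subseteq> S"
  shows "boundary C c = (\<Sum>e\<in>S. Poly_Mapping.single (tgt e) (Poly_Mapping.lookup c e) -
     Poly_Mapping.single (src e) (Poly_Mapping.lookup c e))"
  unfolding boundary_def by (rule sum.mono_neutral_left) (use assms in \<open>auto simp: in_keys_iff\<close>)

lemma chain_scale_single: "chain_scale r (Poly_Mapping.single a x) = Poly_Mapping.single a (r * x)"
  by (rule poly_mapping_eqI) (auto simp: lookup_single when_def)

lemma linear_boundary: "Vector_Spaces.linear chain_scale chain_scale (boundary C)"
  unfolding Vector_Spaces.linear_iff
proof (intro conjI allI vector_space_chain_scale)
  interpret vv: vector_space "chain_scale :: real \<Rightarrow> ('v \<Rightarrow>\<^sub>0 real) \<Rightarrow> _" by (rule vector_space_chain_scale)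
  fix x y :: "'e \<Rightarrow>\<^sub>0 real" and r :: real
  define S where "S = Poly_Mapping.keys x \<union> Poly_Mapping.keys y"
  have S: "finite S" "Poly_Mapping.keys x \<subseteq> S" "Poly_Mapping.keys y \<subseteq> S" "Poly_Mapping.keys (x + y) \<subseteq> S"
    "Poly_Mapping.keys (chain_scale r x) \<subseteq> S"
    unfolding S_def by (auto simp: in_keys_iff lookup_add)
  show "boundary C (x + y) = boundary C x + boundary C y"
    using S by (simp add: boundary_eq_sum[OF S(1)] lookup_add single_add sum.distrib sum_subtractf)
  show "boundary C (chain_scale r x) = chain_scale r (boundary C x)"
    using S by (simp add: boundary_eq_sum[OF S(1)] vv.scale_sum_right vv.scale_right_diff_distrib chain_scale_single)
qed

text \<open>Rank and nullity of the boundary map on chains: the cycles are its kernel, and by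
  connectedness its image is spanned by the differences of vertices with a fixed \<open>v0\<close>,
  so it has one dimension less than the number of vertices.\<close>

lemma genus_eq: "int (genus C) = int (card E) - int (card V) + 1"
proof -
  interpret lin: Vector_Spaces.linear "chain_scale :: real \<Rightarrow> ('e \<Rightarrow>\<^sub>0 real) \<Rightarrow> _" "chain_scale :: real \<Rightarrow> ('v \<Rightarrow>\<^sub>0 real) \<Rightarrow> _" "boundary C"
    by (rule linear_boundary)
  define U where "U = {c :: 'e \<Rightarrow>\<^sub>0 real. Poly_Mapping.keys c \<subseteq> E}"
  define W where "W = (\<lambda>e. Poly_Mapping.single e (1::real)) ` E"
  have U: "lin.vs1.subspace U"
    unfolding lin.vs1.subspace_def U_def by (auto simp: in_keys_iff lookup_add subset_iff) (metis add.right_neutral)+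
  have W_sum: "c = (\<Sum>e\<in>E. chain_scale (Poly_Mapping.lookup c e) (Poly_Mapping.single e 1))" if "c \<in> U" for c
  proof (rule poly_mapping_eqI)
    fix a
    have "(\<Sum>e\<in>E. Poly_Mapping.lookup c e * (1 when e = a)) = (\<Sum>e\<in>E. if e = a then Poly_Mapping.lookup c e else 0)"
      by (rule sum.cong) (auto simp: when_def)
    also have "\<dots> = Poly_Mapping.lookup c a" using that by (auto simp: U_def in_keys_iff subset_iff)
    finally show "Poly_Mapping.lookup c a = Poly_Mapping.lookup (\<Sum>e\<in>E. chain_scale (Poly_Mapping.lookup c e) (Poly_Mapping.single e 1)) a"
      by (simp add: lookup_sum lookup_single)
  qed
  have W: "finite W" "W \<subseteq> U" "U \<subseteq> lin.vs1.span W"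
  proof -
    show "U \<subseteq> lin.vs1.span W"
    proof
      fix c assume "c \<in> U"
      then show "c \<in> lin.vs1.span W"
        by (subst W_sum, assumption) (intro lin.vs1.span_sum lin.vs1.span_scale lin.vs1.span_base; simp add: W_def)
    qed
  qed (auto simp: W_def U_def)
  have inj: "inj_on (\<lambda>e. Poly_Mapping.single e (1::real)) E"
    by (rule inj_onI) (metis lookup_single_eq lookup_single_not_eq zero_neq_one)
  have "lin.vs1.independent W"
  proof (rule lin.vs1.independent_if_scalars_zero[OF W(1)])
    fix f x assume *: "(\<Sum>x\<in>W. chain_scale (f x) x) = 0" "x \<in> W"
    then obtain a where a: "a \<in> E" "x = Poly_Mapping.single a 1" by (auto simp: W_def)
    have "(\<Sum>e\<in>E. chain_scale (f (Poly_Mapping.single e 1)) (Poly_Mapping.single e 1)) = 0"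
      using *(1) unfolding W_def by (simp add: sum.reindex[OF inj])
    then have "0 = Poly_Mapping.lookup (\<Sum>e\<in>E. chain_scale (f (Poly_Mapping.single e 1)) (Poly_Mapping.single e 1)) a" by simp
    also have "\<dots> = (\<Sum>e\<in>E. if e = a then f (Poly_Mapping.single e 1) else 0)"
      unfolding lookup_sum by (rule sum.cong) (auto simp: lookup_single when_def)
    finally show "f x = 0" using a by auto
  qed
  then have dimU: "lin.vs1.dim U = card E"
    using lin.vs1.basis_card_eq_dim[OF W(2,3)] card_image[OF inj] by (simp add: W_def)
  obtain v0 where v0: "v0 \<in> V" using V_nonempty by blast
  define b where "b = (\<lambda>v. Poly_Mapping.single v (1::real) - Poly_Mapping.single v0 1)"
  define Bs where "Bs = b ` (V - {v0})"
  define I where "I = boundary C ` U"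
  have I: "lin.vs2.subspace I" unfolding I_def by (rule lin.subspace_image[OF U])
  have edge: "Poly_Mapping.single (tgt e) 1 - Poly_Mapping.single (src e) 1 \<in> I" if "e \<in> E" for e
  proof -
    have "boundary C (Poly_Mapping.single e 1) = Poly_Mapping.single (tgt e) 1 - Poly_Mapping.single (src e) 1"
      by (simp add: boundary_def)
    moreover have "Poly_Mapping.single e 1 \<in> U" using that by (simp add: U_def)
    ultimately show ?thesis unfolding I_def by (metis imageI)
  qed
  \<comment> \<open>Connectedness: crossing an arc changes \<open>b\<close> by the boundary of that
    arc, so membership in the image spreads from \<open>v0\<close> to every vertex.\<close>
  have bI: "b v \<in> I" if "v \<in> V" for v
    using v0 _ _ that
  proof (rule connected_induct)
    show "b v0 \<in> I" using lin.vs2.subspace_0[OF I] by (simp add: b_def)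
    fix e assume e: "e \<in> E"
    have eq: "b (tgt e) = b (src e) + (Poly_Mapping.single (tgt e) 1 - Poly_Mapping.single (src e) 1)" by (simp add: b_def)
    then have eq': "b (src e) = b (tgt e) - (Poly_Mapping.single (tgt e) 1 - Poly_Mapping.single (src e) 1)" by simp
    show "b (src e) \<in> I \<longleftrightarrow> b (tgt e) \<in> I"
      using lin.vs2.subspace_add[OF I _ edge[OF e], of "b (src e)"] lin.vs2.subspace_diff[OF I _ edge[OF e], of "b (tgt e)"] eq eq' by metis
  qed
  have spb: "b v \<in> lin.vs2.span Bs" if "v \<in> V" for v
  proof (cases "v = v0")
    case True
    then show ?thesis by (simp add: b_def lin.vs2.span_zero)
  qed (use that in \<open>auto simp: Bs_def intro!: lin.vs2.span_base\<close>)
  have "I \<subseteq> lin.vs2.span Bs"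
  proof
    fix x assume "x \<in> I"
    then obtain c where c: "c \<in> U" "x = boundary C c" unfolding I_def by blast
    have "x = (\<Sum>e\<in>E. chain_scale (Poly_Mapping.lookup c e) (b (tgt e) - b (src e)))"
      unfolding c(2) using c(1)
      by (subst boundary_eq_sum[of E]) (auto simp: U_def b_def lin.vs2.scale_right_diff_distrib chain_scale_single)
    also have "\<dots> \<in> lin.vs2.span Bs"
      by (auto intro!: lin.vs2.span_sum lin.vs2.span_scale lin.vs2.span_diff spb)
    finally show "x \<in> lin.vs2.span Bs" .
  qed
  \<comment> \<open>Away from \<open>v0\<close> the coordinates of \<open>b v\<close> are those of a
    unit vector, which gives both injectivity and independence.\<close>
  have lb: "Poly_Mapping.lookup (b v) a = (if v = a then 1 else 0)" if "a \<noteq> v0" for v a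
    using that by (auto simp: b_def lookup_minus lookup_single when_def)
  have injb: "inj_on b (V - {v0})"
  proof (rule inj_onI)
    fix x y assume "x \<in> V - {v0}" "y \<in> V - {v0}" "b x = b y"
    then show "x = y" using lb[of x y] lb[of x x] by (auto split: if_splits)
  qed
  have "lin.vs2.independent Bs"
  proof (rule lin.vs2.independent_if_scalars_zero)
    fix f x assume *: "(\<Sum>x\<in>Bs. chain_scale (f x) x) = 0" "x \<in> Bs"
    then obtain a where a: "a \<in> V - {v0}" "x = b a" by (auto simp: Bs_def)
    have "(\<Sum>v\<in>V - {v0}. chain_scale (f (b v)) (b v)) = 0"
      using *(1) unfolding Bs_def by (simp add: sum.reindex[OF injb])
    then have "0 = Poly_Mapping.lookup (\<Sum>v\<in>V - {v0}. chain_scale (f (b v)) (b v)) a" by simp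
    also have "\<dots> = (\<Sum>v\<in>V - {v0}. if v = a then f (b v) else 0)"
      unfolding lookup_sum by (rule sum.cong) (use a in \<open>auto simp: lb\<close>)
    finally show "f x = 0" using a by auto
  qed (simp add: Bs_def)
  then have "lin.vs2.dim I = card Bs"
    using \<open>I \<subseteq> lin.vs2.span Bs\<close> bI by (intro lin.vs2.basis_card_eq_dim[symmetric]) (auto simp: Bs_def)
  moreover have "card Bs = card V - 1" unfolding Bs_def card_image[OF injb] using v0 by simp
  moreover have "card V > 0" using v0 by (auto simp: card_gt_0_iff)
  moreover have "genus C = lin.vs1.dim {x \<in> U. boundary C x = 0}"
    unfolding genus_def cycles_def U_def by simp
  ultimately show ?thesis
    using lin.rank_nullity[OF U W(1,3)] dimU unfolding I_def by linarith
qed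

section \<open>Functions on the core\<close>

definition core :: "('v, 'e) point set" where
  "core = Vertex ` V0 \<union> {Inner e t | e t. e \<in> E0 \<and> 0 < t \<and> t < L e}"

text \<open>The triple \<open>(e, t, s)\<close> is the direction along the edge \<open>e\<close> at coordinate \<open>t\<close> in which the
  coordinate increases (\<open>s = 1\<close>) or decreases (\<open>s = -1\<close>).\<close>

definition dirs :: "('v, 'e) point \<Rightarrow> ('e \<times> real \<times> real) set" where
  "dirs p = {(e, t, s). e \<in> E0 \<and> (s = 1 \<and> 0 \<le> t \<and> t < L e \<or> s = -1 \<and> 0 < t \<and> t \<le> L e) \<and> chart C e t = p}"

text \<open>The order of \<open>f\<close> within the core, with the slopes along leaves left out.
  Vertices and inner points are treated by the same sum over directions.\<close>

definition cord :: "(('v, 'e) point \<Rightarrow> real) \<Rightarrow> ('v, 'e) point \<Rightarrow> int" where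
  "cord f p = (\<Sum>(e, t, s)\<in>dirs p. gslope (f \<circ> chart C e) t s)"

text \<open>Rational functions that are constant along every leaf, stated by germs so that suprema
  can be checked direction by direction. The value at the endpoint of a leaf is prescribed too, so
  that bounds can be carried across leaves when vertices are reached through the connected
  graph.\<close>

definition core_fun :: "(('v, 'e) point \<Rightarrow> real) \<Rightarrow> bool" where
  "core_fun f \<longleftrightarrow> (\<forall>e\<in>E0. germs_on (L e) (f \<circ> chart C e)) \<and>
     (\<forall>e\<in>E - E0. f (Vertex (tgt e)) = f (Vertex (src e)) \<and> (\<forall>t. f (Inner e t) = f (Vertex (src e))))"

lemma chart_eq_iff:
  assumes "e \<in> E0" "0 \<le> t" "t \<le> L e"
  shows "chart C e t = Vertex v \<longleftrightarrow> (t = 0 \<and> src e = v \<or> t = L e \<and> tgt e = v)"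
    "chart C e t = Inner e' t' \<longleftrightarrow> e' = e \<and> t' = t \<and> 0 < t \<and> t < L e"
  using assms E0_chart[OF assms(1)] E0_len(2)[OF assms(1)]
  by (cases "t = 0"; cases "t = L e"; auto)+

lemma dirs_Vertex: "dirs (Vertex v) = (\<lambda>e. (e, 0, 1)) ` {e \<in> E0. src e = v} \<union> (\<lambda>e. (e, L e, -1)) ` {e \<in> E0. tgt e = v}"
  unfolding dirs_def using E0_len(2) by (fastforce simp: chart_eq_iff)

lemma dirs_Inner: "e \<in> E0 \<Longrightarrow> 0 < t \<Longrightarrow> t < L e \<Longrightarrow> dirs (Inner e t) = {(e, t, 1), (e, t, -1)}"
  unfolding dirs_def by (auto simp: chart_eq_iff)

lemma finite_dirs [simp]: "finite (dirs p)"
proof (cases p)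
  case (Inner e t)
  have "dirs (Inner e t) \<subseteq> {(e, t, 1), (e, t, -1)}"
    unfolding dirs_def by (auto simp: chart_eq_iff)
  then show ?thesis unfolding Inner using finite_subset by blast
qed (simp add: dirs_Vertex)

lemma dirs_valid:
  assumes "(e, t, s) \<in> dirs p"
  shows "e \<in> E0" "s = 1 \<or> s = -1" "0 \<le> t" "t \<le> L e" "chart C e t = p"
    "\<exists>d>0. \<forall>x. 0 < x \<and> x < d \<longrightarrow> 0 < t + s * x \<and> t + s * x < L e"
proof -
  show "e \<in> E0" "s = 1 \<or> s = -1" "0 \<le> t" "t \<le> L e" "chart C e t = p"
    using assms unfolding dirs_def by auto
  show "\<exists>d>0. \<forall>x. 0 < x \<and> x < d \<longrightarrow> 0 < t + s * x \<and> t + s * x < L e"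
    using assms unfolding dirs_def by (auto intro: exI[of _ "L e - t"] exI[of _ t])
qed

lemma core_points: "core \<subseteq> points C"
  unfolding core_def using E0_lo_hi by (auto simp: points_iff V0_V E0_E open_edge_def)

lemma chart_core: "e \<in> E0 \<Longrightarrow> 0 \<le> t \<Longrightarrow> t \<le> L e \<Longrightarrow> chart C e t \<in> core"
  using E0_ends E0_chart by (cases "t = 0"; cases "t = L e") (auto simp: core_def)

lemma dirs_core: "(e, t, s) \<in> dirs p \<Longrightarrow> p \<in> core"
  using chart_core[of e t] dirs_valid[of e t s p] by simp

lemma germs_on_dirs: "germs_on (L e) h \<Longrightarrow> (e, t, s) \<in> dirs p \<Longrightarrow> \<exists>m. germ h t s m"
  unfolding germs_on_def dirs_def by auto

lemma germs_onI_dirs: "e \<in> E0 \<Longrightarrow> (\<And>t s p. (e, t, s) \<in> dirs p \<Longrightarrow> \<exists>m. germ h t s m) \<Longrightarrow> germs_on (L e) h"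
  unfolding germs_on_def dirs_def by auto

lemma core_fun_germ: "core_fun f \<Longrightarrow> (e, t, s) \<in> dirs p \<Longrightarrow> germ (f \<circ> chart C e) t s (gslope (f \<circ> chart C e) t s)"
  using germs_on_dirs germ_gslope dirs_valid(1) unfolding core_fun_def by blast

lemma rational_germs_on:
  assumes "rational_fun C f" "e \<in> E0"
  shows "germs_on (L e) (f \<circ> chart C e)"
proof -
  have *: "continuous_on {0..L e} (f \<circ> chart C e)" "pw_linear_on {0..L e} (f \<circ> chart C e)"
    using assms(1) E0_E[OF assms(2)] E0_edge_dom[OF assms(2)] unfolding rational_fun_def by metis+
  have "\<exists>m. germ (f \<circ> chart C e) t 1 m" if "0 \<le> t" "t < L e" for t
    by (rule pw_linear_germ[OF *(2,1), of _ _ "L e - t"]) (use that in auto)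
  moreover have "\<exists>m. germ (f \<circ> chart C e) t (-1) m" if "0 < t" "t \<le> L e" for t
    by (rule pw_linear_germ[OF *(2,1), of _ _ t]) (use that in auto)
  ultimately show ?thesis unfolding germs_on_def by blast
qed

lemma rational_dirs: "rational_fun C f \<Longrightarrow> (e, t, s) \<in> dirs p \<Longrightarrow> germ (f \<circ> chart C e) t s (gslope (f \<circ> chart C e) t s)"
  using germs_on_dirs germ_gslope dirs_valid(1) rational_germs_on by metis

text \<open>Only the last two sums see the leaves. They vanish for core functions and are estimated
  separately for arbitrary rational functions.\<close>

lemma ord_core_Vertex:
  assumes f: "rational_fun C f"
  shows "ord_at C f (Vertex v) = cord f (Vertex v) +
    (\<Sum>e\<in>out_arcs (graph C) v - E0. slope (at_tail C e) (f \<circ> chart C e)) +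
    (\<Sum>e\<in>in_arcs (graph C) v - E0. - slope (at_head C e) (f \<circ> chart C e))"
proof -
  let ?h = "\<lambda>e. f \<circ> chart C e"
  have t: "slope (at_tail C e) (?h e) = gslope (?h e) 0 1" if "e \<in> E0" for e
  proof -
    have "(e, 0, 1) \<in> dirs (Vertex (src e))" using that by (auto simp: dirs_Vertex)
    from slope_at_right[OF rational_dirs[OF f this]] show ?thesis using that by (simp add: E0_filters)
  qed
  have h: "- slope (at_head C e) (?h e) = gslope (?h e) (L e) (-1)" if "e \<in> E0" for e
  proof -
    have "(e, L e, -1) \<in> dirs (Vertex (tgt e))" using that by (auto simp: dirs_Vertex)
    from slope_at_left[OF rational_dirs[OF f this]] show ?thesis using that by (simp add: E0_filters)
  qed
  have "cord f (Vertex v) = (\<Sum>e\<in>{e \<in> E0. src e = v}. gslope (?h e) 0 1) + (\<Sum>e\<in>{e \<in> E0. tgt e = v}. gslope (?h e) (L e) (-1))"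
    unfolding cord_def dirs_Vertex by (subst sum.union_disjoint) (auto simp: sum.reindex inj_on_def)
  also have "(\<Sum>e\<in>{e \<in> E0. src e = v}. gslope (?h e) 0 1) = (\<Sum>e\<in>out_arcs (graph C) v \<inter> E0. slope (at_tail C e) (?h e))"
    by (rule sum.cong) (auto simp: t E0_E)
  also have "(\<Sum>e\<in>{e \<in> E0. tgt e = v}. gslope (?h e) (L e) (-1)) = (\<Sum>e\<in>in_arcs (graph C) v \<inter> E0. - slope (at_head C e) (?h e))"
    by (rule sum.cong) (auto simp: h E0_E)
  finally have c: "cord f (Vertex v) = (\<Sum>e\<in>out_arcs (graph C) v \<inter> E0. slope (at_tail C e) (?h e)) +
    (\<Sum>e\<in>in_arcs (graph C) v \<inter> E0. - slope (at_head C e) (?h e))" .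
  have "(\<Sum>e\<in>out_arcs (graph C) v. slope (at_tail C e) (?h e)) =
      (\<Sum>e\<in>out_arcs (graph C) v \<inter> E0. slope (at_tail C e) (?h e)) + (\<Sum>e\<in>out_arcs (graph C) v - E0. slope (at_tail C e) (?h e))"
    using sum.Int_Diff[of "out_arcs (graph C) v" _ E0] G.finite_out_arcs by blast
  moreover have "(\<Sum>e\<in>in_arcs (graph C) v. - slope (at_head C e) (?h e)) =
      (\<Sum>e\<in>in_arcs (graph C) v \<inter> E0. - slope (at_head C e) (?h e)) + (\<Sum>e\<in>in_arcs (graph C) v - E0. - slope (at_head C e) (?h e))"
    using sum.Int_Diff[of "in_arcs (graph C) v" _ E0] G.finite_in_arcs by blast
  ultimately show ?thesis unfolding c ord_at.simps by linarith
qed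

lemma open_edge_E0: "e \<in> E0 \<Longrightarrow> t \<in> open_edge e \<longleftrightarrow> 0 < t \<and> t < L e"
  unfolding open_edge_def using E0_lo_hi by auto

lemma ord_core_Inner:
  assumes f: "rational_fun C f" and e: "e \<in> E0" "0 < t" "t < L e"
  shows "ord_at C f (Inner e t) = cord f (Inner e t)"
  unfolding cord_def dirs_Inner[OF e]
  by (subst ord_inner[OF f E0_E]) (use e in \<open>auto simp: open_edge_E0\<close>)

lemma leaf_const_slope:
  assumes "e \<in> E" "e \<notin> E0" "core_fun f"
  shows "f \<circ> chart C e = (\<lambda>t. f (Vertex (src e)))"
    "slope (at_tail C e) (f \<circ> chart C e) = 0" "slope (at_head C e) (f \<circ> chart C e) = 0"
proof -
  show *: "f \<circ> chart C e = (\<lambda>t. f (Vertex (src e)))"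
    using assms by (auto simp: core_fun_def chart_def fun_eq_iff)
  show "slope (at_tail C e) (f \<circ> chart C e) = 0"
    unfolding * using slope_eqI[of "at_tail C e" "\<lambda>t. f (Vertex (src e))" 0 "f (Vertex (src e))"] by simp
  show "slope (at_head C e) (f \<circ> chart C e) = 0"
    unfolding * using slope_eqI[of "at_head C e" "\<lambda>t. f (Vertex (src e))" 0 "f (Vertex (src e))"] by simp
qed

lemma core_fun_rational:
  assumes "core_fun f" shows "rational_fun C f"
  unfolding rational_fun_def
proof
  fix e assume e: "e \<in> E"
  show "continuous_on (edge_dom C e) (f \<circ> chart C e) \<and> pw_linear_on (edge_dom C e) (f \<circ> chart C e)"
  proof (cases "e \<in> E0")
    case True
    then show ?thesis using germs_on_imp[of "L e" "f \<circ> chart C e"] assms E0_len(2)[OF True]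
      unfolding core_fun_def E0_edge_dom[OF True] by auto
  next
    case False
    then show ?thesis unfolding leaf_const_slope(1)[OF e False assms]
      by (auto intro: pw_linear_on_affine[of _ _ 0])
  qed
qed

lemma not_core: "p \<in> points C \<Longrightarrow> p \<notin> core \<Longrightarrow>
    (\<exists>v. p = Vertex v \<and> v \<in> V \<and> v \<notin> V0) \<or> (\<exists>e t. p = Inner e t \<and> e \<in> E \<and> e \<notin> E0 \<and> t \<in> open_edge e)"
  by (cases p) (auto simp: core_def points_iff open_edge_E0)

lemma dirs_not_V0: "v \<notin> V0 \<Longrightarrow> dirs (Vertex v) = {}"
  unfolding dirs_Vertex using E0_ends by auto

lemma ord_core_fun:
  assumes "core_fun f" "p \<in> points C"
  shows "ord_at C f p = (if p \<in> core then cord f p else 0)"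
proof (cases p)
  case (Vertex v)
  have *: "(\<Sum>e\<in>out_arcs (graph C) v - E0. slope (at_tail C e) (f \<circ> chart C e)) = 0"
    "(\<Sum>e\<in>in_arcs (graph C) v - E0. - slope (at_head C e) (f \<circ> chart C e)) = 0"
    by (rule sum.neutral, use leaf_const_slope(2,3)[OF _ _ assms(1)] in auto)+
  have "cord f (Vertex v) = 0" if "v \<notin> V0" using dirs_not_V0[OF that] by (simp add: cord_def)
  then show ?thesis unfolding Vertex ord_core_Vertex[OF core_fun_rational[OF assms(1)]] * by (auto simp: core_def)
next
  case (Inner e t)
  show ?thesis
  proof (cases "e \<in> E0")
    case True
    then show ?thesis using assms(2) ord_core_Inner[OF core_fun_rational[OF assms(1)] True] unfolding Inner
      by (auto simp: points_iff open_edge_E0 core_def)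
  next
    case False
    then have e: "e \<in> E" using assms(2) Inner by (auto simp: points_iff)
    have "slope (at_right t) (\<lambda>t. f (Vertex (src e))) = 0" "slope (at_left t) (\<lambda>t. f (Vertex (src e))) = 0"
      using slope_at_right[OF germ_const] slope_at_left[OF germ_const] by fastforce+
    then show ?thesis unfolding Inner ord_at.simps leaf_const_slope(1)[OF e False assms(1)]
      using False by (auto simp: core_def)
  qed
qed

lemma core_fun_const: "core_fun (\<lambda>p. c)"
  unfolding core_fun_def germs_on_def comp_def using germ_const by blast

lemma core_fun_add:
  assumes "core_fun f" "core_fun h" shows "core_fun (\<lambda>p. f p + h p)"
proof -
  have "germs_on (L e) ((\<lambda>p. f p + h p) \<circ> chart C e)" if "e \<in> E0" for e
  proof (rule germs_onI_dirs[OF that])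
    fix t s p assume "(e, t, s) \<in> dirs p"
    from germ_add[OF core_fun_germ[OF assms(1) this] core_fun_germ[OF assms(2) this]]
    show "\<exists>m. germ ((\<lambda>p. f p + h p) \<circ> chart C e) t s m" by (auto simp: comp_def)
  qed
  then show ?thesis using assms unfolding core_fun_def by auto
qed

lemma core_fun_max:
  assumes "core_fun f" "core_fun h" shows "core_fun (\<lambda>p. max (f p) (h p))"
proof -
  have "germs_on (L e) ((\<lambda>p. max (f p) (h p)) \<circ> chart C e)" if "e \<in> E0" for e
  proof (rule germs_onI_dirs[OF that])
    fix t s p assume d: "(e, t, s) \<in> dirs p"
    have "\<exists>m. germ (f \<circ> chart C e) t s m" "\<exists>m. germ (h \<circ> chart C e) t s m"
      using core_fun_germ[OF assms(1) d] core_fun_germ[OF assms(2) d] by blast+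
    from germ_max[OF this]
    show "\<exists>m. germ ((\<lambda>p. max (f p) (h p)) \<circ> chart C e) t s m" by (auto simp: comp_def)
  qed
  then show ?thesis using assms unfolding core_fun_def by auto
qed

lemma lookup_pdiv_core:
  "core_fun f \<Longrightarrow> Poly_Mapping.lookup (pdiv f) p = (if p \<in> core then cord f p else 0)"
  using core_points by (auto simp: lookup_pdiv core_fun_rational ord_core_fun)

end

section \<open>Suprema of admissible functions\<close>

lemma germ_reparam: "germ (\<lambda>x. h (t + s * x)) x r m \<longleftrightarrow> germ h (t + s * x) (s * r) m"
  unfolding germ_def by (simp add: algebra_simps)

text \<open>Tilting \<open>h\<close> by slope \<open>M + 1\<close> instead of \<open>M\<close> makes
  every left slope strictly positive, so the tilted function cannot have its maximum anywhere but at
  \<open>a\<close>.\<close>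

lemma lipschitz_left:
  assumes cont: "continuous_on {a..b} h" and ab: "a \<le> b"
    and sl: "\<And>t. a < t \<Longrightarrow> t \<le> b \<Longrightarrow> \<exists>l. germ h t (-1) l \<and> - M \<le> l"
  shows "h b \<le> h a + of_int (M + 1) * (b - a)"
proof -
  define k where "k = (\<lambda>x. h x + (of_int (- (M + 1)) * x + 0))"
  have "continuous_on {a..b} k" unfolding k_def by (intro continuous_intros cont)
  then obtain y where y: "a \<le> y" "y \<le> b" "\<And>z. a \<le> z \<Longrightarrow> z \<le> b \<Longrightarrow> k z \<le> k y"
    using continuous_attains_sup[of "{a..b}" k] ab by auto
  have "y = a"
  proof (rule ccontr)
    assume "y \<noteq> a"
    then have "a < y" using y(1) by simp
    from sl[OF this y(2)] obtain l where l: "germ h y (-1) l" "- M \<le> l" by blast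
    have g: "germ k y (-1) (l + - (- (M + 1)))"
      unfolding k_def by (rule germ_add[OF l(1) germ_affine(2)])
    have "l + - (- (M + 1)) \<le> 0"
    proof (rule germ_nonpos[OF g])
      show "\<forall>\<^sub>F x in at_right 0. k (y + - 1 * x) \<le> k y"
        unfolding eventually_at_right_field using \<open>a < y\<close> y(2) by (intro exI[of _ "y - a"]) (auto intro!: y(3))
    qed
    then show False using l(2) by simp
  qed
  then have "k b \<le> k a" using y(3)[of b] ab by simp
  then show ?thesis by (simp add: k_def algebra_simps)
qed

lemma lipschitz_right:
  assumes cont: "continuous_on {a..b} h" and ab: "a \<le> b"
    and sl: "\<And>t. a \<le> t \<Longrightarrow> t < b \<Longrightarrow> \<exists>l. germ h t 1 l \<and> - M \<le> l"
  shows "h a \<le> h b + of_int (M + 1) * (b - a)"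
proof -
  have "(\<lambda>x. h (- x)) (- a) \<le> (\<lambda>x. h (- x)) (- b) + of_int (M + 1) * (- a - (- b))"
  proof (rule lipschitz_left)
    show "continuous_on {- b..- a} (\<lambda>x. h (- x))"
      by (rule continuous_on_compose2[OF cont]) (auto intro!: continuous_intros)
    show "\<exists>l. germ (\<lambda>x. h (- x)) t (-1) l \<and> - M \<le> l" if "- b < t" "t \<le> - a" for t
      using sl[of "- t"] that germ_flip[of "\<lambda>x. h (- x)" t] by auto
  qed (use ab in auto)
  then show ?thesis by simp
qed

lemma eventually_not_in_finite:
  fixes t :: real
  assumes "finite U" "s \<noteq> 0"
  shows "\<forall>\<^sub>F x in at_right 0. t + s * x \<notin> U"
proof -
  have "finite ((\<lambda>x. t + s * x) -` U)" using assms by (intro finite_vimageI) (auto simp: inj_on_def)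
  from islimpt_finite[OF this, of 0] have "\<forall>\<^sub>F x in at 0. x \<notin> (\<lambda>x. t + s * x) -` U"
    unfolding islimpt_iff_eventually not_not .
  then have "\<forall>\<^sub>F x in at_right 0. x \<notin> (\<lambda>x. t + s * x) -` U" unfolding eventually_at_split by blast
  then show ?thesis by eventually_elim simp
qed

section \<open>Admissible functions: bounded slopes, bounded values, convexity on common
  intervals\<close>

context tropical
begin

text \<open>The order on \<open>Q\<close> is left free: a nonnegative function that vanishes at a
  point has a minimum there, so its order at that point is nonnegative anyway.\<close>

definition adm :: "('v, 'e) divisor \<Rightarrow> ('v, 'e) point set \<Rightarrow> (('v, 'e) point \<Rightarrow> real) \<Rightarrow> bool" where
  "adm D Q g \<longleftrightarrow> core_fun g \<and> (\<forall>p\<in>core. 0 \<le> g p) \<and> (\<forall>p\<in>Q. g p = 0) \<and>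
     (\<forall>p\<in>core - Q. 0 \<le> Poly_Mapping.lookup D p + cord g p)"

definition pos_deg :: "('v, 'e) divisor \<Rightarrow> int" where
  "pos_deg D = (\<Sum>p\<in>Poly_Mapping.keys D. max 0 (Poly_Mapping.lookup D p))"

lemma adm_cord: "adm D Q g \<Longrightarrow> p \<in> core \<Longrightarrow> p \<notin> Q \<Longrightarrow> 0 \<le> Poly_Mapping.lookup D p + cord g p"
  unfolding adm_def by blast

lemma chart_dirs: "(e, t, s) \<in> dirs p \<Longrightarrow> h (chart C e t) = h p"
  using dirs_valid(5) by metis

text \<open>The function \<open>max g c\<close> with \<open>c = g p\<close> has a principal divisor of degree 0, which bounds the
  total slope with which \<open>g\<close> enters its superlevel set \<open>{g > c}\<close>.\<close>

lemma adm_slope_le: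
  assumes g: "adm D Q g" and dir: "(e, t, s) \<in> dirs p" and m: "germ (g \<circ> chart C e) t s m"
  shows "m \<le> pos_deg D"
proof -
  define c where "c = g p"
  define k where "k = (\<lambda>x. max (g x) c)"
  have gc: "core_fun g" using g by (simp add: adm_def)
  have k: "core_fun k" unfolding k_def by (intro core_fun_max gc core_fun_const)
  have c0: "0 \<le> c" using g dirs_core[OF dir] by (simp add: adm_def c_def)
  have kd: "gslope (k \<circ> chart C e) t s =
      (if g x < c then 0 else if g x > c then gslope (g \<circ> chart C e) t s else max (gslope (g \<circ> chart C e) t s) 0)"
    if "(e, t, s) \<in> dirs x" for e t s x
  proof -
    have gx: "germ (g \<circ> chart C e) t s (gslope (g \<circ> chart C e) t s)" by (rule core_fun_germ[OF gc that])
    have cx: "germ (\<lambda>_. c) t s 0" by (rule germ_const)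
    have k': "k \<circ> chart C e = (\<lambda>y. max ((g \<circ> chart C e) y) c)" "k \<circ> chart C e = (\<lambda>y. max c ((g \<circ> chart C e) y))"
      by (auto simp: k_def max.commute)
    have v: "(g \<circ> chart C e) t = g x" using chart_dirs[OF that] by simp
    show ?thesis
    proof (cases "g x" c rule: linorder_cases)
      case less
      then show ?thesis using gslope_eq[OF germ_max_less[OF gx cx]] v by (simp add: k'(1))
    next
      case equal
      then show ?thesis using gslope_eq[OF germ_max_eq[OF gx cx]] v by (simp add: k'(1))
    next
      case greater
      then show ?thesis using gslope_eq[OF germ_max_less[OF cx gx]] v by (simp add: k'(2))
    qed
  qed
  \<comment> \<open>Above the level \<open>c\<close> the functions \<open>k\<close> and
    \<open>g\<close> have the same order, and since \<open>c\<close> is nonnegative such points lie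
    outside \<open>Q\<close>. At or below the level \<open>k\<close> has its minimum value
    \<open>c\<close>, so all its outward slopes are nonnegative.\<close>
  have low: "- max 0 (Poly_Mapping.lookup D x) \<le> cord k x" if "x \<in> core" for x
  proof (cases "g x > c")
    case True
    then have "cord k x = cord g x" unfolding cord_def by (intro sum.cong) (auto simp: kd)
    moreover have "x \<notin> Q" using True c0 g by (auto simp: adm_def)
    ultimately show ?thesis using adm_cord[OF g that] by simp
  next
    case False
    then have "0 \<le> cord k x" unfolding cord_def by (intro sum_nonneg) (auto simp: kd)
    then show ?thesis by simp
  qed
  have p: "m \<le> cord k p"
  proof -
    have "(\<Sum>(e, t, s)\<in>{(e, t, s)}. gslope (k \<circ> chart C e) t s) \<le> cord k p"
      unfolding cord_def by (rule sum_mono2) (use dir in \<open>auto simp: kd c_def\<close>)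
    then show ?thesis using kd[OF dir] gslope_eq[OF m] by (simp add: c_def)
  qed
  define X where "X = Poly_Mapping.keys (pdiv k) \<union> Poly_Mapping.keys D \<union> {p}"
  have X: "finite X" "Poly_Mapping.keys (pdiv k) \<subseteq> X" "p \<in> X" unfolding X_def by auto
  have "0 = (\<Sum>x\<in>X. Poly_Mapping.lookup (pdiv k) x)"
    using deg_pdiv[OF core_fun_rational[OF k]] deg_eq_sum[OF X(1,2)] by simp
  \<comment> \<open>The orders sum to 0. The point \<open>p\<close> contributes at least
    \<open>m\<close>, and no point can contribute less than minus its positive chips.\<close>
  also have "\<dots> \<ge> (\<Sum>x\<in>X. (if x = p then m else 0) - max 0 (Poly_Mapping.lookup D x))"
  proof (rule sum_mono)
    fix x assume "x \<in> X"
    show "(if x = p then m else 0) - max 0 (Poly_Mapping.lookup D x) \<le> Poly_Mapping.lookup (pdiv k) x"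
      using p low[of x] dirs_core[OF dir] by (auto simp: lookup_pdiv_core[OF k])
  qed
  finally have "(\<Sum>x\<in>X. (if x = p then m else 0) - max 0 (Poly_Mapping.lookup D x)) \<le> 0" .
  moreover have "(\<Sum>x\<in>X. (if x = p then m else 0) - max 0 (Poly_Mapping.lookup D x)) = m - (\<Sum>x\<in>X. max 0 (Poly_Mapping.lookup D x))"
    using X by (simp add: sum_subtractf)
  moreover have "(\<Sum>x\<in>X. max 0 (Poly_Mapping.lookup D x)) = pos_deg D"
    unfolding pos_deg_def using X(1) by (intro sum.mono_neutral_right) (auto simp: X_def in_keys_iff)
  ultimately show ?thesis by simp
qed

lemma dirs_near:
  assumes "(e, t, s) \<in> dirs p"
  shows "\<forall>\<^sub>F x in at_right 0. 0 < t + s * x \<and> t + s * x < L e"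
  using dirs_valid(6)[OF assms] unfolding eventually_at_right_field by auto

text \<open>A very negative slope is a very positive one when looked back at from a nearby inner
  point, where the one-sided bound applies as well.\<close>

lemma adm_slope_abs:
  assumes g: "adm D Q g" and dir: "(e, t, s) \<in> dirs p" and m: "germ (g \<circ> chart C e) t s m"
  shows "\<bar>m\<bar> \<le> pos_deg D"
proof -
  have s: "s = 1 \<or> s = -1" and e: "e \<in> E0" using dirs_valid[OF dir] by auto
  have "\<forall>\<^sub>F x in at_right 0. (germ (g \<circ> chart C e) (t + s * x) s m \<and> germ (g \<circ> chart C e) (t + s * x) (- s) (- m)) \<and>
      0 < t + s * x \<and> t + s * x < L e"
    using germ_nearby[OF m s] dirs_near[OF dir] by (rule eventually_conj)
  then obtain x where x: "germ (g \<circ> chart C e) (t + s * x) (- s) (- m)" "0 < t + s * x" "t + s * x < L e"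
    using eventually_happens'[OF trivial_limit_at_right_real] by blast
  then have "(e, t + s * x, - s) \<in> dirs (Inner e (t + s * x))" using e s by (auto simp: dirs_Inner)
  then have "- m \<le> pos_deg D" using adm_slope_le[OF g _ x(1)] by blast
  then show ?thesis using adm_slope_le[OF g dir m] by simp
qed

lemma core_fun_continuous:
  assumes "core_fun g" "e \<in> E0" shows "continuous_on {0..L e} (g \<circ> chart C e)"
proof -
  have "germs_on (L e) (g \<circ> chart C e)" using assms unfolding core_fun_def by blast
  from germs_on_imp[OF this] E0_len(2)[OF assms(2)] show ?thesis by simp
qed

lemma adm_continuous: "adm D Q g \<Longrightarrow> e \<in> E0 \<Longrightarrow> continuous_on {0..L e} (g \<circ> chart C e)"
  using core_fun_continuous unfolding adm_def by blast

lemma adm_edge_bound: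
  assumes g: "adm D Q g" and e: "e \<in> E0" and t: "0 \<le> a" "a \<le> b" "b \<le> L e"
  shows "g (chart C e b) \<le> g (chart C e a) + of_int (pos_deg D + 1) * (b - a)"
    "g (chart C e a) \<le> g (chart C e b) + of_int (pos_deg D + 1) * (b - a)"
proof -
  have gc: "core_fun g" using g by (simp add: adm_def)
  have cont: "continuous_on {a..b} (g \<circ> chart C e)"
    by (rule continuous_on_subset[OF adm_continuous[OF g e]]) (use t in auto)
  have l: "\<exists>l. germ (g \<circ> chart C e) x (-1) l \<and> - pos_deg D \<le> l" if "a < x" "x \<le> b" for x
  proof -
    have d: "(e, x, -1) \<in> dirs (chart C e x)" using that t e by (auto simp: dirs_def)
    show ?thesis using core_fun_germ[OF gc d] adm_slope_abs[OF g d] by (metis abs_le_iff minus_le_iff)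
  qed
  have r: "\<exists>l. germ (g \<circ> chart C e) x 1 l \<and> - pos_deg D \<le> l" if "a \<le> x" "x < b" for x
  proof -
    have d: "(e, x, 1) \<in> dirs (chart C e x)" using that t e by (auto simp: dirs_def)
    show ?thesis using core_fun_germ[OF gc d] adm_slope_abs[OF g d] by (metis abs_le_iff minus_le_iff)
  qed
  show "g (chart C e b) \<le> g (chart C e a) + of_int (pos_deg D + 1) * (b - a)"
    using lipschitz_left[OF cont t(2) l] by simp
  show "g (chart C e a) \<le> g (chart C e b) + of_int (pos_deg D + 1) * (b - a)"
    using lipschitz_right[OF cont t(2) r] by simp
qed

lemma core_cases:
  assumes "p \<in> core"
  obtains v where "p = Vertex v" "v \<in> V0" | e t where "p = Inner e t" "p = chart C e t" "e \<in> E0" "0 < t" "t < L e"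
  using assms E0_chart(3) unfolding core_def by fastforce

text \<open>All admissible functions vanish at \<open>q\<close>, share one Lipschitz constant on
  inner edges and are constant on leaves. Connectedness carries a bound that does not depend on
  \<open>g\<close> from \<open>q\<close> to any vertex.\<close>

lemma adm_bounded_vertex:
  assumes Q: "q \<in> Q" "q \<in> core" and v: "v \<in> V"
  shows "\<exists>B. \<forall>g. adm D Q g \<longrightarrow> g (Vertex v) \<le> B"
proof -
  define P where "P = (\<lambda>v. \<exists>B. \<forall>g. adm D Q g \<longrightarrow> g (Vertex v) \<le> B)"
  have "\<exists>v0\<in>V. P v0"
    using Q(2)
  proof (cases rule: core_cases)
    case (1 v)
    then have "P v" using Q(1) unfolding P_def adm_def by (intro exI[of _ 0]) auto
    then show ?thesis using 1 V0_V by blast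
  next
    case (2 e t)
    have "g (Vertex (src e)) \<le> of_int (pos_deg D + 1) * t" if "adm D Q g" for g
    proof -
      have "g q = 0" using that Q(1) by (simp add: adm_def)
      then show ?thesis using adm_edge_bound(2)[OF that 2(3), of 0 t] 2 E0_chart(1)[OF 2(3)] by simp
    qed
    then have "P (src e)" unfolding P_def by blast
    then show ?thesis using 2(3) E0_ends V0_V by blast
  qed
  then obtain v0 where v0: "v0 \<in> V" "P v0" by blast
  have "P v"
  proof (rule connected_induct[of v0 P, OF v0 _ v])
    fix e assume e: "e \<in> E"
    show "P (src e) \<longleftrightarrow> P (tgt e)"
    proof (cases "e \<in> E0")
      case True
      have le: "0 \<le> L e" using E0_len(2)[OF True] by simp
      have "g (Vertex (tgt e)) \<le> g (Vertex (src e)) + of_int (pos_deg D + 1) * L e"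
        "g (Vertex (src e)) \<le> g (Vertex (tgt e)) + of_int (pos_deg D + 1) * L e" if "adm D Q g" for g
        using adm_edge_bound[OF that True, of 0 "L e"] le E0_chart(1,2)[OF True] by auto
      then show ?thesis unfolding P_def by (meson add_right_mono order_trans)
    next
      case False
      then have "g (Vertex (tgt e)) = g (Vertex (src e))" if "adm D Q g" for g
        using that e unfolding adm_def core_fun_def by blast
      then show ?thesis unfolding P_def by metis
    qed
  qed
  then show ?thesis unfolding P_def .
qed

lemma adm_bounded:
  assumes Q: "q \<in> Q" "q \<in> core" and p: "p \<in> core"
  shows "bdd_above ((\<lambda>g. g p) ` {g. adm D Q g})"
  using p
proof (cases rule: core_cases)
  case (1 v)
  then show ?thesis using adm_bounded_vertex[OF Q V0_V[OF 1(2)], of D] by (auto simp: bdd_above_def)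
next
  case (2 e t)
  obtain B where B: "\<And>g. adm D Q g \<Longrightarrow> g (Vertex (src e)) \<le> B"
    using adm_bounded_vertex[OF Q V0_V[OF E0_ends(1)[OF 2(3)]], of D] by blast
  have "g p \<le> B + of_int (pos_deg D + 1) * t" if "adm D Q g" for g
    using adm_edge_bound(1)[OF that 2(3), of 0 t] 2 E0_chart(1)[OF 2(3)] B[OF that] by simp
  then show ?thesis by (auto simp: bdd_above_def)
qed

text \<open>A short interval leaving \<open>p\<close> meets, after its start, neither
  \<open>Q\<close> nor the support of \<open>D\<close>, and there admissibility is convexity. The
  interval depends on \<open>D\<close> and \<open>Q\<close> alone, so it serves the whole family, as
  the supremum requires.\<close>

lemma adm_cvx:
  assumes Q: "finite Q" and dir: "(e, t, s) \<in> dirs p"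
  shows "\<forall>\<^sub>F b in at_right 0. \<forall>g. adm D Q g \<longrightarrow> cvx (\<lambda>x. (g \<circ> chart C e) (t + s * x)) 0 b"
proof -
  have s: "s = 1 \<or> s = -1" and e: "e \<in> E0" using dirs_valid[OF dir] by auto
  have "inj (Inner e)" by (auto simp: inj_on_def)
  then have "finite (Inner e -` (Q \<union> Poly_Mapping.keys D))" using Q by (intro finite_vimageI) auto
  then have "\<forall>\<^sub>F x in at_right 0. t + s * x \<notin> Inner e -` (Q \<union> Poly_Mapping.keys D)"
    by (rule eventually_not_in_finite) (use s in auto)
  with dirs_near[OF dir] have "\<forall>\<^sub>F x in at_right 0. 0 < t + s * x \<and> t + s * x < L e \<and> Inner e (t + s * x) \<notin> Q \<union> Poly_Mapping.keys D"
    by eventually_elim auto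
  then obtain d where d: "d > 0" "\<And>x. 0 < x \<Longrightarrow> x < d \<Longrightarrow> 0 < t + s * x \<and> t + s * x < L e \<and> Inner e (t + s * x) \<notin> Q \<union> Poly_Mapping.keys D"
    unfolding eventually_at_right_field by auto
  have "cvx (\<lambda>x. (g \<circ> chart C e) (t + s * x)) 0 b" if b: "0 < b" "b < d" and g: "adm D Q g" for b g
    unfolding cvx_def
  proof (intro conjI allI impI)
    show "continuous_on {0..b} (\<lambda>x. (g \<circ> chart C e) (t + s * x))"
    proof (rule continuous_on_compose2[OF adm_continuous[OF g e]])
      show "(\<lambda>x. t + s * x) ` {0..b} \<subseteq> {0..L e}"
      proof
        fix y assume "y \<in> (\<lambda>x. t + s * x) ` {0..b}"
        then obtain x where x: "0 \<le> x" "x \<le> b" "y = t + s * x" by auto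
        then show "y \<in> {0..L e}" using d(2)[of x] dirs_valid(3,4)[OF dir] b by (cases "x = 0") auto
      qed
    qed (intro continuous_intros)
    fix x assume x: "0 < x \<and> x < b"
    then have u: "0 < t + s * x" "t + s * x < L e" "Inner e (t + s * x) \<notin> Q" "Poly_Mapping.lookup D (Inner e (t + s * x)) = 0"
      using d(2)[of x] b by (auto simp: in_keys_iff)
    have gc: "core_fun g" using g by (simp add: adm_def)
    have dd: "dirs (Inner e (t + s * x)) = {(e, t + s * x, s), (e, t + s * x, - s)}"
      using dirs_Inner[OF e u(1,2)] s by auto
    have "Inner e (t + s * x) \<in> core" using e u by (auto simp: core_def)
    then have "0 \<le> cord g (Inner e (t + s * x))" using adm_cord[OF g _ u(3)] u(4) by simp
    then have "0 \<le> gslope (g \<circ> chart C e) (t + s * x) s + gslope (g \<circ> chart C e) (t + s * x) (- s)"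
      unfolding cord_def dd using s by auto
    moreover have "germ (g \<circ> chart C e) (t + s * x) s (gslope (g \<circ> chart C e) (t + s * x) s)"
      "germ (g \<circ> chart C e) (t + s * x) (- s) (gslope (g \<circ> chart C e) (t + s * x) (- s))"
      using core_fun_germ[OF gc, of e "t + s * x" _ "Inner e (t + s * x)"] dd by auto
    ultimately show "\<exists>m n. germ (\<lambda>x. (g \<circ> chart C e) (t + s * x)) x 1 m \<and>
        germ (\<lambda>x. (g \<circ> chart C e) (t + s * x)) x (- 1) n \<and> m + n \<ge> 0"
      unfolding germ_reparam by auto
  qed
  with d(1) show ?thesis unfolding eventually_at_right_field by blast
qed

text \<open>By the assumption on \<open>D\<close> the zero function is admissible, so the family is
  nonempty and its supremum nonnegative. Germs of the supremum come from
  \<open>cvx_sup_germ\<close>; the delicate point is that passing to the supremum does not lower an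
  order, which uses that slopes are integers.\<close>

lemma adm_sup:
  assumes Q: "finite Q" "Q \<subseteq> core" "Q \<noteq> {}"
    and D: "\<And>p. p \<in> core - Q \<Longrightarrow> 0 \<le> Poly_Mapping.lookup D p"
  shows "\<exists>F. adm D Q F \<and> (\<forall>g p. adm D Q g \<longrightarrow> p \<in> core \<longrightarrow> g p \<le> F p)"
proof -
  define A where "A = {g. adm D Q g}"
  define F where "F = (\<lambda>p. SUP g\<in>A. g p)"
  obtain q where q: "q \<in> Q" "q \<in> core" using Q by auto
  have "cord (\<lambda>p. 0) p = 0" for p
    unfolding cord_def by (rule sum.neutral) (auto simp: comp_def gslope_eq[OF germ_const])
  then have "adm D Q (\<lambda>p. 0)" unfolding adm_def using D core_fun_const by auto
  then have A0: "(\<lambda>p. 0) \<in> A" "A \<noteq> {}" unfolding A_def by auto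
  have bdd: "bdd_above ((\<lambda>g. g p) ` A)" if "p \<in> core" for p
    unfolding A_def by (rule adm_bounded[OF q that])
  have up: "g p \<le> F p" if "g \<in> A" "p \<in> core" for g p
    unfolding F_def by (rule cSUP_upper[OF that(1) bdd[OF that(2)]])
  have F0: "F p = 0" if "p \<in> Q" for p
  proof -
    have "(\<lambda>g. g p) ` A = {0}" using that A0 by (auto simp: A_def adm_def)
    then show ?thesis by (simp add: F_def)
  qed
  have Fgerm: "\<exists>m. germ (F \<circ> chart C e) t s m" if dir: "(e, t, s) \<in> dirs p" for e t s p
  proof -
    have s: "s = 1 \<or> s = -1" and e: "e \<in> E0" using dirs_valid[OF dir] by auto
    obtain b where b: "b > 0" "\<And>g. adm D Q g \<Longrightarrow> cvx (\<lambda>x. (g \<circ> chart C e) (t + s * x)) 0 b"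
      "\<And>x. 0 < x \<Longrightarrow> x < b \<Longrightarrow> 0 < t + s * x \<and> t + s * x < L e"
    proof -
      obtain d where d: "d > 0" "\<And>x. 0 < x \<Longrightarrow> x < d \<Longrightarrow> 0 < t + s * x \<and> t + s * x < L e"
        using dirs_valid(6)[OF dir] by blast
      have "\<forall>\<^sub>F b in at_right 0. b < d \<and> 0 < b" using d(1) unfolding eventually_at_right_field by blast
      with adm_cvx[OF Q(1) dir, of D] have "\<forall>\<^sub>F b in at_right (0::real). (\<forall>g. adm D Q g \<longrightarrow> cvx (\<lambda>x. (g \<circ> chart C e) (t + s * x)) 0 b) \<and> b < d \<and> 0 < b"
        by eventually_elim auto
      then obtain b where "(\<forall>g. adm D Q g \<longrightarrow> cvx (\<lambda>x. (g \<circ> chart C e) (t + s * x)) 0 b) \<and> b < d \<and> 0 < b"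
        using eventually_happens'[OF trivial_limit_at_right_real] by blast
      then show ?thesis using d(2) by (intro that[of b]) auto
    qed
    have dx: "(e, t + s * x, s) \<in> dirs (chart C e (t + s * x))" if "0 \<le> x" "x < b" for x
    proof (cases "x = 0")
      case True
      then show ?thesis using dir dirs_valid(5)[OF dir] by simp
    next
      case False
      then show ?thesis using that b(3)[of x] e s by (auto simp: dirs_def)
    qed
    have "\<exists>m. germ (\<lambda>x. SUP g\<in>A. (g \<circ> chart C e) (t + s * x)) 0 1 m"
    proof (rule cvx_sup_germ[OF A0(2) b(1)])
      fix g assume g: "g \<in> A"
      show "cvx (\<lambda>x. (g \<circ> chart C e) (t + s * x)) 0 b" using b(2) g by (simp add: A_def)
      have gc: "core_fun g" using g by (simp add: A_def adm_def)
      show "\<exists>m. germ (\<lambda>x. (g \<circ> chart C e) (t + s * x)) 0 1 m"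
        unfolding germ_comp using core_fun_germ[OF gc dir] by blast
      fix x m assume "0 \<le> x" "x < b" "germ (\<lambda>x. (g \<circ> chart C e) (t + s * x)) x 1 m"
      then show "\<bar>m\<bar> \<le> pos_deg D"
        unfolding germ_reparam using adm_slope_abs[OF _ dx, of D Q g x m] g by (simp add: A_def)
    next
      fix x assume "0 \<le> x" "x < b"
      from dirs_core[OF dx[OF this]] show "bdd_above ((\<lambda>g. (g \<circ> chart C e) (t + s * x)) ` A)"
        using bdd by simp
    qed
    then show ?thesis unfolding germ_comp[symmetric, of "F \<circ> chart C e"] by (simp add: F_def)
  qed
  have Fc: "core_fun F"
    unfolding core_fun_def
  proof (intro conjI ballI)
    fix e assume "e \<in> E0"
    then show "germs_on (L e) (F \<circ> chart C e)" using Fgerm by (rule germs_onI_dirs)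
  next
    fix e assume e: "e \<in> E - E0"
    have "g (Vertex (tgt e)) = g (Vertex (src e))" "g (Inner e t) = g (Vertex (src e))" if "g \<in> A" for g t
      using that e unfolding A_def adm_def core_fun_def by blast+
    then show "F (Vertex (tgt e)) = F (Vertex (src e))" "\<forall>t. F (Inner e t) = F (Vertex (src e))"
      unfolding F_def by (intro allI arg_cong[where f = Sup] image_cong; simp)+
  qed
  have Ford: "0 \<le> Poly_Mapping.lookup D p + cord F p" if p: "p \<in> core - Q" for p
  proof (rule ccontr)
    assume neg: "\<not> ?thesis"
    let ?m = "\<lambda>(e, t, s). gslope (F \<circ> chart C e) t s"
    \<comment> \<open>\<open>R x d\<close>: at distance \<open>x\<close> in direction
      \<open>d\<close> the supremum is still given by its germ, and every member lies above its
      tangent. As a point has finitely many directions, one \<open>x\<close> works for all of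
      them.\<close>
    define R where "R = (\<lambda>x (e, t, s).
        F (chart C e (t + s * x)) = F p + of_int (gslope (F \<circ> chart C e) t s) * x \<and>
        chart C e (t + s * x) \<in> core \<and>
        (\<forall>g\<in>A. g p + of_int (gslope (g \<circ> chart C e) t s) * x \<le> g (chart C e (t + s * x))))"
    have "\<forall>\<^sub>F x in at_right 0. \<forall>d\<in>dirs p. R x d"
    proof (intro eventually_ball_finite[OF finite_dirs] ballI)
      fix d assume d: "d \<in> dirs p"
      obtain e t s where dd: "d = (e, t, s)" by (cases d)
      with d have dir: "(e, t, s) \<in> dirs p" by simp
      have pos: "\<forall>\<^sub>F x in at_right (0::real). x > 0" by (simp add: eventually_at_right_less)
      from core_fun_germ[OF Fc dir, unfolded germ_def] adm_cvx[OF Q(1) dir, of D] dirs_near[OF dir] pos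
      show "\<forall>\<^sub>F x in at_right 0. R x d"
        unfolding dd R_def prod.case
      proof eventually_elim
        case (elim x)
        have "g p + of_int (gslope (g \<circ> chart C e) t s) * x \<le> g (chart C e (t + s * x))" if "g \<in> A" for g
        proof -
          have "core_fun g" using that by (simp add: A_def adm_def)
          from core_fun_germ[OF this dir] have "germ (\<lambda>x. (g \<circ> chart C e) (t + s * x)) 0 1 (gslope (g \<circ> chart C e) t s)"
            unfolding germ_comp .
          from cvx_tangent_right[OF _ this, of x x] show ?thesis
            using elim that chart_dirs[OF dir, of g] by (simp add: A_def)
        qed
        then show ?case using elim chart_dirs[OF dir, of F] chart_core[OF dirs_valid(1)[OF dir], of "t + s * x"] by simp
      qed
    qed
    then have "\<forall>\<^sub>F x in at_right 0. x > 0 \<and> (\<forall>d\<in>dirs p. R x d)"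
      by (intro eventually_conj) (simp_all add: eventually_at_right_less)
    then obtain x where xR: "x > 0" "\<forall>d\<in>dirs p. R x d"
      using eventually_happens'[OF trivial_limit_at_right_real] by blast
    have x: "F (chart C e (t + s * x)) = F p + of_int (gslope (F \<circ> chart C e) t s) * x \<and>
        chart C e (t + s * x) \<in> core \<and>
        (\<forall>g\<in>A. g p + of_int (gslope (g \<circ> chart C e) t s) * x \<le> g (chart C e (t + s * x)))"
      if "(e, t, s) \<in> dirs p" for e t s
      using bspec[OF xR(2) that] unfolding R_def by simp
    have "F p - x < F p" using xR(1) by simp
    \<comment> \<open>The tolerance is \<open>x\<close> itself: if some slope of \<open>g\<close>
      exceeds that of \<open>F\<close> by at least 1, then over the distance \<open>x\<close> the
      function \<open>g\<close> makes up more than its deficit at \<open>p\<close> and overtakes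
      \<open>F\<close>.\<close>
    then obtain g where g: "g \<in> A" "F p - x < g p"
      using less_cSUP_iff[OF A0(2) bdd, of p "F p - x"] p unfolding F_def by auto
    have "cord F p < cord g p" using neg adm_cord[of D Q g p] g(1) p unfolding A_def by auto
    then obtain d where "d \<in> dirs p" "(case d of (e, t, s) \<Rightarrow> gslope (F \<circ> chart C e) t s) < (case d of (e, t, s) \<Rightarrow> gslope (g \<circ> chart C e) t s)"
      unfolding cord_def by (meson not_le sum_mono)
    then obtain e t s where d: "(e, t, s) \<in> dirs p" "gslope (F \<circ> chart C e) t s < gslope (g \<circ> chart C e) t s"
      by (cases d) auto
    define m where "m = gslope (F \<circ> chart C e) t s"
    have "(of_int m + 1) * x \<le> of_int (gslope (g \<circ> chart C e) t s) * x"
      using d(2) xR(1) unfolding m_def by (intro mult_right_mono) auto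
    moreover have "g p + of_int (gslope (g \<circ> chart C e) t s) * x \<le> F p + of_int m * x"
      using x[OF d(1)] g(1) up[OF g(1), of "chart C e (t + s * x)"] unfolding m_def by force
    ultimately show False using g(2) by (simp add: algebra_simps)
  qed
  have Fpos: "0 \<le> F p" if "p \<in> core" for p
    using up[OF A0(1) that] .
  have "adm D Q F"
    unfolding adm_def using Fc F0 Ford Fpos by blast
  then show ?thesis using up by (auto simp: A_def)
qed

end

section \<open>Subdivisions and moderators\<close>

text \<open>Dhar's burning algorithm: the nodes are ranked in the order in which they burn.\<close>

lemma burning_order:
  fixes l r :: "'s \<Rightarrow> 'w" and c :: "'w \<Rightarrow> int"
  assumes "finite W" "finite S"
    and burn: "\<And>U. U \<subseteq> W \<Longrightarrow> U \<noteq> {} \<Longrightarrow>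
      \<exists>w\<in>U. c w < int (card {s \<in> S. l s = w \<and> r s \<notin> U \<or> r s = w \<and> l s \<notin> U})"
  shows "\<exists>i :: 'w \<Rightarrow> nat. inj_on i W \<and> (\<forall>w\<in>W. c w <
    int (card {s \<in> S. l s = w \<and> (r s \<notin> W \<or> i (r s) < i w) \<or> r s = w \<and> (l s \<notin> W \<or> i (l s) < i w)}))"
proof -
  have "\<exists>i :: 'w \<Rightarrow> nat. inj_on i U \<and> (\<forall>w\<in>U. c w <
    int (card {s \<in> S. l s = w \<and> (r s \<notin> U \<or> i (r s) < i w) \<or> r s = w \<and> (l s \<notin> U \<or> i (l s) < i w)}))"
    if "U \<subseteq> W" for U
    using finite_subset[OF that assms(1)] that
  proof (induction U rule: finite_psubset_induct)
    case (psubset U)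
    show ?case
    proof (cases "U = {}")
      case False
      obtain w0 where w0: "w0 \<in> U" "c w0 < int (card {s \<in> S. l s = w0 \<and> r s \<notin> U \<or> r s = w0 \<and> l s \<notin> U})"
        using burn[OF psubset.prems False] by blast
      have "U - {w0} \<subset> U" "U - {w0} \<subseteq> W" using w0 psubset.prems by auto
      from psubset.IH[OF this] obtain i :: "'w \<Rightarrow> nat" where i: "inj_on i (U - {w0})"
        "\<And>w. w \<in> U - {w0} \<Longrightarrow> c w < int (card {s \<in> S. l s = w \<and> (r s \<notin> U - {w0} \<or> i (r s) < i w) \<or>
            r s = w \<and> (l s \<notin> U - {w0} \<or> i (l s) < i w)})" by blast
      \<comment> \<open>The node \<open>w0\<close> burns first. The ranks of the others are shifted
        by one, so for them \<open>w0\<close> counts as burnt, just as it did while it lay outside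
        the set.\<close>
      define j where "j = (\<lambda>w. if w = w0 then 0 else Suc (i w))"
      have "inj_on j U" using i(1) unfolding inj_on_def j_def by auto
      moreover have "c w < int (card {s \<in> S. l s = w \<and> (r s \<notin> U \<or> j (r s) < j w) \<or> r s = w \<and> (l s \<notin> U \<or> j (l s) < j w)})"
        if w: "w \<in> U" for w
      proof (cases "w = w0")
        case True
        have "card {s \<in> S. l s = w0 \<and> r s \<notin> U \<or> r s = w0 \<and> l s \<notin> U} \<le>
          card {s \<in> S. l s = w \<and> (r s \<notin> U \<or> j (r s) < j w) \<or> r s = w \<and> (l s \<notin> U \<or> j (l s) < j w)}"
          by (rule card_mono) (use assms(2) True in auto)
        then show ?thesis using w0(2) unfolding True by linarith
      next
        case False
        have "{s \<in> S. l s = w \<and> (r s \<notin> U - {w0} \<or> i (r s) < i w) \<or> r s = w \<and> (l s \<notin> U - {w0} \<or> i (l s) < i w)} =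
          {s \<in> S. l s = w \<and> (r s \<notin> U \<or> j (r s) < j w) \<or> r s = w \<and> (l s \<notin> U \<or> j (l s) < j w)}"
          using False unfolding j_def by auto
        then show ?thesis using i(2)[of w] w False by simp
      qed
      ultimately show ?thesis by blast
    qed auto
  qed
  then show ?thesis by blast
qed

lemma germ_max_affine:
  "\<exists>p q. germ (\<lambda>x. max (of_int m * x + c) (of_int n * x + d)) t 1 p \<and>
    germ (\<lambda>x. max (of_int m * x + c) (of_int n * x + d)) t (-1) q \<and> p + q \<ge> 0"
proof (cases "of_int m * t + c" "of_int n * t + d" rule: linorder_cases)
  case less
  from germ_max_less[OF germ_affine(1) germ_affine(1) less] germ_max_less[OF germ_affine(2) germ_affine(2) less]
  show ?thesis by force
next
  case equal
  from germ_max_eq[OF germ_affine(1) germ_affine(1) equal] germ_max_eq[OF germ_affine(2) germ_affine(2) equal]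
  show ?thesis by (intro exI conjI) auto
next
  case greater
  from germ_max_less[OF germ_affine(1) germ_affine(1) greater] germ_max_less[OF germ_affine(2) germ_affine(2) greater]
  show ?thesis unfolding max.commute[of "of_int m * _ + c"] by force
qed

text \<open>\<open>P e\<close> holds the points that cut the inner edge \<open>e\<close>. At least
  one is demanded on every edge so that loops are broken and each segment joins two different
  nodes.\<close>

locale subdivided = tropical C for C :: "('v, 'e) metric_graph" +
  fixes P :: "'e \<Rightarrow> real set"
  assumes P_finite: "e \<in> E0 \<Longrightarrow> finite (P e)"
    and P_nonempty: "e \<in> E0 \<Longrightarrow> P e \<noteq> {}"
    and P_inner: "e \<in> E0 \<Longrightarrow> x \<in> P e \<Longrightarrow> 0 < x \<and> x < L e"
begin

definition "W = Vertex ` V0 \<union> (\<Union>e\<in>E0. Inner e ` P e)"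
text \<open>A segment is named by its edge and its left coordinate; \<open>nxt\<close> recovers the
  right one. The pieces of an edge are thus told apart even when they join the same two
  nodes.\<close>

definition "S = Sigma E0 (\<lambda>e. insert 0 (P e))"
definition "nxt e a = Min {b \<in> insert (L e) (P e). a < b}"
definition "prv e b = Max {a \<in> insert 0 (P e). a < b}"
definition "lf s = chart C (fst s) (snd s)"
definition "rt s = chart C (fst s) (nxt (fst s) (snd s))"

lemma finite_W [simp]: "finite W" and finite_S [simp]: "finite S"
  unfolding W_def S_def using P_finite by auto

lemma W_core: "W \<subseteq> core"
  unfolding W_def core_def using P_inner by auto

lemma S_range: "(e, a) \<in> S \<Longrightarrow> e \<in> E0 \<and> 0 \<le> a \<and> a < L e"
  unfolding S_def using P_inner E0_len(2) by force

lemma nxt: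
  assumes "e \<in> E0" "0 \<le> a" "a < L e"
  shows "nxt e a \<in> insert (L e) (P e)" "a < nxt e a" "nxt e a \<le> L e" "\<And>x. a < x \<Longrightarrow> x < nxt e a \<Longrightarrow> x \<notin> P e"
proof -
  let ?X = "{b \<in> insert (L e) (P e). a < b}"
  have X: "finite ?X" "?X \<noteq> {}" using P_finite[OF assms(1)] assms(3) by auto
  have "nxt e a \<in> ?X" unfolding nxt_def by (rule Min_in[OF X])
  then show *: "nxt e a \<in> insert (L e) (P e)" "a < nxt e a" by auto
  show "nxt e a \<le> L e" unfolding nxt_def using X(1) assms(3) by (intro Min_le) auto
  fix x assume "a < x" "x < nxt e a"
  moreover have "nxt e a \<le> x" if "x \<in> P e"
    unfolding nxt_def using X(1) that \<open>a < x\<close> by (intro Min_le) auto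
  ultimately show "x \<notin> P e" by force
qed

lemma prv:
  assumes "e \<in> E0" "0 < b" "b \<le> L e"
  shows "(e, prv e b) \<in> S" "prv e b < b" "\<And>x. prv e b < x \<Longrightarrow> x < b \<Longrightarrow> x \<notin> P e"
proof -
  let ?X = "{a \<in> insert 0 (P e). a < b}"
  have X: "finite ?X" "?X \<noteq> {}" using P_finite[OF assms(1)] assms(2) by auto
  have "prv e b \<in> ?X" unfolding prv_def by (rule Max_in[OF X])
  then show "(e, prv e b) \<in> S" "prv e b < b" using assms(1) by (auto simp: S_def)
  fix x assume "prv e b < x" "x < b"
  moreover have "x \<le> prv e b" if "x \<in> P e"
    unfolding prv_def using X(1) that \<open>x < b\<close> by (intro Max_ge) auto
  ultimately show "x \<notin> P e" by force
qed

lemma nxt_unique: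
  assumes "e \<in> E0" "0 \<le> a" "a < b" "b \<in> insert (L e) (P e)" "\<And>x. a < x \<Longrightarrow> x < b \<Longrightarrow> x \<notin> P e"
  shows "nxt e a = b"
proof -
  have "b \<le> L e" using assms(1,4) P_inner by force
  then have n: "e \<in> E0" "0 \<le> a" "a < L e" using assms by auto
  show ?thesis
  proof (rule antisym)
    show "nxt e a \<le> b" using assms(3,4) nxt(3,4)[OF n] by force
    show "b \<le> nxt e a" using assms(5)[of "nxt e a"] nxt(1,2)[OF n] \<open>b \<le> L e\<close> by force
  qed
qed

lemma prv_cover:
  assumes "e \<in> E0" "0 < b" "b \<le> L e"
  shows "b \<le> nxt e (prv e b)"
proof (rule ccontr)
  assume "\<not> ?thesis"
  moreover have r: "0 \<le> prv e b" "prv e b < L e" using S_range[OF prv(1)[OF assms]] by auto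
  ultimately show False using nxt(1,2)[OF assms(1) r] prv(3)[OF assms, of "nxt e (prv e b)"] assms(3) by auto
qed

lemma seg_right:
  assumes "e \<in> E0" "0 \<le> t" "t < L e"
  shows "\<exists>a. (e, a) \<in> S \<and> a \<le> t \<and> t < nxt e a"
proof (cases "t \<in> insert 0 (P e)")
  case True
  then show ?thesis using nxt(2)[OF assms] assms by (auto simp: S_def)
next
  case False
  then have t: "0 < t" "t \<le> L e" using assms by auto
  have r: "0 \<le> prv e t" "prv e t < L e" using S_range[OF prv(1)[OF assms(1) t]] by auto
  have "t \<noteq> nxt e (prv e t)" using nxt(1)[OF assms(1) r] False assms(3) by auto
  then show ?thesis using prv_cover[OF assms(1) t] prv(1,2)[OF assms(1) t] by (intro exI[of _ "prv e t"]) auto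
qed

lemma W_chart:
  assumes "e \<in> E0" "0 \<le> t" "t \<le> L e"
  shows "chart C e t \<in> W \<longleftrightarrow> t = 0 \<or> t = L e \<or> t \<in> P e"
  using E0_chart[OF assms(1)] E0_ends[OF assms(1)] assms
  by (cases "t = 0"; cases "t = L e") (auto simp: W_def)

lemma lf_W: "s \<in> S \<Longrightarrow> lf s \<in> W"
proof -
  assume s: "s \<in> S"
  obtain e a where [simp]: "s = (e, a)" by (cases s)
  have "e \<in> E0" "0 \<le> a" "a \<le> L e" using S_range[of e a] s by auto
  then show ?thesis using W_chart[of e a] s by (auto simp: lf_def S_def)
qed

lemma rt_W: "s \<in> S \<Longrightarrow> rt s \<in> W"
proof -
  assume s: "s \<in> S"
  obtain e a where [simp]: "s = (e, a)" by (cases s)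
  have r: "e \<in> E0" "0 \<le> a" "a < L e" using S_range[of e a] s by auto
  then show ?thesis using W_chart[of e "nxt e a"] nxt[OF r] by (auto simp: rt_def)
qed

text \<open>On a closed edge the only coordinates that can denote the same point are the two ends of
  a loop, and a cut lies between them.\<close>

lemma lf_neq_rt: "s \<in> S \<Longrightarrow> lf s \<noteq> rt s"
proof
  assume s: "s \<in> S" and eq: "lf s = rt s"
  obtain e a where [simp]: "s = (e, a)" by (cases s)
  have r: "e \<in> E0" "0 \<le> a" "a < L e" using S_range[of e a] s by auto
  have n: "a < nxt e a" "nxt e a \<le> L e" "\<And>x. a < x \<Longrightarrow> x < nxt e a \<Longrightarrow> x \<notin> P e" using nxt[OF r] by auto
  have "chart C e a = chart C e (nxt e a)" using eq by (simp add: lf_def rt_def)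
  moreover have "0 \<le> nxt e a" using r n by simp
  ultimately have "a = 0 \<and> nxt e a = L e"
  proof (cases "a = 0")
    case True
    have "chart C e (nxt e a) = Vertex (src e)" using \<open>chart C e a = _\<close> E0_chart(1)[OF r(1)] True by simp
    then have "nxt e a = 0 \<or> nxt e a = L e" unfolding chart_eq_iff(1)[OF r(1) \<open>0 \<le> nxt e a\<close> n(2)] by blast
    then show ?thesis using n(1) True by auto
  next
    case False
    have "chart C e (nxt e a) = Inner e a" using \<open>chart C e a = _\<close> E0_chart(3)[OF r(1), of a] False r by simp
    then have "a = nxt e a" unfolding chart_eq_iff(2)[OF r(1) \<open>0 \<le> nxt e a\<close> n(2)] by blast
    then show ?thesis using n(1) by simp
  qed
  then have "P e = {}" using n(3) P_inner[OF r(1)] by force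
  then show False using P_nonempty[OF r(1)] by simp
qed

text \<open>The dictionary that turns sums over the directions at a node into sums over its incident
  segments.\<close>

lemma dirs_node:
  assumes w: "w \<in> W"
  shows "dirs w = (\<lambda>(e, a). (e, a, 1)) ` {s \<in> S. lf s = w} \<union> (\<lambda>(e, a). (e, nxt e a, -1)) ` {s \<in> S. rt s = w}"
proof (intro equalityI subsetI)
  fix d assume "d \<in> dirs w"
  moreover obtain e t s where d: "d = (e, t, s)" by (cases d)
  ultimately have dir: "(e, t, s) \<in> dirs w" by simp
  have v: "e \<in> E0" "0 \<le> t" "t \<le> L e" "chart C e t = w" using dirs_valid[OF dir] by auto
  have tW: "t = 0 \<or> t = L e \<or> t \<in> P e" using W_chart[OF v(1-3)] v(4) w by simp
  show "d \<in> (\<lambda>(e, a). (e, a, 1)) ` {s \<in> S. lf s = w} \<union> (\<lambda>(e, a). (e, nxt e a, -1)) ` {s \<in> S. rt s = w}"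
  proof (cases "s = 1")
    case True
    then have "t < L e" using dir E0_len(2)[OF v(1)] by (auto simp: dirs_def)
    then have "(e, t) \<in> {s \<in> S. lf s = w}" using tW v by (auto simp: S_def lf_def)
    then show ?thesis using d True by force
  next
    case False
    then have t: "0 < t" "s = -1" using dir by (auto simp: dirs_def)
    have p: "(e, prv e t) \<in> S" using prv(1)[OF v(1) t(1) v(3)] .
    have "nxt e (prv e t) = t"
      using S_range[OF p] prv[OF v(1) t(1) v(3)] tW t(1) v by (intro nxt_unique) auto
    then show ?thesis using d t p v by (force simp: rt_def)
  qed
next
  fix d :: "'e \<times> real \<times> real" assume "d \<in> (\<lambda>(e, a). (e, a, 1)) ` {s \<in> S. lf s = w} \<union> (\<lambda>(e, a). (e, nxt e a, -1)) ` {s \<in> S. rt s = w}"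
  then show "d \<in> dirs w"
    using S_range nxt by (fastforce simp: dirs_def lf_def rt_def)
qed

definition "slf f s = gslope (f \<circ> chart C (fst s)) (snd s) 1"
definition "srt f s = gslope (f \<circ> chart C (fst s)) (nxt (fst s) (snd s)) (-1)"

lemma inj_on_right_dirs: "inj_on (\<lambda>(e, a). (e, nxt e a, - 1 :: real)) {s \<in> S. rt s = w}"
proof (rule inj_onI)
  fix x y assume xy: "x \<in> {s \<in> S. rt s = w}" "y \<in> {s \<in> S. rt s = w}"
    "(case x of (e, a) \<Rightarrow> (e, nxt e a, - 1 :: real)) = (case y of (e, a) \<Rightarrow> (e, nxt e a, - 1))"
  obtain e a b where e: "x = (e, a)" "y = (e, b)" "nxt e a = nxt e b" using xy(3) by (cases x; cases y) auto
  have "(e, a) \<in> S" "(e, b) \<in> S" using xy e by auto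
  moreover from this have "e \<in> E0" "0 \<le> a" "a < L e" "0 \<le> b" "b < L e" using S_range by blast+
  ultimately have "\<not> a < b" "\<not> b < a" using nxt(2,4)[of e a] nxt(2,4)[of e b] e(3) by (auto simp: S_def)
  then show "x = y" using e by simp
qed

lemma cord_node:
  assumes w: "w \<in> W"
  shows "cord f w = (\<Sum>s\<in>{s \<in> S. lf s = w}. slf f s) + (\<Sum>s\<in>{s \<in> S. rt s = w}. srt f s)"
proof -
  have "cord f w = (\<Sum>(e, t, s)\<in>(\<lambda>(e, a). (e, a, 1)) ` {s \<in> S. lf s = w}. gslope (f \<circ> chart C e) t s) +
      (\<Sum>(e, t, s)\<in>(\<lambda>(e, a). (e, nxt e a, -1)) ` {s \<in> S. rt s = w}. gslope (f \<circ> chart C e) t s)"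
    unfolding cord_def dirs_node[OF w] by (rule sum.union_disjoint) auto
  also have "(\<Sum>(e, t, s)\<in>(\<lambda>(e, a). (e, a, 1)) ` {s \<in> S. lf s = w}. gslope (f \<circ> chart C e) t s) = (\<Sum>s\<in>{s \<in> S. lf s = w}. slf f s)"
    by (subst sum.reindex) (auto simp: inj_on_def slf_def intro!: sum.cong)
  also have "(\<Sum>(e, t, s)\<in>(\<lambda>(e, a). (e, nxt e a, -1)) ` {s \<in> S. rt s = w}. gslope (f \<circ> chart C e) t s) = (\<Sum>s\<in>{s \<in> S. rt s = w}. srt f s)"
    by (subst sum.reindex[OF inj_on_right_dirs]) (auto simp: srt_def intro!: sum.cong)
  finally show ?thesis .
qed

lemma seg_dirs:
  assumes "s \<in> S"
  shows "(fst s, snd s, 1) \<in> dirs (lf s)" "(fst s, nxt (fst s) (snd s), -1) \<in> dirs (rt s)"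
  using dirs_node[OF lf_W[OF assms]] dirs_node[OF rt_W[OF assms]] assms by force+

text \<open>Each cut adds one segment and one node.\<close>

lemma card_S_W: "int (card S) - int (card W) = int (card E0) - int (card V0)"
proof -
  have "card S = (\<Sum>e\<in>E0. card (insert 0 (P e)))" unfolding S_def using P_finite by simp
  also have "\<dots> = (\<Sum>e\<in>E0. card (P e) + 1)"
    by (rule sum.cong) (use P_finite P_inner in \<open>force simp: card_insert_if\<close>)+
  finally have S: "card S = (\<Sum>e\<in>E0. card (P e)) + card E0" by (simp only: sum.distrib sum_constant) simp
  have "card W = card (Vertex ` V0 :: ('v, 'e) point set) + card (\<Union>e\<in>E0. Inner e ` P e :: ('v, 'e) point set)"
    unfolding W_def by (rule card_Un_disjoint) (use P_finite in auto)
  also have "card (\<Union>e\<in>E0. Inner e ` P e :: ('v, 'e) point set) = (\<Sum>e\<in>E0. card (Inner e ` P e :: ('v, 'e) point set))"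
    by (rule card_UN_disjoint) (use P_finite in auto)
  also have "\<dots> = (\<Sum>e\<in>E0. card (P e))" by (intro sum.cong refl card_image) (auto simp: inj_on_def)
  also have "card (Vertex ` V0 :: ('v, 'e) point set) = card V0" by (rule card_image) (auto simp: inj_on_def)
  finally show ?thesis using S by simp
qed

definition "outdeg U w = card {s \<in> S. lf s = w \<and> rt s \<notin> U \<or> rt s = w \<and> lf s \<notin> U}"
definition "later i s = (if i (rt s) < (i (lf s) :: nat) then lf s else rt s)"
definition "earlier i s = (if i (rt s) < (i (lf s) :: nat) then rt s else lf s)"
text \<open>Orienting every segment towards its later end, the moderator has coefficient indegree minus 1
  at every node; reversing the ranking replaces it by the canonical divisor of the core minus it.\<close>

definition moderator :: "(('v, 'e) point \<Rightarrow> nat) \<Rightarrow> ('v, 'e) divisor" where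
  "moderator i = (\<Sum>w\<in>W. Poly_Mapping.single w (int (card {s \<in> S. later i s = w}) - 1))"

lemma lookup_sum_single:
  assumes "finite A"
  shows "Poly_Mapping.lookup (\<Sum>w\<in>A. Poly_Mapping.single w (c w)) p = (if p \<in> A then c p else 0)"
proof -
  have "Poly_Mapping.lookup (\<Sum>w\<in>A. Poly_Mapping.single w (c w)) p = (\<Sum>w\<in>A. if w = p then c w else 0)"
    unfolding lookup_sum by (rule sum.cong) (auto simp: lookup_single when_def)
  then show ?thesis using assms by simp
qed

lemma lookup_moderator:
  "Poly_Mapping.lookup (moderator i) p = (if p \<in> W then int (card {s \<in> S. later i s = p}) - 1 else 0)"
  unfolding moderator_def by (rule lookup_sum_single) simp

lemma moderator_divisor: "moderator i \<in> divisors C"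
  using W_core core_points by (auto simp: divisors_iff lookup_moderator)

text \<open>Every segment has exactly one later end, so the degree is segments minus nodes whatever
  the ranking.\<close>

lemma deg_moderator: "deg (moderator i) = int (card E0) - int (card V0)"
proof -
  have "deg (moderator i) = (\<Sum>w\<in>W. int (card {s \<in> S. later i s = w}) - 1)"
    by (subst deg_eq_sum[of W]) (auto simp: in_keys_iff lookup_moderator split: if_splits)
  also have "\<dots> = int (\<Sum>w\<in>W. \<Sum>s\<in>{s \<in> S. later i s = w}. 1) - int (card W)"
    by (simp add: sum_subtractf)
  also have "(\<Sum>w\<in>W. \<Sum>s\<in>{s \<in> S. later i s = w}. 1) = (\<Sum>s\<in>S. 1::nat)"
    by (rule sum.group) (auto simp: later_def lf_W rt_W)
  finally show ?thesis using card_S_W by simp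
qed

end

section \<open>Endpoints, leaves and the Euler characteristic of the core\<close>

context tropical
begin

lemma endpoint_arcs:
  assumes "endpoint C v" "e \<in> E"
  shows "src e = v \<Longrightarrow> out_arcs (graph C) v = {e} \<and> in_arcs (graph C) v = {}"
    "tgt e = v \<Longrightarrow> in_arcs (graph C) v = {e} \<and> out_arcs (graph C) v = {}"
proof -
  have fin: "finite (in_arcs (graph C) v)" "finite (out_arcs (graph C) v)" by auto
  have c: "card (in_arcs (graph C) v) + card (out_arcs (graph C) v) = 1"
    using assms(1) unfolding endpoint_def vertex_val_def in_degree_def out_degree_def by simp
  show "src e = v \<Longrightarrow> out_arcs (graph C) v = {e} \<and> in_arcs (graph C) v = {}"
  proof -
    assume "src e = v"
    then have e: "e \<in> out_arcs (graph C) v" using assms(2) by simp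
    then have "card (out_arcs (graph C) v) \<noteq> 0" using fin by auto
    then have "card (out_arcs (graph C) v) = 1" "card (in_arcs (graph C) v) = 0" using c by auto
    then obtain x where x: "out_arcs (graph C) v = {x}" using card_1_singletonE by blast
    have "x = e" using e unfolding x by simp
    then show ?thesis using x \<open>card (in_arcs (graph C) v) = 0\<close> fin(1) by simp
  qed
  show "tgt e = v \<Longrightarrow> in_arcs (graph C) v = {e} \<and> out_arcs (graph C) v = {}"
  proof -
    assume "tgt e = v"
    then have e: "e \<in> in_arcs (graph C) v" using assms(2) by simp
    then have "card (in_arcs (graph C) v) \<noteq> 0" using fin by auto
    then have "card (in_arcs (graph C) v) = 1" "card (out_arcs (graph C) v) = 0" using c by auto
    then obtain x where x: "in_arcs (graph C) v = {x}" using card_1_singletonE by blast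
    have "x = e" using e unfolding x by simp
    then show ?thesis using x \<open>card (out_arcs (graph C) v) = 0\<close> fin(2) by simp
  qed
qed

lemma endpoint_arc_unique:
  assumes "endpoint C v" "e \<in> E" "e' \<in> E" "src e = v \<or> tgt e = v" "src e' = v \<or> tgt e' = v"
  shows "e = e'"
proof -
  have "out_arcs (graph C) v \<union> in_arcs (graph C) v = {e}"
    using endpoint_arcs[OF assms(1,2)] assms(4) by (metis Un_empty_left Un_empty_right)
  moreover have "e' \<in> out_arcs (graph C) v \<union> in_arcs (graph C) v" using assms(3,5) by auto
  ultimately have "e' \<in> {e}" by (rule subst)
  then show ?thesis by simp
qed

lemma endpoint_no_loop:
  assumes "e \<in> E" "endpoint C (src e)" shows "tgt e \<noteq> src e"
proof
  assume "tgt e = src e"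
  then have "e \<in> in_arcs (graph C) (src e)" using assms(1) by simp
  then show False using endpoint_arcs(1)[OF assms(2,1) refl] by simp
qed

text \<open>Both ends of \<open>e\<close> have valence 1, so no other arc touches them, and
  connectedness leaves room for nothing else.\<close>

lemma line_vertices:
  assumes "e \<in> E" "endpoint C (src e)" "endpoint C (tgt e)"
  shows "V = {src e, tgt e}" "E = {e}"
proof -
  have uniq: "e' = e" if "e' \<in> E" "src e' \<in> {src e, tgt e} \<or> tgt e' \<in> {src e, tgt e}" for e'
    using endpoint_arc_unique[OF assms(2) assms(1) that(1)] endpoint_arc_unique[OF assms(3) assms(1) that(1)] that(2)
    by (metis insertE singletonD)
  have "v \<in> {src e, tgt e}" if "v \<in> V" for v
  proof (rule connected_induct[OF G.tail_in_verts[OF assms(1)] _ _ that])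
    fix e' assume e': "e' \<in> E"
    show "src e' \<in> {src e, tgt e} \<longleftrightarrow> tgt e' \<in> {src e, tgt e}"
    proof
      assume "src e' \<in> {src e, tgt e}"
      then have "e' = e" using uniq[OF e'] by simp
      then show "tgt e' \<in> {src e, tgt e}" by simp
    next
      assume "tgt e' \<in> {src e, tgt e}"
      then have "e' = e" using uniq[OF e'] by simp
      then show "src e' \<in> {src e, tgt e}" by simp
    qed
  qed simp
  then have "V \<subseteq> {src e, tgt e}" by blast
  moreover have "{src e, tgt e} \<subseteq> V" using G.tail_in_verts[OF assms(1)] G.head_in_verts[OF assms(1)] by blast
  ultimately show V: "V = {src e, tgt e}" by (rule subset_antisym)
  have "e' = e" if "e' \<in> E" for e'
  proof -
    have "src e' \<in> {src e, tgt e}" using G.tail_in_verts[OF that] unfolding V .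
    then show ?thesis using uniq[OF that] by simp
  qed
  then show "E = {e}" using assms(1) by blast
qed

lemma leaf_ends:
  assumes "V0 \<noteq> {}" "e \<in> E" "e \<notin> E0"
  shows "(endpoint C (src e) \<and> tgt e \<in> V0) \<or> (endpoint C (tgt e) \<and> src e \<in> V0)"
proof -
  have "\<not> (endpoint C (src e) \<and> endpoint C (tgt e))"
    using line_vertices(1)[OF assms(2)] assms(1) unfolding V0_def by auto
  then show ?thesis using leaf_endpoint[OF assms(2,3)] assms(2) unfolding V0_def by auto
qed

text \<open>Each leaf has exactly one endpoint and each endpoint lies on exactly one leaf, so
  removing leaves deletes as many edges as vertices.\<close>

lemma core_euler:
  assumes "V0 \<noteq> {}"
  shows "int (card E0) - int (card V0) = int (card E) - int (card V)"
proof -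
  define ep where "ep = (\<lambda>e. if endpoint C (src e) then src e else tgt e)"
  have ep: "endpoint C (ep e)" "src e = ep e \<or> tgt e = ep e" if "e \<in> E - E0" for e
    using leaf_ends[OF assms, of e] that unfolding ep_def by auto
  have "bij_betw ep (E - E0) (V - V0)"
    unfolding bij_betw_def
  proof
    show "inj_on ep (E - E0)"
      by (rule inj_onI) (metis DiffE endpoint_arc_unique ep)
    show "ep ` (E - E0) = V - V0"
    proof
      show "ep ` (E - E0) \<subseteq> V - V0" using ep unfolding V0_def endpoint_def by auto
      show "V - V0 \<subseteq> ep ` (E - E0)"
      proof
        fix v assume "v \<in> V - V0"
        then have v: "endpoint C v" unfolding V0_def by auto
        then have "in_arcs (graph C) v \<union> out_arcs (graph C) v \<noteq> {}"
          unfolding endpoint_def vertex_val_def in_degree_def out_degree_def by auto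
        then obtain e where "e \<in> in_arcs (graph C) v \<union> out_arcs (graph C) v" by blast
        then have e: "e \<in> E" "src e = v \<or> tgt e = v" by auto
        then have "e \<notin> E0" using endpoint_leaf v by auto
        then have "v = ep e" using leaf_ends[OF assms e(1)] e v unfolding ep_def V0_def by auto
        then show "v \<in> ep ` (E - E0)" using e \<open>e \<notin> E0\<close> by auto
      qed
    qed
  qed
  then have "card (E - E0) = card (V - V0)" by (rule bij_betw_same_card)
  moreover have "E0 \<subseteq> E" "V0 \<subseteq> V" using E0_E V0_V by auto
  ultimately show ?thesis
    using card_Diff_subset[of E0 E] card_Diff_subset[of V0 V] card_mono[of E E0] card_mono[of V V0] by auto
qed

lemma lookup_canonical:
  "Poly_Mapping.lookup (canonical C) (Vertex v) = (if v \<in> V then int (vertex_val C v) - 2 else 0)"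
  "Poly_Mapping.lookup (canonical C) (Inner e t) = 0"
proof -
  have "Poly_Mapping.lookup (canonical C) (Vertex v) = (\<Sum>u\<in>V. if u = v then int (vertex_val C u) - 2 else 0)"
    unfolding canonical_def lookup_sum by (rule sum.cong) (auto simp: lookup_single when_def)
  then show "Poly_Mapping.lookup (canonical C) (Vertex v) = (if v \<in> V then int (vertex_val C v) - 2 else 0)" by simp
  show "Poly_Mapping.lookup (canonical C) (Inner e t) = 0"
    unfolding canonical_def lookup_sum by (rule sum.neutral) (auto simp: lookup_single when_def)
qed

lemma core_max:
  assumes "V0 \<noteq> {}" and cont: "\<And>e. e \<in> E0 \<Longrightarrow> continuous_on {0..L e} (f \<circ> chart C e)"
  shows "\<exists>p\<in>core. \<forall>p'\<in>core. f p' \<le> (f p :: real)"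
proof -
  have "\<exists>x\<in>{0..L e}. \<forall>y\<in>{0..L e}. (f \<circ> chart C e) y \<le> (f \<circ> chart C e) x" if "e \<in> E0" for e
    using continuous_attains_sup[OF _ _ cont[OF that]] E0_len(2)[OF that] by auto
  then obtain x where x: "\<And>e. e \<in> E0 \<Longrightarrow> x e \<in> {0..L e}"
    "\<And>e y. e \<in> E0 \<Longrightarrow> y \<in> {0..L e} \<Longrightarrow> f (chart C e y) \<le> f (chart C e (x e))"
    by (metis comp_apply)
  define X where "X = Vertex ` V0 \<union> (\<lambda>e. chart C e (x e)) ` E0"
  have X: "finite X" "X \<noteq> {}" "X \<subseteq> core" unfolding X_def using assms(1) x(1) chart_core by (auto simp: core_def)
  have "Max (f ` X) \<in> f ` X" using X by (intro Max_in) auto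
  then obtain p where p: "p \<in> X" "f p = Max (f ` X)" by auto
  have "f p' \<le> f p" if "p' \<in> core" for p'
    using that
  proof (cases rule: core_cases)
    case (1 v)
    then show ?thesis unfolding p(2) using X(1) by (intro Max_ge) (auto simp: X_def)
  next
    case (2 e t)
    then have "f p' \<le> f (chart C e (x e))" using x(2)[of e t] by auto
    also have "\<dots> \<le> f p" unfolding p(2) using X(1) 2 by (intro Max_ge) (auto simp: X_def)
    finally show ?thesis .
  qed
  then show ?thesis using p(1) X(3) by blast
qed

text \<open>Without negative orders inside the edge the function is convex on it, so its slope can
  only grow from tail to head.\<close>

lemma leaf_slopes:
  assumes f: "rational_fun C f" and e: "e \<in> E"
    and inner: "\<And>t. t \<in> open_edge e \<Longrightarrow> 0 \<le> ord_at C f (Inner e t)"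
  shows "slope (at_tail C e) (f \<circ> chart C e) \<le> slope (at_head C e) (f \<circ> chart C e)"
proof -
  obtain B where "B \<subseteq> open_edge e"
    "(\<Sum>t\<in>B. ord_at C f (Inner e t)) = slope (at_head C e) (f \<circ> chart C e) - slope (at_tail C e) (f \<circ> chart C e)"
    using edge_structure[OF f e] by metis
  moreover from this have "0 \<le> (\<Sum>t\<in>B. ord_at C f (Inner e t))" using inner by (intro sum_nonneg) auto
  ultimately show ?thesis by simp
qed

end

section \<open>The complement of a moderator has no effective representative\<close>

context subdivided
begin

lemma seg_cvx:
  assumes f: "\<And>e. e \<in> E0 \<Longrightarrow> germs_on (L e) (f \<circ> chart C e)"
    and c: "\<And>p. p \<in> core \<Longrightarrow> p \<notin> W \<Longrightarrow> 0 \<le> cord f p" and s: "(e, a) \<in> S"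
  shows "cvx (f \<circ> chart C e) a (nxt e a)"
  unfolding cvx_def
proof (intro conjI allI impI)
  have r: "e \<in> E0" "0 \<le> a" "a < L e" using S_range[OF s] by auto
  have n: "nxt e a \<le> L e" "\<And>x. a < x \<Longrightarrow> x < nxt e a \<Longrightarrow> x \<notin> P e" using nxt[OF r] by auto
  have "continuous_on {0..L e} (f \<circ> chart C e)" using germs_on_imp[OF f[OF r(1)]] r by auto
  then show "continuous_on {a..nxt e a} (f \<circ> chart C e)" by (rule continuous_on_subset) (use r n in auto)
  fix t assume t: "a < t \<and> t < nxt e a"
  then have t': "0 < t" "t < L e" using r n by auto
  have "chart C e t \<in> core" "chart C e t \<notin> W"
    using W_chart[of e t] r t t' n chart_core[of e t] by auto
  then have "0 \<le> cord f (Inner e t)" using c E0_chart(3)[OF r(1) t'] by simp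
  then have "0 \<le> gslope (f \<circ> chart C e) t 1 + gslope (f \<circ> chart C e) t (-1)"
    unfolding cord_def dirs_Inner[OF r(1) t'] by simp
  moreover have "germ (f \<circ> chart C e) t 1 (gslope (f \<circ> chart C e) t 1)" "germ (f \<circ> chart C e) t (-1) (gslope (f \<circ> chart C e) t (-1))"
    using f[OF r(1)] t' unfolding germs_on_def by (auto intro!: germ_gslope)
  ultimately show "\<exists>m n. germ (f \<circ> chart C e) t 1 m \<and> germ (f \<circ> chart C e) t (-1) n \<and> 0 \<le> m + n" by blast
qed

text \<open>Indegree plus outdegree is the valence of a node in the core, loops being impossible.
  This relates the moderator to that of the reversed ranking.\<close>

lemma card_later_earlier:
  "card {s \<in> S. later i s = w} + card {s \<in> S. earlier i s = w} = card {s \<in> S. lf s = w} + card {s \<in> S. rt s = w}"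
proof -
  have "card {s \<in> S. later i s = w} + card {s \<in> S. earlier i s = w} = card ({s \<in> S. later i s = w} \<union> {s \<in> S. earlier i s = w})"
    by (rule card_Un_disjoint[symmetric]) (auto simp: later_def earlier_def lf_neq_rt dest: lf_neq_rt split: if_splits)
  also have "{s \<in> S. later i s = w} \<union> {s \<in> S. earlier i s = w} = {s \<in> S. lf s = w} \<union> {s \<in> S. rt s = w}"
    by (auto simp: later_def earlier_def)
  also have "card \<dots> = card {s \<in> S. lf s = w} + card {s \<in> S. rt s = w}"
    by (rule card_Un_disjoint) (auto dest: lf_neq_rt)
  finally show ?thesis .
qed

lemma card_dirs_node:
  assumes "w \<in> W"
  shows "card {s \<in> S. lf s = w} + card {s \<in> S. rt s = w} = card (dirs w)"
proof -
  have "card (dirs w) = card ((\<lambda>(e, a). (e, a, 1 :: real)) ` {s \<in> S. lf s = w}) + card ((\<lambda>(e, a). (e, nxt e a, -1 :: real)) ` {s \<in> S. rt s = w})"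
    unfolding dirs_node[OF assms] by (rule card_Un_disjoint) auto
  also have "card ((\<lambda>(e, a). (e, a, 1 :: real)) ` {s \<in> S. lf s = w}) = card {s \<in> S. lf s = w}"
    by (rule card_image) (auto simp: inj_on_def)
  also have "card ((\<lambda>(e, a). (e, nxt e a, -1 :: real)) ` {s \<in> S. rt s = w}) = card {s \<in> S. rt s = w}"
    by (rule card_image[OF inj_on_right_dirs])
  finally show ?thesis by simp
qed

text \<open>The function attains its maximum over the core at a node; at the latest-ranked such node it
  strictly decreases along every segment to a later node.\<close>

lemma no_max_at_nodes:
  assumes V0: "V0 \<noteq> {}" and i: "inj_on i W"
    and f: "\<And>e. e \<in> E0 \<Longrightarrow> germs_on (L e) (f \<circ> chart C e)"
    and c: "\<And>p. p \<in> core \<Longrightarrow> p \<notin> W \<Longrightarrow> 0 \<le> cord f p"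
    and w: "\<And>w. w \<in> W \<Longrightarrow> 1 - int (card {s \<in> S. earlier i s = w}) \<le> cord f w"
  shows False
proof -
  have cont: "continuous_on {0..L e} (f \<circ> chart C e)" if "e \<in> E0" for e
    using germs_on_imp[OF f[OF that]] E0_len(2)[OF that] by simp
  obtain p where p: "p \<in> core" "\<And>p'. p' \<in> core \<Longrightarrow> f p' \<le> f p" using core_max[OF V0 cont] by blast
  define A where "A = {w \<in> W. f w = f p}"
  have germ: "germ (f \<circ> chart C e) t s (gslope (f \<circ> chart C e) t s)" if "(e, t, s) \<in> dirs x" for e t s x
    using germs_on_dirs[OF f that] dirs_valid(1)[OF that] by (intro germ_gslope) auto
  have nonpos: "gslope (f \<circ> chart C e) t s \<le> 0" if d: "(e, t, s) \<in> dirs x" "f x = f p" for e t s x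
  proof (rule germ_nonpos[OF germ[OF d(1)]])
    show "\<forall>\<^sub>F y in at_right 0. (f \<circ> chart C e) (t + s * y) \<le> (f \<circ> chart C e) t"
      using dirs_near[OF d(1)]
    proof eventually_elim
      case (elim y)
      then show ?case using p(2)[OF chart_core[OF dirs_valid(1)[OF d(1)], of "t + s * y"]] chart_dirs[OF d(1), of f] d(2) by simp
    qed
  qed
  \<comment> \<open>At a maximum that is not a node the outward slopes are at most 0 with sum at
    least 0, so both vanish. The horizontal tangent then lies below \<open>f\<close> up to the right
    end of the segment, which is therefore a maximum too.\<close>
  have "A \<noteq> {}"
  proof (cases "p \<in> W")
    case True
    then show ?thesis by (auto simp: A_def)
  next
    case False
    obtain e t where et: "p = Inner e t" "p = chart C e t" "e \<in> E0" "0 < t" "t < L e"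
    proof (rule core_cases[OF p(1)])
      fix v assume "p = Vertex v" "v \<in> V0"
      then show ?thesis using False by (simp add: W_def)
    qed (rule that)
    obtain a where a: "(e, a) \<in> S" "a \<le> t" "t < nxt e a" using seg_right[of e t] et by auto
    have d: "(e, t, 1) \<in> dirs p" "(e, t, -1) \<in> dirs p" using dirs_Inner[OF et(3-5)] et(1) by auto
    have "0 \<le> gslope (f \<circ> chart C e) t 1 + gslope (f \<circ> chart C e) t (-1)"
      using c[OF p(1) False] unfolding cord_def et(1) dirs_Inner[OF et(3-5)] by simp
    with nonpos[OF d(1)] nonpos[OF d(2)] have "gslope (f \<circ> chart C e) t 1 = 0" by simp
    then have "germ (f \<circ> chart C e) t 1 0" using germ[OF d(1)] by simp
    from cvx_tangent[OF seg_cvx[OF f c a(1)] this a(2,3), of "nxt e a"] have "f p \<le> f (rt (e, a))"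
      using a et(2) by (simp add: rt_def)
    moreover have "f (rt (e, a)) \<le> f p" using p(2) rt_W[OF a(1)] W_core by blast
    ultimately show ?thesis using rt_W[OF a(1)] by (auto simp: A_def)
  qed
  moreover have "finite A" by (simp add: A_def)
  ultimately have "Max (i ` A) \<in> i ` A" by (intro Max_in) auto
  then obtain u where u: "u \<in> A" "i u = Max (i ` A)" by auto
  have late: "i w' \<le> i u" if "w' \<in> A" for w' unfolding u(2) using that \<open>finite A\<close> by (intro Max_ge) auto
  have uW: "u \<in> W" "f u = f p" using u(1) by (auto simp: A_def)
  \<comment> \<open>Slope 0 along a segment would by convexity make its other end a maximum as well,
    which contradicts the choice of \<open>u\<close> when that end is the later one. By integrality
    the slope is then at most -1.\<close>
  have left: "slf f s \<le> (if earlier i s = u then -1 else 0)" if s: "s \<in> S" "lf s = u" for s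
  proof -
    obtain e a where [simp]: "s = (e, a)" by (cases s)
    have d: "(e, a, 1) \<in> dirs u" using seg_dirs(1)[OF s(1)] s(2) by simp
    have le: "slf f s \<le> 0" using nonpos[OF d uW(2)] by (simp add: slf_def)
    have "slf f s \<noteq> 0" if "earlier i s = u"
    proof
      assume "slf f s = 0"
      then have "germ (f \<circ> chart C e) a 1 0" using germ[OF d] by (simp add: slf_def)
      moreover have "a < nxt e a" using nxt(2)[of e a] S_range[of e a] s(1) by simp
      ultimately have "f (lf s) \<le> f (rt s)"
        using cvx_tangent_right[OF seg_cvx[OF f c, of e a], of 0 "nxt e a"] s(1) by (simp add: lf_def rt_def)
      then have "rt s \<in> A" using p(2)[of "rt s"] rt_W[OF s(1)] W_core s(2) uW by (auto simp: A_def)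
      then have "i (rt s) \<le> i (lf s)" using late s(2) by simp
      moreover have "i (rt s) \<noteq> i (lf s)" using inj_onD[OF i] rt_W[OF s(1)] lf_W[OF s(1)] lf_neq_rt[OF s(1)] by metis
      ultimately have "earlier i s = rt s" by (simp add: earlier_def)
      then show False using that s(2) lf_neq_rt[OF s(1)] by simp
    qed
    then show ?thesis using le by (cases "earlier i s = u") auto
  qed
  have right: "srt f s \<le> (if earlier i s = u then -1 else 0)" if s: "s \<in> S" "rt s = u" for s
  proof -
    obtain e a where [simp]: "s = (e, a)" by (cases s)
    have d: "(e, nxt e a, -1) \<in> dirs u" using seg_dirs(2)[OF s(1)] s(2) by simp
    have le: "srt f s \<le> 0" using nonpos[OF d uW(2)] by (simp add: srt_def)
    have "srt f s \<noteq> 0" if "earlier i s = u"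
    proof
      assume "srt f s = 0"
      then have "germ (f \<circ> chart C e) (nxt e a) (-1) 0" using germ[OF d] by (simp add: srt_def)
      moreover have "a < nxt e a" using nxt(2)[of e a] S_range[of e a] s(1) by simp
      ultimately have "f (rt s) \<le> f (lf s)"
        using cvx_tangent_left[OF seg_cvx[OF f c, of e a], of 0 a] s(1) by (simp add: lf_def rt_def)
      then have "lf s \<in> A" using p(2)[of "lf s"] lf_W[OF s(1)] W_core s(2) uW by (auto simp: A_def)
      then have "i (lf s) \<le> i (rt s)" using late s(2) by simp
      then have "earlier i s = lf s" by (simp add: earlier_def)
      then show False using that s(2) lf_neq_rt[OF s(1)] by simp
    qed
    then show ?thesis using le by (cases "earlier i s = u") auto
  qed
  have "cord f u \<le> (\<Sum>s\<in>{s \<in> S. lf s = u}. if earlier i s = u then -1 else 0) + (\<Sum>s\<in>{s \<in> S. rt s = u}. if earlier i s = u then -1 else 0)"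
    unfolding cord_node[OF uW(1)] using left right by (intro add_mono sum_mono) auto
  also have "\<dots> = (\<Sum>s\<in>{s \<in> S. lf s = u} \<union> {s \<in> S. rt s = u}. if earlier i s = u then -1 else 0)"
    by (rule sum.union_disjoint[symmetric]) (auto dest: lf_neq_rt)
  also have "\<dots> = (\<Sum>s\<in>{s \<in> S. earlier i s = u}. -1)"
    by (rule sum.mono_neutral_cong_right) (auto simp: earlier_def)
  finally show False using w[OF uW(1)] by simp
qed

text \<open>At a vertex the canonical coefficient counts leaves in the valence, but each leaf also
  forces a slope of at most -1 away from the vertex. The two effects cancel, and what remains for
  the order within the core is the bound that \<open>no_max_at_nodes\<close> refutes.\<close>

lemma moderator_empty:
  assumes V0: "V0 \<noteq> {}" and i: "inj_on i W"
  shows "linsys C (canonical C - moderator i) = {}"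
proof (rule ccontr)
  let ?N = "moderator i"
  have div: "canonical C - ?N \<in> divisors C" by (intro divisors_diff canonical_divisor moderator_divisor)
  assume "linsys C (canonical C - ?N) \<noteq> {}"
  then obtain f where f: "rational_fun C f" "effective (canonical C - ?N + pdiv f)"
    using linsys_iff[OF div] by blast
  have eff: "0 \<le> Poly_Mapping.lookup (canonical C) p - Poly_Mapping.lookup ?N p + ord_at C f p" if "p \<in> points C" for p
    using f(2) that lookup_pdiv[OF f(1), of p] unfolding effective_def by (metis lookup_add lookup_minus)
  have inner: "0 \<le> ord_at C f (Inner e t)" if "Inner e t \<notin> W" "Inner e t \<in> points C" for e t
    using eff[OF that(2)] that(1) by (simp add: lookup_canonical lookup_moderator del: ord_at.simps)
  \<comment> \<open>The canonical coefficient at the endpoint is -1, so the order there is at least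
    1 and \<open>f\<close> falls towards the endpoint. By convexity along the leaf it already leaves
    the base with slope at most -1.\<close>
  have leaf_tail: "slope (at_tail C e) (f \<circ> chart C e) \<le> -1" if e: "e \<in> E" "e \<notin> E0" "src e \<in> V0" for e
  proof -
    have v: "endpoint C (tgt e)" using leaf_ends[OF V0 e(1,2)] e(3) unfolding V0_def by auto
    then have "tgt e \<in> V" "vertex_val C (tgt e) = 1" "Vertex (tgt e) \<notin> W" unfolding endpoint_def W_def V0_def using v by auto
    then have "slope (at_head C e) (f \<circ> chart C e) \<le> -1"
      using eff[of "Vertex (tgt e)"] endpoint_arcs(2)[OF v e(1) refl] by (simp add: points_iff lookup_canonical lookup_moderator)
    moreover have "0 \<le> ord_at C f (Inner e t)" if "t \<in> open_edge e" for t
      by (rule inner) (use that e in \<open>auto simp: W_def points_iff\<close>)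
    ultimately show ?thesis using leaf_slopes[OF f(1) e(1)] by force
  qed
  have leaf_head: "- slope (at_head C e) (f \<circ> chart C e) \<le> -1" if e: "e \<in> E" "e \<notin> E0" "tgt e \<in> V0" for e
  proof -
    have v: "endpoint C (src e)" using leaf_ends[OF V0 e(1,2)] e(3) unfolding V0_def by auto
    then have "src e \<in> V" "vertex_val C (src e) = 1" "Vertex (src e) \<notin> W" unfolding endpoint_def W_def V0_def using v by auto
    then have "1 \<le> slope (at_tail C e) (f \<circ> chart C e)"
      using eff[of "Vertex (src e)"] endpoint_arcs(1)[OF v e(1) refl] by (simp add: points_iff lookup_canonical lookup_moderator)
    moreover have "0 \<le> ord_at C f (Inner e t)" if "t \<in> open_edge e" for t
      by (rule inner) (use that e in \<open>auto simp: W_def points_iff\<close>)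
    ultimately show ?thesis using leaf_slopes[OF f(1) e(1)] by force
  qed
  show False
  proof (rule no_max_at_nodes[OF V0 i, of f])
    show "germs_on (L e) (f \<circ> chart C e)" if "e \<in> E0" for e by (rule rational_germs_on[OF f(1) that])
    show "0 \<le> cord f p" if p: "p \<in> core" "p \<notin> W" for p
      using p(1)
    proof (cases rule: core_cases)
      case (2 e t)
      then show ?thesis using inner[of e t] p core_points ord_core_Inner[OF f(1) 2(3-5)] by auto
    qed (use p in \<open>auto simp: W_def\<close>)
    fix w assume w: "w \<in> W"
    have dn: "int (card {s \<in> S. later i s = w}) + int (card {s \<in> S. earlier i s = w}) = int (card (dirs w))"
      using card_later_earlier[of i w] card_dirs_node[OF w] by simp
    have wp: "w \<in> points C" using w W_core core_points by auto
    show "1 - int (card {s \<in> S. earlier i s = w}) \<le> cord f w"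
    proof (cases w)
      case (Inner e t)
      then have et: "e \<in> E0" "0 < t" "t < L e" using w W_core by (auto simp: core_def)
      have "card (dirs w) = 2" unfolding Inner dirs_Inner[OF et] by simp
      then show ?thesis
        using eff[OF wp] dn w ord_core_Inner[OF f(1) et] unfolding Inner by (simp add: lookup_canonical lookup_moderator)
    next
      case (Vertex v)
      then have v: "v \<in> V0" "v \<in> V" using w V0_V by (auto simp: W_def)
      let ?o = "out_arcs (graph C) v" and ?i = "in_arcs (graph C) v"
      have "card (dirs w) = card {e \<in> E0. src e = v} + card {e \<in> E0. tgt e = v}"
        unfolding Vertex dirs_Vertex by (subst card_Un_disjoint) (auto simp: card_image inj_on_def)
      also have "{e \<in> E0. src e = v} = ?o \<inter> E0" using E0_E by auto
      also have "{e \<in> E0. tgt e = v} = ?i \<inter> E0" using E0_E by auto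
      finally have "int (card (dirs w)) + int (card (?o - E0)) + int (card (?i - E0)) = int (vertex_val C v)"
        using card_Int_Diff[of ?o E0] card_Int_Diff[of ?i E0] G.finite_out_arcs[of v] G.finite_in_arcs[of v]
        unfolding vertex_val_def in_degree_def out_degree_def by simp
      moreover have "(\<Sum>e\<in>?o - E0. slope (at_tail C e) (f \<circ> chart C e)) \<le> (\<Sum>e\<in>?o - E0. -1)"
        by (rule sum_mono) (use leaf_tail v in auto)
      moreover have "(\<Sum>e\<in>?i - E0. - slope (at_head C e) (f \<circ> chart C e)) \<le> (\<Sum>e\<in>?i - E0. -1)"
        by (rule sum_mono) (use leaf_head v in auto)
      moreover have "0 \<le> int (vertex_val C v) - 2 - (int (card {s \<in> S. later i s = w}) - 1) + ord_at C f (Vertex v)"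
        using eff[OF wp] w v unfolding Vertex by (simp add: lookup_canonical lookup_moderator del: ord_at.simps)
      ultimately show ?thesis using dn unfolding ord_core_Vertex[OF f(1)] Vertex by simp
    qed
  qed
qed

end

section \<open>Chip firing\<close>

context tropical
begin

lemma core_extend:
  assumes V0: "V0 \<noteq> {}"
  shows "\<exists>g :: ('v, 'e) point \<Rightarrow> real. (\<forall>p\<in>core. g p = g0 p) \<and>
    (\<forall>e\<in>E - E0. g (Vertex (tgt e)) = g (Vertex (src e)) \<and> (\<forall>t. g (Inner e t) = g (Vertex (src e))))"
proof -
  \<comment> \<open>For an endpoint, \<open>nb\<close> is the base of its leaf, whose value the
    endpoint and the leaf have to take over.\<close>
  define nb where "nb v = (if v \<in> V0 then v else SOME u. \<exists>e\<in>E. (src e = u \<and> tgt e = v) \<or> (src e = v \<and> tgt e = u))" for v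
  define g where "g p = (case p of Vertex v \<Rightarrow> g0 (Vertex (nb v)) | Inner e t \<Rightarrow> if e \<in> E0 then g0 p else g0 (Vertex (nb (src e))))" for p
  have "nb (src e) = nb (tgt e)" if e: "e \<in> E" "e \<notin> E0" for e
  proof -
    have aux: "nb v = u" if v: "endpoint C v" "(src e = u \<and> tgt e = v) \<or> (src e = v \<and> tgt e = u)" for u v
    proof -
      have "u' = u" if "e' \<in> E" "(src e' = u' \<and> tgt e' = v) \<or> (src e' = v \<and> tgt e' = u')" for e' u'
      proof -
        have "e = e'" using endpoint_arc_unique[OF v(1) e(1) that(1)] v(2) that(2) by blast
        then show ?thesis using v(2) that(2) endpoint_no_loop[OF e(1)] by metis
      qed
      moreover have "\<exists>e\<in>E. (src e = u \<and> tgt e = v) \<or> (src e = v \<and> tgt e = u)" using e(1) v(2) by blast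
      ultimately have "(SOME u. \<exists>e\<in>E. (src e = u \<and> tgt e = v) \<or> (src e = v \<and> tgt e = u)) = u"
        by (intro some_equality) blast+
      moreover have "v \<notin> V0" using v(1) by (simp add: V0_def)
      ultimately show ?thesis by (simp add: nb_def)
    qed
    show ?thesis
      using leaf_ends[OF V0 e]
    proof
      assume *: "endpoint C (src e) \<and> tgt e \<in> V0"
      then have "nb (src e) = tgt e" by (intro aux) auto
      then show ?thesis using * by (simp add: nb_def)
    next
      assume *: "endpoint C (tgt e) \<and> src e \<in> V0"
      then have "nb (tgt e) = src e" by (intro aux) auto
      then show ?thesis using * by (simp add: nb_def)
    qed
  qed
  then have "\<forall>e\<in>E - E0. g (Vertex (tgt e)) = g (Vertex (src e)) \<and> (\<forall>t. g (Inner e t) = g (Vertex (src e)))"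
    by (auto simp: g_def)
  moreover have "\<forall>p\<in>core. g p = g0 p" by (auto simp: core_def g_def nb_def)
  ultimately show ?thesis by (intro exI[of _ g]) blast
qed

lemma cord_add:
  assumes "core_fun f" "core_fun h" "p \<in> core"
  shows "cord (\<lambda>p. f p + h p) p = cord f p + cord h p"
  using arg_cong[OF pdiv_add[OF core_fun_rational[OF assms(1)] core_fun_rational[OF assms(2)]], of "\<lambda>D. Poly_Mapping.lookup D p"]
    lookup_pdiv_core[OF core_fun_add[OF assms(1,2)], of p] lookup_pdiv_core[OF assms(1), of p] lookup_pdiv_core[OF assms(2), of p] assms(3)
  by (simp add: lookup_add)

lemma cord_nonneg_at_zero:
  assumes g: "core_fun g" "\<And>p. p \<in> core \<Longrightarrow> 0 \<le> g p" and q: "g q = 0"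
  shows "0 \<le> cord g q"
  unfolding cord_def
proof (rule sum_nonneg, clarify)
  fix e t s assume dir: "(e, t, s) \<in> dirs q"
  show "0 \<le> gslope (g \<circ> chart C e) t s"
  proof (rule germ_pos[OF core_fun_germ[OF g(1) dir]])
    show "\<forall>\<^sub>F x in at_right 0. (g \<circ> chart C e) t \<le> (g \<circ> chart C e) (t + s * x)"
      using dirs_near[OF dir]
    proof eventually_elim
      case (elim x)
      then show ?case using g(2)[OF chart_core[OF dirs_valid(1)[OF dir], of "t + s * x"]] chart_dirs[OF dir, of g] q by simp
    qed
  qed
qed

end

context subdivided
begin

lemma seg_unique:
  assumes "(e, a) \<in> S" "(e, a') \<in> S" "a \<le> t" "t < nxt e a" "a' \<le> t" "t < nxt e a'"
  shows "a = a'"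
proof -
  have r: "e \<in> E0" "0 \<le> a" "a < L e" "0 \<le> a'" "a' < L e" using S_range assms(1,2) by blast+
  then show ?thesis
    using assms nxt(4)[of e a a'] nxt(4)[of e a' a] unfolding S_def by (cases a a' rule: linorder_cases) auto
qed

text \<open>The profile of a firing function on one segment, where \<open>A\<close> and
  \<open>B\<close> tell which ends are fired. As \<open>\<epsilon> \<le> b - a\<close>, it reaches 0
  before or at an unfired far end. A maximum of two affine functions has outward slopes with
  nonnegative sum at every point, so inside the segment chips are only gained.\<close>

lemma hat:
  assumes eps: "0 < (\<epsilon> :: real)" "\<epsilon> \<le> b - a"
  shows "\<exists>\<phi>. (\<exists>m c n d. \<phi> = (\<lambda>x. max (of_int m * x + c) (of_int n * x + d))) \<and> (\<forall>x. 0 \<le> \<phi> x) \<and>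
    \<phi> a = (if A then \<epsilon> else 0) \<and> \<phi> b = (if B then \<epsilon> else 0) \<and>
    (A \<longrightarrow> germ \<phi> a 1 (if B then 0 else -1)) \<and> (B \<longrightarrow> germ \<phi> b (-1) (if A then 0 else -1))"
proof -
  consider "A" "B" | "A" "\<not> B" | "\<not> A" "B" | "\<not> A" "\<not> B" by blast
  then show ?thesis
  proof cases
    case 1
    then show ?thesis using eps germ_const[of \<epsilon>]
      by (intro exI[of _ "\<lambda>x. max (of_int 0 * x + \<epsilon>) (of_int 0 * x + \<epsilon>)"] conjI exI[of _ 0] exI[of _ \<epsilon>]) auto
  next
    case 2
    have "germ (\<lambda>x. max (of_int 0 * x + 0) (of_int (-1) * x + (\<epsilon> + a))) a 1 (-1)"
      by (rule germ_max_less[OF germ_affine(1) germ_affine(1)]) (use eps in auto)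
    then show ?thesis using eps 2
      by (intro exI[of _ "\<lambda>x. max (of_int 0 * x + 0) (of_int (-1) * x + (\<epsilon> + a))"] conjI exI[of _ 0] exI[of _ "-1"] exI[of _ "\<epsilon> + a"]) auto
  next
    case 3
    have "germ (\<lambda>x. max (of_int 0 * x + 0) (of_int 1 * x + (\<epsilon> - b))) b (-1) (- 1)"
      by (rule germ_max_less[OF germ_affine(2) germ_affine(2)]) (use eps in auto)
    then show ?thesis using eps 3
      by (intro exI[of _ "\<lambda>x. max (of_int 0 * x + 0) (of_int 1 * x + (\<epsilon> - b))"] conjI exI[of _ 0] exI[of _ 1] exI[of _ "\<epsilon> - b"]) auto
  next
    case 4
    then show ?thesis using eps
      by (intro exI[of _ "\<lambda>x. max (of_int 0 * x + 0) (of_int 0 * x + 0)"] conjI exI[of _ 0]) auto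
  qed
qed

text \<open>Chip firing: \<open>g\<close> moves one chip from \<open>U\<close> a distance \<open>\<epsilon>\<close> into every segment leaving \<open>U\<close>.\<close>

lemma fire:
  assumes V0: "V0 \<noteq> {}" and U: "U \<subseteq> W" "U \<noteq> {}" "U \<inter> Q = {}" and Q: "Q \<subseteq> W"
    and pay: "\<And>w. w \<in> U \<Longrightarrow> int (outdeg U w) \<le> Poly_Mapping.lookup D w"
    and D: "\<And>p. p \<in> core - Q \<Longrightarrow> 0 \<le> Poly_Mapping.lookup D p"
  shows "\<exists>g p. adm D Q g \<and> p \<in> core \<and> 0 < g p"
proof -
  \<comment> \<open>No chip may travel further than the shortest segment; the entry 1 covers the
    case without segments.\<close>
  define \<epsilon> where "\<epsilon> = Min (insert 1 ((\<lambda>(e, a). nxt e a - a) ` S))"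
  have "\<epsilon> \<in> insert 1 ((\<lambda>(e, a). nxt e a - a) ` S)" unfolding \<epsilon>_def by (rule Min_in) auto
  then have eps: "0 < \<epsilon>" using S_range nxt(2) by fastforce
  have eps_le: "\<epsilon> \<le> nxt e a - a" if "(e, a) \<in> S" for e a
    unfolding \<epsilon>_def using that by (intro Min_le) force+
  define ind where "ind p = (if p \<in> U then \<epsilon> else 0)" for p
  have "\<forall>s\<in>S. \<exists>\<phi>. (\<exists>m c n d. \<phi> = (\<lambda>x. max (of_int m * x + c) (of_int n * x + d))) \<and> (\<forall>x. 0 \<le> \<phi> x) \<and>
    \<phi> (snd s) = ind (lf s) \<and> \<phi> (nxt (fst s) (snd s)) = ind (rt s) \<and>
    (lf s \<in> U \<longrightarrow> germ \<phi> (snd s) 1 (if rt s \<in> U then 0 else -1)) \<and>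
    (rt s \<in> U \<longrightarrow> germ \<phi> (nxt (fst s) (snd s)) (-1) (if lf s \<in> U then 0 else -1))"
    unfolding ind_def by (intro ballI hat[OF eps]) (metis eps_le prod.collapse)
  then obtain \<phi> where \<phi>: "\<forall>s\<in>S. (\<exists>m c n d. \<phi> s = (\<lambda>x. max (of_int m * x + c) (of_int n * x + d))) \<and> (\<forall>x. 0 \<le> \<phi> s x) \<and>
    \<phi> s (snd s) = ind (lf s) \<and> \<phi> s (nxt (fst s) (snd s)) = ind (rt s) \<and>
    (lf s \<in> U \<longrightarrow> germ (\<phi> s) (snd s) 1 (if rt s \<in> U then 0 else -1)) \<and>
    (rt s \<in> U \<longrightarrow> germ (\<phi> s) (nxt (fst s) (snd s)) (-1) (if lf s \<in> U then 0 else -1))"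
    by (rule bchoice[THEN exE])
  have ends: "\<phi> (e, a) a = ind (chart C e a)" "\<phi> (e, a) (nxt e a) = ind (chart C e (nxt e a))" if "(e, a) \<in> S" for e a
    using bspec[OF \<phi> that] by (simp_all add: lf_def rt_def)
  \<comment> \<open>The segment containing \<open>t\<close>, taken half-open on the right so that it
    is unique.\<close>
  define sa where "sa e t = (SOME a. (e, a) \<in> S \<and> a \<le> t \<and> t < nxt e a)" for e t
  have sa: "sa e t = a" if "(e, a) \<in> S" "a \<le> t" "t < nxt e a" for e a t
    unfolding sa_def by (rule some_equality) (use that seg_unique in blast)+
  define g0 where "g0 p = (case p of Vertex v \<Rightarrow> ind p | Inner e t \<Rightarrow> \<phi> (e, sa e t) t)" for p
  obtain g where g: "\<And>p. p \<in> core \<Longrightarrow> g p = g0 p"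
    "\<And>e. e \<in> E - E0 \<Longrightarrow> g (Vertex (tgt e)) = g (Vertex (src e)) \<and> (\<forall>t. g (Inner e t) = g (Vertex (src e)))"
    using core_extend[OF V0, of g0] by blast
  have g\<phi>': "g (chart C e t) = \<phi> (e, a) t" if s: "(e, a) \<in> S" "a \<le> t" "t < nxt e a" for e a t
  proof -
    have r: "e \<in> E0" "0 \<le> a" "a < L e" using S_range[OF s(1)] by auto
    have t: "0 \<le> t" "t < L e" using nxt(3)[OF r] r s by auto
    have gc: "g (chart C e t) = g0 (chart C e t)" using g(1) chart_core[OF r(1) t(1)] t(2) by simp
    show ?thesis
    proof (cases "t = 0")
      case True
      then have "a = 0" using r s by simp
      then show ?thesis using gc ends(1)[OF s(1)] E0_chart(1)[OF r(1)] True by (simp add: g0_def)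
    next
      case False
      then show ?thesis using gc E0_chart(3)[OF r(1)] t sa[OF s] by (simp add: g0_def)
    qed
  qed
  \<comment> \<open>Where two segments meet, both profiles have the value \<open>ind\<close> of the
    node, so the formula of either segment may be used there.\<close>
  have g\<phi>: "g (chart C e t) = \<phi> (e, a) t" if s: "(e, a) \<in> S" "a \<le> t" "t \<le> nxt e a" for e a t
  proof (cases "t = nxt e a")
    case True
    have r: "e \<in> E0" "0 \<le> a" "a < L e" using S_range[OF s(1)] by auto
    show ?thesis
    proof (cases "t = L e")
      case L: True
      have "g (chart C e t) = ind (chart C e t)"
        using g(1)[OF chart_core[OF r(1), of t]] r s L E0_chart(2)[OF r(1)] by (simp add: g0_def)
      then show ?thesis using ends(2)[OF s(1)] True by simp
    next
      case False
      then have t: "t \<in> P e" "(e, t) \<in> S" using nxt(1)[OF r] True r(1) by (auto simp: S_def)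
      have "0 \<le> t" "t < L e" using S_range[OF t(2)] by auto
      then have "g (chart C e t) = \<phi> (e, t) t" using g\<phi>'[OF t(2), of t] nxt(2)[OF r(1)] by simp
      also have "\<dots> = \<phi> (e, a) t" using ends(1)[OF t(2)] ends(2)[OF s(1)] True by simp
      finally show ?thesis .
    qed
  qed (use g\<phi>'[OF s(1,2)] s(3) in simp)
  have cong1: "germ (g \<circ> chart C e) t 1 m \<longleftrightarrow> germ (\<phi> (e, a)) t 1 m" if s: "(e, a) \<in> S" "a \<le> t" "t < nxt e a" for e a t m
    by (rule germ_cong[of "nxt e a - t"]) (use s g\<phi> in auto)
  have cong2: "germ (g \<circ> chart C e) t (-1) m \<longleftrightarrow> germ (\<phi> (e, a)) t (-1) m" if s: "(e, a) \<in> S" "a < t" "t \<le> nxt e a" for e a t m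
    by (rule germ_cong[of "t - a"]) (use s g\<phi> in auto)
  have \<phi>g: "\<exists>p q. germ (\<phi> s) t 1 p \<and> germ (\<phi> s) t (-1) q \<and> p + q \<ge> 0" if s: "s \<in> S" for s t
  proof -
    obtain m n :: int and c d where "\<phi> s = (\<lambda>x. max (of_int m * x + c) (of_int n * x + d))"
      using bspec[OF \<phi> s] by blast
    then show ?thesis using germ_max_affine by metis
  qed
  have gc: "core_fun g"
    unfolding core_fun_def
  proof (intro conjI ballI)
    fix e assume e: "e \<in> E0"
    show "germs_on (L e) (g \<circ> chart C e)"
      unfolding germs_on_def
    proof (intro conjI allI impI)
      fix t assume "0 \<le> t \<and> t < L e"
      then obtain a where a: "(e, a) \<in> S" "a \<le> t" "t < nxt e a" using seg_right[OF e] by blast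
      show "\<exists>m. germ (g \<circ> chart C e) t 1 m" unfolding cong1[OF a] using \<phi>g[OF a(1)] by blast
    next
      fix t assume t: "0 < t \<and> t \<le> L e"
      then have a: "(e, prv e t) \<in> S" "prv e t < t" "t \<le> nxt e (prv e t)" using prv[OF e] prv_cover[OF e] by auto
      show "\<exists>m. germ (g \<circ> chart C e) t (-1) m" unfolding cong2[OF a] using \<phi>g[OF a(1)] by blast
    qed
  qed (use g(2) in auto)
  have node: "g w = ind w" if w: "w \<in> W" for w
  proof -
    have "w \<in> core" using w W_core by auto
    then show ?thesis
    proof (cases rule: core_cases)
      case (1 v)
      then show ?thesis using g(1)[OF \<open>w \<in> core\<close>] by (simp add: g0_def)
    next
      case (2 e t)
      then have "t \<in> P e" using w by (auto simp: W_def)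
      then have "(e, t) \<in> S" using 2 by (auto simp: S_def)
      then show ?thesis using g\<phi>'[of e t t] ends(1)[of e t] nxt(2)[of e t] 2 by auto
    qed
  qed
  have pos: "0 \<le> g p" if "p \<in> core" for p
    using that
  proof (cases rule: core_cases)
    case (1 v)
    then show ?thesis using node[of p] eps by (auto simp: W_def ind_def)
  next
    case (2 e t)
    then obtain a where a: "(e, a) \<in> S" "a \<le> t" "t < nxt e a" using seg_right[of e t] by auto
    then show ?thesis using g\<phi>'[OF a] bspec[OF \<phi> a(1)] 2 by simp
  qed
  have "0 \<le> Poly_Mapping.lookup D p + cord g p" if p: "p \<in> core" "p \<notin> Q" for p
  proof (cases "p \<in> U")
    case True
    then have w: "p \<in> W" using U by auto
    have l: "slf g s = (if rt s \<in> U then 0 else -1)" if "s \<in> S" "lf s = p" for s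
    proof -
      obtain e a where [simp]: "s = (e, a)" by (cases s)
      have "a < nxt e a" using S_range[of e a] nxt(2)[of e a] that(1) by simp
      then have "germ (g \<circ> chart C e) a 1 (if rt s \<in> U then 0 else -1)"
        using cong1[of e a a] bspec[OF \<phi> that(1)] that True by simp
      then show ?thesis by (simp add: slf_def gslope_eq)
    qed
    have r: "srt g s = (if lf s \<in> U then 0 else -1)" if "s \<in> S" "rt s = p" for s
    proof -
      obtain e a where [simp]: "s = (e, a)" by (cases s)
      have "a < nxt e a" using S_range[of e a] nxt(2)[of e a] that(1) by simp
      then have "germ (g \<circ> chart C e) (nxt e a) (-1) (if lf s \<in> U then 0 else -1)"
        using cong2[of e a "nxt e a"] bspec[OF \<phi> that(1)] that True by simp
      then show ?thesis by (simp add: srt_def gslope_eq)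
    qed
    define k where "k s = (if lf s = p \<and> rt s \<notin> U \<or> rt s = p \<and> lf s \<notin> U then -1 else 0 :: int)" for s
    have "cord g p = (\<Sum>s\<in>{s \<in> S. lf s = p}. k s) + (\<Sum>s\<in>{s \<in> S. rt s = p}. k s)"
      unfolding cord_node[OF w] by (intro arg_cong2[where f = "(+)"] sum.cong) (use l r True in \<open>auto simp: k_def\<close>)
    also have "\<dots> = (\<Sum>s\<in>{s \<in> S. lf s = p} \<union> {s \<in> S. rt s = p}. k s)"
      by (rule sum.union_disjoint[symmetric]) (auto dest: lf_neq_rt)
    also have "\<dots> = (\<Sum>s\<in>{s \<in> S. lf s = p \<and> rt s \<notin> U \<or> rt s = p \<and> lf s \<notin> U}. -1)"
      by (rule sum.mono_neutral_cong_right) (auto simp: k_def)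
    finally have "cord g p = - int (outdeg U p)" by (simp add: outdeg_def)
    then show ?thesis using pay[OF True] by simp
  next
    case False
    \<comment> \<open>At an unfired node \<open>g\<close> has its minimum 0; inside a segment the
      profile is convex.\<close>
    have "0 \<le> cord g p"
    proof (cases "p \<in> W")
      case True
      then show ?thesis using cord_nonneg_at_zero[OF gc pos] node[OF True] False by (simp add: ind_def)
    next
      case W: False
      show ?thesis
        using p(1)
      proof (cases rule: core_cases)
        case (1 v)
        then show ?thesis using W by (simp add: W_def)
      next
        case (2 e t)
        obtain a where a: "(e, a) \<in> S" "a \<le> t" "t < nxt e a" using seg_right[of e t] 2 by auto
        have "a \<noteq> t" using lf_W[OF a(1)] W 2(2) by (auto simp: lf_def)
        then have at: "a < t" "t \<le> nxt e a" using a by auto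
        obtain m n where mn: "germ (\<phi> (e, a)) t 1 m" "germ (\<phi> (e, a)) t (-1) n" "m + n \<ge> 0" using \<phi>g[OF a(1)] by blast
        have "gslope (g \<circ> chart C e) t 1 = m" "gslope (g \<circ> chart C e) t (-1) = n"
          using cong1[OF a] cong2[OF a(1) at] mn by (simp_all add: gslope_eq)
        then show ?thesis using mn(3) unfolding cord_def 2(1) dirs_Inner[OF 2(3-5)] by simp
      qed
    qed
    then show ?thesis using D[of p] p by simp
  qed
  moreover have "g p = 0" if "p \<in> Q" for p
  proof -
    have "p \<in> W" "p \<notin> U" using that Q U(3) by blast+
    then show ?thesis using node[of p] by (simp add: ind_def)
  qed
  ultimately have "adm D Q g" unfolding adm_def using gc pos by auto
  moreover obtain u where "u \<in> U" using U(2) by auto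
  ultimately show ?thesis using node[of u] U(1) W_core eps by (intro exI[of _ g] exI[of _ u]) (auto simp: ind_def)
qed

text \<open>A node \<open>w\<close> of an unburnt set \<open>U\<close> burns if it has fewer chips
  than \<open>outdeg U w\<close>. A set without such a node can afford to be fired, and
  \<open>fire\<close> would give an admissible function with a positive value, against
  \<open>red\<close>.\<close>

lemma reduced_below_moderator:
  assumes V0: "V0 \<noteq> {}" and Q: "\<And>p. p \<in> Q \<longleftrightarrow> Poly_Mapping.lookup D p < 0" and D: "Poly_Mapping.keys D \<subseteq> W"
    and red: "\<And>g p. adm D Q g \<Longrightarrow> p \<in> core \<Longrightarrow> g p \<le> 0"
  shows "\<exists>i. inj_on i W \<and> (\<forall>p. Poly_Mapping.lookup D p \<le> Poly_Mapping.lookup (moderator i) p)"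
proof -
  have QW: "Q \<subseteq> W" using D Q by (force simp: in_keys_iff)
  have "\<exists>w\<in>U. Poly_Mapping.lookup D w < int (outdeg U w)" if U: "U \<subseteq> W" "U \<noteq> {}" for U
  proof (rule ccontr)
    assume "\<not> ?thesis"
    then have pay: "int (outdeg U w) \<le> Poly_Mapping.lookup D w" if "w \<in> U" for w using that by (meson not_le)
    \<comment> \<open>A node with a negative coefficient always burns, as no outdegree is
      negative.\<close>
    have "U \<inter> Q = {}"
    proof (rule ccontr)
      assume "U \<inter> Q \<noteq> {}"
      then obtain w where "w \<in> U" "w \<in> Q" by blast
      then show False using pay[of w] Q[of w] by simp
    qed
    moreover have "0 \<le> Poly_Mapping.lookup D p" if "p \<in> core - Q" for p using that Q[of p] by simp
    ultimately obtain g p where "adm D Q g" "p \<in> core" "0 < g p" using fire[OF V0 U _ QW pay] by blast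
    then show False using red by fastforce
  qed
  then obtain i :: "('v, 'e) point \<Rightarrow> nat" where i: "inj_on i W" "\<And>w. w \<in> W \<Longrightarrow> Poly_Mapping.lookup D w <
      int (card {s \<in> S. lf s = w \<and> (rt s \<notin> W \<or> i (rt s) < i w) \<or> rt s = w \<and> (lf s \<notin> W \<or> i (lf s) < i w)})"
    using burning_order[OF finite_W finite_S, of "Poly_Mapping.lookup D" lf rt] unfolding outdeg_def by blast
  \<comment> \<open>The strict inequality in burning pays for the -1 in the moderator.\<close>
  have "Poly_Mapping.lookup D p \<le> Poly_Mapping.lookup (moderator i) p" for p
  proof (cases "p \<in> W")
    case True
    have "{s \<in> S. lf s = p \<and> (rt s \<notin> W \<or> i (rt s) < i p) \<or> rt s = p \<and> (lf s \<notin> W \<or> i (lf s) < i p)} \<subseteq> {s \<in> S. later i s = p}"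
      by (auto simp: later_def lf_W rt_W)
    then have "card {s \<in> S. lf s = p \<and> (rt s \<notin> W \<or> i (rt s) < i p) \<or> rt s = p \<and> (lf s \<notin> W \<or> i (lf s) < i p)} \<le> card {s \<in> S. later i s = p}"
      by (intro card_mono) auto
    then show ?thesis using i(2)[OF True] True by (simp add: lookup_moderator)
  next
    case False
    then have "Poly_Mapping.lookup D p = 0" using D by (auto simp: in_keys_iff)
    then show ?thesis using False by (simp add: lookup_moderator)
  qed
  then show ?thesis using i(1) by blast
qed

end

section \<open>Representatives below a moderator\<close>

context tropical
begin

definition neg_deg :: "('v, 'e) divisor \<Rightarrow> nat" where
  "neg_deg D = nat (\<Sum>p\<in>Poly_Mapping.keys D. max 0 (- Poly_Mapping.lookup D p))"

lemma neg_deg_sum: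
  assumes "finite X" "Poly_Mapping.keys D \<subseteq> X"
  shows "int (neg_deg D) = (\<Sum>p\<in>X. max 0 (- Poly_Mapping.lookup D p))"
proof -
  have "int (neg_deg D) = (\<Sum>p\<in>Poly_Mapping.keys D. max 0 (- Poly_Mapping.lookup D p))"
    unfolding neg_deg_def by (simp add: sum_nonneg)
  also have "\<dots> = (\<Sum>p\<in>X. max 0 (- Poly_Mapping.lookup D p))"
    by (rule sum.mono_neutral_left) (use assms in \<open>auto simp: in_keys_iff\<close>)
  finally show ?thesis .
qed

lemma keys_core_add_pdiv: "Poly_Mapping.keys D \<subseteq> core \<Longrightarrow> core_fun f \<Longrightarrow> Poly_Mapping.keys (D + pdiv f) \<subseteq> core"
  by (auto simp: in_keys_iff lookup_add lookup_pdiv_core split: if_splits)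

text \<open>Why nothing can be fired after translating by the largest admissible function
  \<open>F\<close>: a function admissible for the translate, added to \<open>F\<close>, competes
  with \<open>F\<close> again.\<close>

lemma adm_add:
  assumes F: "adm D Q F" and g: "adm (D + pdiv F) Q g"
  shows "adm D Q (\<lambda>p. F p + g p)"
proof -
  have c: "core_fun F" "core_fun g" using F g by (auto simp: adm_def)
  show ?thesis
    using F g core_fun_add[OF c] unfolding adm_def
    by (auto simp: cord_add[OF c] lookup_add lookup_pdiv_core[OF c(1)] add.assoc)
qed

text \<open>Among the divisors equivalent to \<open>D\<close> via core functions, first minimize the number of
  negative chips; then push chips towards the set \<open>Q\<close> of negative points as far as possible.\<close>

lemma reduced_representative:
  assumes D: "Poly_Mapping.keys D \<subseteq> core" and empty: "linsys C D = {}"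
  shows "\<exists>f Q. core_fun f \<and> (\<forall>p. p \<in> Q \<longleftrightarrow> Poly_Mapping.lookup (D + pdiv f) p < 0) \<and>
    (\<forall>g p. adm (D + pdiv f) Q g \<longrightarrow> p \<in> core \<longrightarrow> g p \<le> 0)"
proof -
  have Ddiv: "D \<in> divisors C" using D core_points unfolding divisors_def by auto
  obtain f where f: "core_fun f" "\<And>h. core_fun h \<Longrightarrow> neg_deg (D + pdiv f) \<le> neg_deg (D + pdiv h)"
    using ex_has_least_nat[of core_fun "\<lambda>_. 0" "\<lambda>f. neg_deg (D + pdiv f)"] core_fun_const by blast
  define D1 where "D1 = D + pdiv f"
  have D1: "Poly_Mapping.keys D1 \<subseteq> core" unfolding D1_def by (rule keys_core_add_pdiv[OF D f(1)])
  define Q where "Q = {p. Poly_Mapping.lookup D1 p < 0}"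
  have QK: "Q \<subseteq> Poly_Mapping.keys D1" unfolding Q_def by (auto simp: in_keys_iff)
  have Q: "finite Q" "Q \<subseteq> core" using QK D1 finite_subset[OF QK] by auto
  have "Q \<noteq> {}"
  proof
    assume "Q = {}"
    then have "effective (D + pdiv f)" unfolding Q_def D1_def effective_def by (force simp: not_less)
    then show False using empty linsys_iff[OF Ddiv] core_fun_rational[OF f(1)] by blast
  qed
  then obtain F where F: "adm D1 Q F" "\<And>g p. adm D1 Q g \<Longrightarrow> p \<in> core \<Longrightarrow> g p \<le> F p"
    using adm_sup[OF Q, of D1] unfolding Q_def by fastforce
  have Fc: "core_fun F" using F(1) by (simp add: adm_def)
  define D2 where "D2 = D1 + pdiv F"
  define fF where "fF = (\<lambda>p. f p + F p)"
  have fF: "core_fun fF" unfolding fF_def by (rule core_fun_add[OF f(1) Fc])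
  have D2: "D2 = D + pdiv fF"
    unfolding D2_def D1_def fF_def pdiv_add[OF core_fun_rational[OF f(1)] core_fun_rational[OF Fc]] by (simp add: add.assoc)
  have FQ: "0 \<le> cord F q" if "q \<in> Q" for q
    using F(1) that unfolding adm_def by (intro cord_nonneg_at_zero) auto
  have l2: "Poly_Mapping.lookup D2 p = Poly_Mapping.lookup D1 p + (if p \<in> core then cord F p else 0)" for p
    unfolding D2_def by (simp add: lookup_add lookup_pdiv_core[OF Fc])
  have off: "0 \<le> Poly_Mapping.lookup D2 p" if "p \<notin> Q" for p
  proof (cases "p \<in> core")
    case True
    then show ?thesis using adm_cord[OF F(1) True that] l2 by simp
  next
    case False
    then show ?thesis using l2[of p] that by (simp add: Q_def)
  qed
  have ge: "Poly_Mapping.lookup D1 q \<le> Poly_Mapping.lookup D2 q" if "q \<in> Q" for q using l2[of q] FQ[OF that] by simp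
  \<comment> \<open>The translation can only raise coefficients on \<open>Q\<close> and creates
    nothing negative elsewhere. A coefficient that did rise would reduce the number of negative
    chips, against the choice of \<open>f\<close>.\<close>
  have on: "Poly_Mapping.lookup D2 q = Poly_Mapping.lookup D1 q" if q: "q \<in> Q" for q
  proof (rule ccontr)
    assume "\<not> ?thesis"
    then have lt: "Poly_Mapping.lookup D1 q < Poly_Mapping.lookup D2 q" using ge[OF q] by simp
    define X where "X = Poly_Mapping.keys D1 \<union> Poly_Mapping.keys D2"
    have X: "finite X" "Poly_Mapping.keys D1 \<subseteq> X" "Poly_Mapping.keys D2 \<subseteq> X" by (auto simp: X_def)
    have "(\<Sum>p\<in>X. max 0 (- Poly_Mapping.lookup D2 p)) < (\<Sum>p\<in>X. max 0 (- Poly_Mapping.lookup D1 p))"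
    proof (rule sum_strict_mono_ex1[OF X(1)])
      show "\<forall>p\<in>X. max 0 (- Poly_Mapping.lookup D2 p) \<le> max 0 (- Poly_Mapping.lookup D1 p)"
      proof
        fix p
        show "max 0 (- Poly_Mapping.lookup D2 p) \<le> max 0 (- Poly_Mapping.lookup D1 p)"
          using off[of p] ge[of p] by (cases "p \<in> Q") auto
      qed
      show "\<exists>p\<in>X. max 0 (- Poly_Mapping.lookup D2 p) < max 0 (- Poly_Mapping.lookup D1 p)"
        using q lt QK X(2) by (intro bexI[of _ q]) (auto simp: Q_def)
    qed
    then have "int (neg_deg D2) < int (neg_deg D1)" unfolding neg_deg_sum[OF X(1,2)] neg_deg_sum[OF X(1,3)] .
    then show False using f(2)[OF fF] unfolding D2 D1_def by simp
  qed
  have "p \<in> Q \<longleftrightarrow> Poly_Mapping.lookup D2 p < 0" for p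
    using off[of p] on[of p] by (cases "p \<in> Q") (auto simp: Q_def)
  moreover have "g p \<le> 0" if "adm D2 Q g" "p \<in> core" for g p
    using F(2)[OF adm_add[OF F(1), of g], of p] that unfolding D2_def by simp
  ultimately show ?thesis using fF unfolding D2 by blast
qed

lemma moderator_above_core:
  assumes V0: "V0 \<noteq> {}" and D: "Poly_Mapping.keys D \<subseteq> core" and empty: "linsys C D = {}"
  shows "\<exists>N\<in>divisors C. deg N = int (card E) - int (card V) \<and> linsys C (N - D) \<noteq> {} \<and> linsys C (canonical C - N) = {}"
proof -
  obtain f Q where f: "core_fun f" "\<And>p. p \<in> Q \<longleftrightarrow> Poly_Mapping.lookup (D + pdiv f) p < 0"
    "\<And>g p. adm (D + pdiv f) Q g \<Longrightarrow> p \<in> core \<Longrightarrow> g p \<le> 0"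
    using reduced_representative[OF D empty] by blast
  define D' where "D' = D + pdiv f"
  have D': "Poly_Mapping.keys D' \<subseteq> core" unfolding D'_def by (rule keys_core_add_pdiv[OF D f(1)])
  \<comment> \<open>The support of \<open>D'\<close> has to consist of nodes; the midpoint ensures
    that every edge is cut.\<close>
  define P where "P e = insert (L e / 2) (Inner e -` Poly_Mapping.keys D')" for e
  interpret subdivided C P
  proof unfold_locales
    fix e assume e: "e \<in> E0"
    show "finite (P e)" unfolding P_def by (auto intro!: finite_vimageI simp: inj_on_def)
    show "P e \<noteq> {}" by (simp add: P_def)
    fix x assume "x \<in> P e"
    then show "0 < x \<and> x < L e" using D' E0_len(2)[OF e] unfolding P_def core_def by auto
  qed
  have "Poly_Mapping.keys D' \<subseteq> W"
  proof
    fix p assume p: "p \<in> Poly_Mapping.keys D'"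
    then have "p \<in> core" using D' by auto
    then show "p \<in> W" by (cases rule: core_cases) (use p in \<open>auto simp: W_def P_def\<close>)
  qed
  then obtain i where i: "inj_on i W" "\<And>p. Poly_Mapping.lookup D' p \<le> Poly_Mapping.lookup (moderator i) p"
    using reduced_below_moderator[OF V0, of Q D'] f(2,3) unfolding D'_def by blast
  have Ddiv: "D \<in> divisors C" using D core_points unfolding divisors_def by auto
  have mf: "rational_fun C (\<lambda>p. - f p)" by (rule rational_fun_uminus[OF core_fun_rational[OF f(1)]])
  have "effective (moderator i - D + pdiv (\<lambda>p. - f p))"
    using i(2) unfolding effective_def D'_def pdiv_uminus[OF core_fun_rational[OF f(1)]]
    by (simp add: lookup_minus lookup_add algebra_simps)
  then have "linsys C (moderator i - D) \<noteq> {}"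
    using linsys_iff[OF divisors_diff[OF moderator_divisor Ddiv]] mf by blast
  then show ?thesis
    using moderator_divisor deg_moderator[of i] core_euler[OF V0] moderator_empty[OF V0 i(1)] by (intro bexI[of _ "moderator i"]) auto
qed

text \<open>The function with slopes \<open>m\<close> and \<open>n\<close> on either side of \<open>t0\<close> on the leaf \<open>e\<close>, normalized to
  vanish at the base of the leaf and extended by \<open>0\<close>.\<close>

lemma leaf_pdiv:
  assumes e: "e \<in> E" "e \<notin> E0" and t0: "t0 \<in> open_edge e"
  shows "\<exists>f. rational_fun C f \<and> pdiv f = Poly_Mapping.single (Vertex (src e)) m - Poly_Mapping.single (Vertex (tgt e)) n
    + Poly_Mapping.single (Inner e t0) (n - m)"
proof -
  define \<psi> where "\<psi> x = of_int m * min (x - t0) 0 + of_int n * max (x - t0) 0" for x :: real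
  define \<phi> where "\<phi> x = \<psi> x - \<psi> 0" for x
  have \<phi>m: "\<phi> x = of_int m * x + (- of_int m * t0 - \<psi> 0)" if "x \<le> t0" for x
    using that by (simp add: \<phi>_def \<psi>_def algebra_simps)
  have \<phi>n: "\<phi> x = of_int n * x + (- of_int n * t0 - \<psi> 0)" if "t0 \<le> x" for x
    using that by (simp add: \<phi>_def \<psi>_def algebra_simps)
  have pw: "pw_linear_on I \<phi>" for I
    unfolding pw_linear_on_def
  proof (intro exI[of _ "{t0}"] conjI allI impI)
    fix J assume J: "is_interval J \<and> J \<subseteq> I - {t0}"
    have "(\<forall>x\<in>J. x \<le> t0) \<or> (\<forall>x\<in>J. t0 \<le> x)"
    proof (rule ccontr)
      assume "\<not> ?thesis"
      then obtain x y where "x \<in> J" "y \<in> J" "t0 < x" "y < t0" by (auto simp: not_le)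
      then have "t0 \<in> J" using J mem_is_interval_1_I[of J y x t0] by auto
      then show False using J by auto
    qed
    then show "\<exists>(k::int) c. \<forall>x\<in>J. \<phi> x = of_int k * x + c" using \<phi>m \<phi>n by blast
  qed simp
  have cont: "continuous_on I \<phi>" for I unfolding \<phi>_def \<psi>_def by (intro continuous_intros)
  define f :: "('v, 'e) point \<Rightarrow> real" where "f p = (case p of Vertex v \<Rightarrow> 0 | Inner e' t \<Rightarrow> if e' = e then \<phi> t else 0)" for p
  \<comment> \<open>A finite end of a leaf has coordinate 0, so with this normalization the
    extension by 0 is continuous at the base of the leaf.\<close>
  have "\<phi> 0 = 0" by (simp add: \<phi>_def)
  have lohi: "lo C e = - \<infinity> \<or> lo C e = 0" "hi C e = 0 \<or> hi C e = \<infinity>"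
    using leaf_len[OF e] by (auto simp: lo_def hi_def)
  have fe: "f \<circ> chart C e = \<phi>"
    using lohi \<open>\<phi> 0 = 0\<close> by (auto simp: fun_eq_iff f_def chart_def)
  have fe': "f \<circ> chart C e' = (\<lambda>_. 0)" if "e' \<noteq> e" for e'
    using that by (auto simp: fun_eq_iff f_def chart_def)
  have f: "rational_fun C f"
    unfolding rational_fun_def
  proof
    fix e'
    show "continuous_on (edge_dom C e') (f \<circ> chart C e') \<and> pw_linear_on (edge_dom C e') (f \<circ> chart C e')"
      by (cases "e' = e") (auto simp: fe fe' cont pw intro: pw_linear_on_affine[of _ _ 0 0])
  qed
  have t0': "lo C e < ereal t0" "ereal t0 < hi C e" using t0 by (auto simp: open_edge_def)
  have st: "slope (at_tail C e') (f \<circ> chart C e') = (if e' = e then m else 0)" for e'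
  proof (cases "e' = e")
    case True
    have "\<forall>\<^sub>F x in at_tail C e. \<phi> x = of_int m * x + (- of_int m * t0 - \<psi> 0)"
      using eventually_at_tail[OF e(1) t0'(1)] by eventually_elim (rule \<phi>m, simp)
    then show ?thesis using slope_eqI[OF punctured_ends(1), of \<phi> m] True fe by simp
  next
    case False
    then show ?thesis using slope_eqI[OF punctured_ends(1), of "\<lambda>_. 0" 0 0] fe' by simp
  qed
  have sh: "slope (at_head C e') (f \<circ> chart C e') = (if e' = e then n else 0)" for e'
  proof (cases "e' = e")
    case True
    have "\<forall>\<^sub>F x in at_head C e. \<phi> x = of_int n * x + (- of_int n * t0 - \<psi> 0)"
      using eventually_at_head[OF e(1) t0'(2)] by eventually_elim (rule \<phi>n, simp)
    then show ?thesis using slope_eqI[OF punctured_ends(2), of \<phi> n] True fe by simp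
  next
    case False
    then show ?thesis using slope_eqI[OF punctured_ends(2), of "\<lambda>_. 0" 0 0] fe' by simp
  qed
  have \<phi>1: "germ \<phi> t 1 (if t < t0 then m else n)" for t
  proof (cases "t < t0")
    case True
    then have "germ \<phi> t 1 m" by (intro germI[of "t0 - t"]) (auto simp: \<phi>m algebra_simps)
    then show ?thesis using True by simp
  next
    case False
    then have "germ \<phi> t 1 n" by (intro germI[of 1]) (auto simp: \<phi>n algebra_simps)
    then show ?thesis using False by simp
  qed
  have \<phi>2: "germ \<phi> t (-1) (if t \<le> t0 then - m else - n)" for t
  proof (cases "t \<le> t0")
    case True
    then have "germ \<phi> t (-1) (- m)" by (intro germI[of 1]) (auto simp: \<phi>m algebra_simps)
    then show ?thesis using True by simp
  next
    case False
    then have "germ \<phi> t (-1) (- n)" by (intro germI[of "t - t0"]) (auto simp: \<phi>n algebra_simps)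
    then show ?thesis using False by simp
  qed
  have "pdiv f = Poly_Mapping.single (Vertex (src e)) m - Poly_Mapping.single (Vertex (tgt e)) n
    + Poly_Mapping.single (Inner e t0) (n - m)"
  proof (rule poly_mapping_eqI)
    fix p
    show "Poly_Mapping.lookup (pdiv f) p = Poly_Mapping.lookup (Poly_Mapping.single (Vertex (src e)) m -
       Poly_Mapping.single (Vertex (tgt e)) n + Poly_Mapping.single (Inner e t0) (n - m)) p"
    proof (cases p)
      case (Vertex v)
      have "(\<Sum>e'\<in>out_arcs (graph C) v. if e' = e then m else 0) = (if src e = v then m else 0)"
        using e(1) by (simp add: sum.delta[OF G.finite_out_arcs])
      moreover have "(\<Sum>e'\<in>in_arcs (graph C) v. - (if e' = e then n else 0)) = - (if tgt e = v then n else 0)"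
        using e(1) by (simp add: sum_negf sum.delta[OF G.finite_in_arcs])
      ultimately have "ord_at C f (Vertex v) = (if src e = v then m else 0) - (if tgt e = v then n else 0)"
        unfolding ord_at.simps st sh by simp
      moreover have "src e \<in> V" "tgt e \<in> V" using e(1) by auto
      ultimately show ?thesis unfolding Vertex
        by (auto simp: lookup_pdiv[OF f] lookup_add lookup_minus lookup_single when_def points_iff simp del: ord_at.simps)
    next
      case (Inner e' t)
      have "ord_at C f (Inner e' t) = (if e' = e \<and> t = t0 then n - m else 0)" if "e' \<in> E" "t \<in> open_edge e'"
      proof (cases "e' = e")
        case True
        have "ord_at C f (Inner e' t) = gslope \<phi> t 1 + gslope \<phi> t (-1)"
          using ord_inner[OF f that] unfolding True fe .
        then show ?thesis unfolding gslope_eq[OF \<phi>1] gslope_eq[OF \<phi>2] using True by simp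
      next
        case False
        have "ord_at C f (Inner e' t) = 0"
          using ord_inner[OF f that] unfolding fe'[OF False] gslope_eq[OF germ_const] by simp
        then show ?thesis using False by simp
      qed
      then show ?thesis unfolding Inner using e(1) t0
        by (auto simp: lookup_pdiv[OF f] lookup_add lookup_minus lookup_single when_def points_iff simp del: ord_at.simps)
    qed
  qed
  then show ?thesis using f by blast
qed

lemma open_edge_nonempty: "e \<in> E \<Longrightarrow> \<exists>t. t \<in> open_edge e"
  using ereal_dense2[OF lo_less_hi] unfolding open_edge_def by blast

text \<open>A function of constant slope along the leaf carries chips from one end to the other,
  even from infinity; slope \<open>n\<close> up to \<open>t\<close> and 0 beyond carries them to the
  inner point \<open>t\<close>.\<close>

lemma tail_move:
  assumes e: "e \<in> E" "e \<notin> E0" and p: "p = Vertex (tgt e) \<or> (\<exists>t\<in>open_edge e. p = Inner e t)"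
  shows "\<exists>f. rational_fun C f \<and> pdiv f = Poly_Mapping.single (Vertex (src e)) n - Poly_Mapping.single p n"
proof -
  obtain t0 where t0: "t0 \<in> open_edge e" using open_edge_nonempty[OF e(1)] by blast
  show ?thesis
    using p
  proof (elim disjE bexE)
    assume "p = Vertex (tgt e)"
    then show ?thesis using leaf_pdiv[OF e t0, of n n] by simp
  next
    fix t assume "t \<in> open_edge e" "p = Inner e t"
    then show ?thesis using leaf_pdiv[OF e, of t n 0] by (simp add: single_uminus)
  qed
qed

lemma head_move:
  assumes e: "e \<in> E" "e \<notin> E0" and p: "p = Vertex (src e) \<or> (\<exists>t\<in>open_edge e. p = Inner e t)"
  shows "\<exists>f. rational_fun C f \<and> pdiv f = Poly_Mapping.single (Vertex (tgt e)) n - Poly_Mapping.single p n"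
proof -
  obtain t0 where t0: "t0 \<in> open_edge e" using open_edge_nonempty[OF e(1)] by blast
  show ?thesis
    using p
  proof (elim disjE bexE)
    assume "p = Vertex (src e)"
    then show ?thesis using leaf_pdiv[OF e t0, of "- n" "- n"] by (simp add: single_uminus)
  next
    fix t assume "t \<in> open_edge e" "p = Inner e t"
    then show ?thesis using leaf_pdiv[OF e, of t 0 "- n"] by (simp add: single_uminus)
  qed
qed

text \<open>The support outside \<open>B\<close> is cleared point by point. All chips of a point
  move at once, whatever their number and sign, and land in \<open>B\<close>, so the set of points
  to be cleared shrinks.\<close>

lemma move_chips:
  assumes move: "\<And>p n. p \<in> points C \<Longrightarrow> p \<notin> B \<Longrightarrow> \<exists>q\<in>B. \<exists>f. rational_fun C f \<and>
      pdiv f = Poly_Mapping.single q n - Poly_Mapping.single p n"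
    and D: "D \<in> divisors C"
  shows "\<exists>f. rational_fun C f \<and> Poly_Mapping.keys (D + pdiv f) \<subseteq> B"
proof -
  have "\<exists>f. rational_fun C f \<and> Poly_Mapping.keys (D + pdiv f) \<subseteq> B"
    if "finite X" "X \<subseteq> points C - B" "Poly_Mapping.keys D \<subseteq> X \<union> B" for X D
    using that
  proof (induction X arbitrary: D rule: finite_induct)
    case empty
    then show ?case by (intro exI[of _ "\<lambda>p. 0"]) (simp add: rational_fun_const pdiv_zero)
  next
    case (insert p X)
    obtain q f where q: "q \<in> B" and f: "rational_fun C f"
      "pdiv f = Poly_Mapping.single q (Poly_Mapping.lookup D p) - Poly_Mapping.single p (Poly_Mapping.lookup D p)"
      using move[of p "Poly_Mapping.lookup D p"] insert.prems(1) by auto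
    have "Poly_Mapping.keys (D + pdiv f) \<subseteq> X \<union> B"
    proof
      fix x assume x: "x \<in> Poly_Mapping.keys (D + pdiv f)"
      have "p \<noteq> q" using insert.prems(1) q by auto
      then have "x \<noteq> p" using x by (auto simp: f(2) in_keys_iff lookup_add lookup_minus lookup_single when_def)
      then show "x \<in> X \<union> B"
        using x insert.prems(2) q by (cases "x = q") (auto simp: f(2) in_keys_iff lookup_add lookup_minus lookup_single when_def)
    qed
    then obtain h where h: "rational_fun C h" "Poly_Mapping.keys (D + pdiv f + pdiv h) \<subseteq> B"
      using insert.IH[of "D + pdiv f"] insert.prems(1) by auto
    then show ?case
      by (intro exI[of _ "\<lambda>p. f p + h p"]) (simp add: rational_fun_add f(1) pdiv_add add.assoc)
  qed
  from this[of "Poly_Mapping.keys D - B" D] D show ?thesis unfolding divisors_def by auto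
qed

lemma move_to_core:
  assumes V0: "V0 \<noteq> {}" and p: "p \<in> points C" "p \<notin> core"
  shows "\<exists>q\<in>core. \<exists>f. rational_fun C f \<and> pdiv f = Poly_Mapping.single q n - Poly_Mapping.single p n"
proof -
  have "\<exists>e. e \<in> E \<and> e \<notin> E0 \<and> (\<exists>t\<in>open_edge e. p = Inner e t) \<or>
      e \<in> E \<and> e \<notin> E0 \<and> p = Vertex (src e) \<and> src e \<notin> V0 \<or> e \<in> E \<and> e \<notin> E0 \<and> p = Vertex (tgt e) \<and> tgt e \<notin> V0"
    using not_core[OF p]
  proof (elim disjE exE conjE)
    fix v assume v: "p = Vertex v" "v \<in> V" "v \<notin> V0"
    then have ev: "endpoint C v" by (simp add: V0_def)
    then have "in_arcs (graph C) v \<union> out_arcs (graph C) v \<noteq> {}"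
      unfolding endpoint_def vertex_val_def in_degree_def out_degree_def by auto
    then obtain e where "e \<in> in_arcs (graph C) v \<union> out_arcs (graph C) v" by blast
    then have e: "e \<in> E" "src e = v \<or> tgt e = v" by auto
    then have "e \<notin> E0" using endpoint_leaf ev by auto
    then show ?thesis using e v by blast
  qed blast
  then obtain e where e: "e \<in> E" "e \<notin> E0" and
    p': "(\<exists>t\<in>open_edge e. p = Inner e t) \<or> p = Vertex (src e) \<and> src e \<notin> V0 \<or> p = Vertex (tgt e) \<and> tgt e \<notin> V0"
    by blast
  show ?thesis
    using leaf_ends[OF V0 e]
  proof
    assume *: "endpoint C (src e) \<and> tgt e \<in> V0"
    then have "Vertex (tgt e) \<in> core" by (simp add: core_def)
    moreover have "p = Vertex (src e) \<or> (\<exists>t\<in>open_edge e. p = Inner e t)" using p' * by blast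
    ultimately show ?thesis using head_move[OF e] by blast
  next
    assume *: "endpoint C (tgt e) \<and> src e \<in> V0"
    then have "Vertex (src e) \<in> core" by (simp add: core_def)
    moreover have "p = Vertex (tgt e) \<or> (\<exists>t\<in>open_edge e. p = Inner e t)" using p' * by blast
    ultimately show ?thesis using tail_move[OF e] by blast
  qed
qed

text \<open>The curve is a single edge between two endpoints, where every divisor is equivalent to a
  multiple of one point \<open>q\<close>, so a system is empty only in negative degree. Hence minus
  \<open>q\<close> serves as \<open>N\<close>: the canonical degree is -2, and the complement has
  degree -1.\<close>

lemma moderator_above_line:
  assumes V0: "V0 = {}" and D: "D \<in> divisors C" and empty: "linsys C D = {}"
  shows "\<exists>N\<in>divisors C. deg N = int (card E) - int (card V) \<and> linsys C (N - D) \<noteq> {} \<and> linsys C (canonical C - N) = {}"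
proof -
  have ep: "endpoint C v" if "v \<in> V" for v using that V0 by (auto simp: V0_def)
  obtain v where v: "v \<in> V" using V_nonempty by blast
  then have "in_arcs (graph C) v \<union> out_arcs (graph C) v \<noteq> {}"
    using ep[OF v] unfolding endpoint_def vertex_val_def in_degree_def out_degree_def by auto
  then obtain e where "e \<in> in_arcs (graph C) v \<union> out_arcs (graph C) v" by blast
  then have e: "e \<in> E" by auto
  have ends: "endpoint C (src e)" "endpoint C (tgt e)" using ep e by auto
  have VE: "V = {src e, tgt e}" "E = {e}" using line_vertices[OF e ends] by auto
  have "tgt e \<noteq> src e" by (rule endpoint_no_loop[OF e ends(1)])
  then have euler: "int (card E) - int (card V) = -1" unfolding VE by simp
  have e0: "e \<notin> E0" using endpoint_leaf[OF e] ends by simp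
  define q :: "('v, 'e) point" where "q = Vertex (src e)"
  have q: "q \<in> points C" using e by (simp add: q_def points_iff)
  have move: "\<exists>q'\<in>{q}. \<exists>f. rational_fun C f \<and> pdiv f = Poly_Mapping.single q' n - Poly_Mapping.single p n"
    if p: "p \<in> points C" "p \<notin> {q}" for p n
  proof -
    have "p = Vertex (tgt e) \<or> (\<exists>t\<in>open_edge e. p = Inner e t)"
    proof (cases p)
      case (Vertex v)
      then have "v \<in> {src e, tgt e}" using p(1) VE(1) by (simp add: points_iff)
      then show ?thesis using Vertex p(2) by (auto simp: q_def)
    next
      case (Inner e' t)
      then have "e' \<in> {e}" "t \<in> open_edge e'" using p(1) VE(2) by (auto simp: points_iff)
      then show ?thesis using Inner by auto
    qed
    from tail_move[OF e e0 this] show ?thesis by (simp add: q_def)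
  qed
  have ne: "linsys C D' \<noteq> {}" if D': "D' \<in> divisors C" "0 \<le> deg D'" for D'
  proof -
    obtain f where f: "rational_fun C f" "Poly_Mapping.keys (D' + pdiv f) \<subseteq> {q}" using move_chips[OF move D'(1)] by blast
    have "deg (D' + pdiv f) = Poly_Mapping.lookup (D' + pdiv f) q" using deg_eq_sum[OF _ f(2)] by simp
    then have "0 \<le> Poly_Mapping.lookup (D' + pdiv f) q" using D'(2) by (simp add: deg_add deg_pdiv[OF f(1)])
    moreover have "Poly_Mapping.lookup (D' + pdiv f) p = 0" if "p \<noteq> q" for p using f(2) that by (auto simp: in_keys_iff)
    ultimately have "effective (D' + pdiv f)" unfolding effective_def by (metis order_refl)
    then show ?thesis using linsys_iff[OF D'(1)] f(1) by blast
  qed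
  have "deg D < 0" using ne[OF D] empty by force
  define N where "N = Poly_Mapping.single q (-1 :: int)"
  have N: "N \<in> divisors C" "deg N = -1" unfolding N_def using q by (auto intro: divisors_single)
  have "linsys C (N - D) \<noteq> {}" using ne[OF divisors_diff[OF N(1) D]] N(2) \<open>deg D < 0\<close> by (simp add: deg_diff)
  moreover have "linsys C (canonical C - N) = {}"
    using linsys_deg[OF divisors_diff[OF canonical_divisor N(1)]] deg_canonical N(2) euler by (fastforce simp: deg_diff)
  ultimately show ?thesis using N euler by auto
qed

text \<open>Clearing the leaves alters \<open>D\<close> by a principal divisor, which changes
  neither the hypothesis nor, after shifting back, the conclusion.\<close>

lemma moderator_above:
  assumes D: "D \<in> divisors C" and empty: "linsys C D = {}"
  shows "\<exists>N\<in>divisors C. deg N = int (card E) - int (card V) \<and> linsys C (N - D) \<noteq> {} \<and> linsys C (canonical C - N) = {}"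
proof (cases "V0 = {}")
  case True
  then show ?thesis by (rule moderator_above_line[OF _ assms])
next
  case False
  obtain f where f: "rational_fun C f" "Poly_Mapping.keys (D + pdiv f) \<subseteq> core"
    using move_chips[OF move_to_core[OF False] D] by blast
  have "linsys C (D + pdiv f) = {}" using linsys_pdiv[OF D f(1)] empty by blast
  from moderator_above_core[OF False f(2) this] obtain N where N: "N \<in> divisors C" "deg N = int (card E) - int (card V)"
    "linsys C (N - (D + pdiv f)) \<noteq> {}" "linsys C (canonical C - N) = {}" by blast
  have d: "N - (D + pdiv f) \<in> divisors C" by (intro divisors_diff divisors_add N(1) D pdiv_divisor f(1))
  have "linsys C (N - (D + pdiv f) + pdiv f) \<noteq> {}" using linsys_pdiv[OF d f(1)] N(3) by blast
  then have "linsys C (N - D) \<noteq> {}" by (simp add: algebra_simps)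
  then show ?thesis using N by blast
qed

end

theorem theorem7p3:
  fixes C :: "('v, 'e) metric_graph" and D :: "('v, 'e) divisor" and d :: int and g :: nat
  assumes "tropical_curve C"
    and "genus C = g"
    and "D \<in> divisors C"
    and "deg D = d"
  shows "dim_linsys C D - dim_linsys C (canonical C - D) = d - int g + 1"
proof -
  interpret tropical C by unfold_locales (rule assms(1))
  have "dim_linsys C D - dim_linsys C (canonical C - D) = deg D - (int (card E) - int (card V))"
    by (rule riemann_roch[OF moderator_above _ assms(3)]) (simp_all add: deg_canonical)
  then show ?thesis using genus_eq assms(2,4) by simp
qed

end
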